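(* Every atom-free graphing $\mathcal{G}$ is locally-globally equivalent to its Bernoulli lift $\mathcal{G}^+$, i.e. $\overline{Q}_{\mathcal{G},r,k}=\overline{Q}_{\mathcal{G}^+,r,k}$ for all $r,k\ge1$.
   Context: Fix $d\ge1$. A graphing is a graph $\mathcal{G}$ on a Polish space $X$ with Borel probability measure $\nu$, Borel symmetric edge set, all degrees at most $d$, and $\int_A e(x,B)\,d\nu(x)=\int_B e(x,A)\,d\nu(x)$ for all Borel $A,B$, where $e(x,S)$ is the number of edges from $x$ to $S$. It is atom-free if $\nu$ has no point masses. $U^{r,k}$ is the finite set of isomorphism classes of rooted $k$-vertex-colored graphs of radius at most $r$ with degrees at most $d$. For a Borel $c:X\to[k]$, $P_{\mathcal{G},r}[c]$ is the distribution on $U^{r,k}$ of the colored ball $(N_{\mathcal{G},r}(x),c|_{N_{\mathcal{G},r}(x)})$ rooted at $x$, for $x\sim\nu$; $Q_{\mathcal{G},r,k}$ is the set of all such distributions over Borel $k$-colorings $c$, viewed in $\mathbb{R}^{U^{r,k}}$, and $\overline{Q}_{\mathcal{G},r,k}$ is its closure. The Bernoulli lift $\mathcal{G}^+$ of $\mathcal{G}$: for $x\in X$ let $\mathcal{G}_x$ be the connected component of $x$. The underlying set $X^+$ consists of pairs $(x,\xi)$ with $x\in X$ and $\xi:V(\mathcal{G}_x)\to[0,1]$; $(x,\xi)$ is adjacent to $(y,\upsilon)$ iff $y$ is a neighbor of $x$ in $\mathcal{G}$ and $\xi=\upsilon$. The probability measure on $X^+$ is obtained by choosing $x\sim\nu$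 and then independent uniform random weights $\xi(u)\in[0,1]$ for the vertices $u$ of $\mathcal{G}_x$. $\mathcal{G}^+$ is a graphing. *)

theory Defs
  imports "HOL-Probability.Probability"
begin

section \<open>Graphs and rooted coloured graphs\<close>

text \<open>An edge set is a symmetric irreflexive relation, so graphs are simple; every edge
  occurs as two ordered pairs.\<close>

definition simple_graph :: "'v set \<Rightarrow> ('v \<times> 'v) set \<Rightarrow> bool" where
  "simple_graph V E \<longleftrightarrow> E \<subseteq> V \<times> V \<and> sym E \<and> irrefl E"

definition degrees_le :: "nat \<Rightarrow> 'v set \<Rightarrow> ('v \<times> 'v) set \<Rightarrow> bool" where
  "degrees_le d V E \<longleftrightarrow> (\<forall>v\<in>V. finite (E `` {v}) \<and> card (E `` {v}) \<le> d)"

definition ball_verts :: "('v \<times> 'v) set \<Rightarrow> nat \<Rightarrow> 'v \<Rightarrow> 'v set" where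
  "ball_verts E r x = {y. \<exists>n\<le>r. (x, y) \<in> E ^^ n}"

record 'v rcgraph =
  verts :: "'v set"
  edges :: "('v \<times> 'v) set"
  root :: 'v
  colour :: "'v \<Rightarrow> nat"

definition rc_iso :: "'v rcgraph \<Rightarrow> 'w rcgraph \<Rightarrow> bool" where
  "rc_iso G H \<longleftrightarrow> (\<exists>\<phi>. bij_betw \<phi> (verts G) (verts H) \<and>
     (\<forall>u\<in>verts G. \<forall>v\<in>verts G. (u, v) \<in> edges G \<longleftrightarrow> (\<phi> u, \<phi> v) \<in> edges H) \<and>
     \<phi> (root G) = root H \<and>
     (\<forall>v\<in>verts G. colour H (\<phi> v) = colour G v))"

definition rc_graphs :: "nat \<Rightarrow> nat \<Rightarrow> nat \<Rightarrow> 'v rcgraph set" where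
  "rc_graphs d r k = {G. simple_graph (verts G) (edges G) \<and> degrees_le d (verts G) (edges G) \<and>
     root G \<in> verts G \<and> verts G \<subseteq> ball_verts (edges G) r (root G) \<and>
     colour G ` verts G \<subseteq> {1..k}}"

text \<open>The set $U^{r,k}$. Graphs with degrees at most \<open>d\<close> and radius at most \<open>r\<close> are finite,
  so every isomorphism class has representatives with vertices in \<open>nat\<close>.\<close>

definition rc_classes :: "nat \<Rightarrow> nat \<Rightarrow> nat \<Rightarrow> nat rcgraph set set" where
  "rc_classes d r k = rc_graphs d r k //
     {(G, H). G \<in> rc_graphs d r k \<and> H \<in> rc_graphs d r k \<and> rc_iso G H}"


section \<open>Graphings\<close>

definition polish_topology :: "'a topology \<Rightarrow> bool" where
  "polish_topology X \<longleftrightarrow> separable_space X \<and> completely_metrizable_space X"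

text \<open>A graphing consists of a Polish space \<open>X\<close>, a probability measure \<open>\<nu>\<close> on its Borel sets and
  an edge set \<open>E\<close>. As \<open>X\<close> is second countable, the Borel sets of \<open>X \<times> X\<close> are the sets of
  \<open>\<nu> \<Otimes>\<^sub>M \<nu>\<close>.\<close>

definition edges_to :: "('a \<times> 'a) set \<Rightarrow> 'a \<Rightarrow> 'a set \<Rightarrow> nat" where
  "edges_to E x S = card (E `` {x} \<inter> S)"

definition graphing :: "nat \<Rightarrow> 'a topology \<Rightarrow> 'a measure \<Rightarrow> ('a \<times> 'a) set \<Rightarrow> bool" where
  "graphing d X \<nu> E \<longleftrightarrow>
     polish_topology X \<and>
     prob_space \<nu> \<and> space \<nu> = topspace X \<and>
     sets \<nu> = sigma_sets (topspace X) {U. openin X U} \<and>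
     simple_graph (topspace X) E \<and> E \<in> sets (\<nu> \<Otimes>\<^sub>M \<nu>) \<and>
     degrees_le d (topspace X) E \<and>
     (\<forall>A\<in>sets \<nu>. \<forall>B\<in>sets \<nu>.
        (\<integral>\<^sup>+x\<in>A. of_nat (edges_to E x B) \<partial>\<nu>) = (\<integral>\<^sup>+x\<in>B. of_nat (edges_to E x A) \<partial>\<nu>))"

definition atom_free :: "'a measure \<Rightarrow> bool" where
  "atom_free \<nu> \<longleftrightarrow> (\<forall>x\<in>space \<nu>. measure \<nu> {x} = 0)"


section \<open>Local statistics and local-global equivalence\<close>

definition coloured_ball ::
  "('a \<times> 'a) set \<Rightarrow> nat \<Rightarrow> ('a \<Rightarrow> nat) \<Rightarrow> 'a \<Rightarrow> 'a rcgraph" where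
  "coloured_ball E r c x = \<lparr>verts = ball_verts E r x,
     edges = E \<inter> (ball_verts E r x \<times> ball_verts E r x), root = x, colour = c\<rparr>"

text \<open>The distribution $P_{G,r}[c]$, as a vector indexed by $U^{r,k}$.\<close>

definition ball_distribution ::
  "nat \<Rightarrow> 'a measure \<Rightarrow> ('a \<times> 'a) set \<Rightarrow> nat \<Rightarrow> nat \<Rightarrow> ('a \<Rightarrow> nat) \<Rightarrow> nat rcgraph set \<Rightarrow> real" where
  "ball_distribution d \<nu> E r k c =
     (\<lambda>F\<in>rc_classes d r k. measure \<nu> {x\<in>space \<nu>. \<exists>H\<in>F. rc_iso (coloured_ball E r c x) H})"

definition ball_distributions ::
  "nat \<Rightarrow> 'a measure \<Rightarrow> ('a \<times> 'a) set \<Rightarrow> nat \<Rightarrow> nat \<Rightarrow> (nat rcgraph set \<Rightarrow> real) set" where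
  "ball_distributions d \<nu> E r k =
     ball_distribution d \<nu> E r k ` measurable \<nu> (count_space {1..k})"

definition local_global_equivalent :: "nat \<Rightarrow> 'a measure \<Rightarrow> ('a \<times> 'a) set \<Rightarrow>
    'b measure \<Rightarrow> ('b \<times> 'b) set \<Rightarrow> bool" where
  "local_global_equivalent d \<nu> E \<mu> F \<longleftrightarrow> (\<forall>r\<ge>1. \<forall>k\<ge>1.
     powertop_real (rc_classes d r k) closure_of ball_distributions d \<nu> E r k =
     powertop_real (rc_classes d r k) closure_of ball_distributions d \<mu> F r k)"


section \<open>The Bernoulli lift\<close>

definition component :: "('a \<times> 'a) set \<Rightarrow> 'a \<Rightarrow> 'a set" where
  "component E x = E\<^sup>* `` {x}"

definition lift_space :: "'a measure \<Rightarrow> ('a \<times> 'a) set \<Rightarrow> ('a \<times> ('a \<Rightarrow> real)) set" where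
  "lift_space \<nu> E = (SIGMA x:space \<nu>. component E x \<rightarrow>\<^sub>E {0..1})"

text \<open>The Borel structure of the lift is the smallest sigma-algebra that makes the base point
  \<open>x\<close> measurable, and also the weight \<open>\<xi> (f x)\<close> for every Borel choice \<open>f\<close> of a vertex of the
  component of \<open>x\<close>. Countably many \<open>f\<close> enumerating all components generate the same
  sigma-algebra: any other choice agrees with one of them on each piece of a countable Borel
  partition. Hence \<open>(x, \<xi>) \<mapsto> (x, \<lambda>n. \<xi> (f n x))\<close> identifies the lift with a Borel subset of the
  product of the base with a countable power of \<open>{0..1}\<close>.\<close>

definition lift_algebra :: "'a measure \<Rightarrow> ('a \<times> 'a) set \<Rightarrow> ('a \<times> ('a \<Rightarrow> real)) measure" where
  "lift_algebra \<nu> E = sigma (lift_space \<nu> E)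
     ({{(x, \<xi>) \<in> lift_space \<nu> E. x \<in> A} | A. A \<in> sets \<nu>} \<union>
      {{(x, \<xi>) \<in> lift_space \<nu> E. \<xi> (f x) \<in> B} | f B.
         f \<in> measurable \<nu> \<nu> \<and> (\<forall>x\<in>space \<nu>. f x \<in> component E x) \<and> B \<in> sets borel})"

definition lift_measure :: "'a measure \<Rightarrow> ('a \<times> 'a) set \<Rightarrow> ('a \<times> ('a \<Rightarrow> real)) measure" where
  "lift_measure \<nu> E = \<nu> \<bind> (\<lambda>x.
     distr (PiM (component E x) (\<lambda>_. restrict_space lborel {0..1})) (lift_algebra \<nu> E)
       (\<lambda>\<xi>. (x, \<xi>)))"

definition lift_edges :: "'a measure \<Rightarrow> ('a \<times> 'a) set \<Rightarrow>
    (('a \<times> ('a \<Rightarrow> real)) \<times> ('a \<times> ('a \<Rightarrow> real))) set" where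
  "lift_edges \<nu> E = {((x, \<xi>), (y, \<upsilon>)). (x, \<xi>) \<in> lift_space \<nu> E \<and> (y, \<upsilon>) \<in> lift_space \<nu> E \<and>
     (x, y) \<in> E \<and> \<xi> = \<upsilon>}"

end

theory Submission
  imports Defs
begin

text \<open>Pulling colourings back along the projection of the lift gives one inclusion. For the other,
  a Borel colouring \<open>c\<close> of the lift is approximated by one that depends on the base point
  and on the weights at finitely many Borel chosen vertices. Invariance of the measure bounds the
  probability that the two colourings differ somewhere in the ball of radius \<open>r\<close> by a constant times
  the probability that they differ at the root. Next, a partition of the base into small Borel
  cells receives independent uniform weights, one per cell, so that every point carries the weight
  of its cell. If the chosen vertices of two independent random points lie in different cells, they see
  independent uniform weights, exactly as in the lift. Because there are no atoms, this fails with
  probability tending to 0 as the cells shrink, and a second moment estimate yields a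
  deterministic choice of the cell weights for which the ball frequencies are nearly those of the lift.

  Everything rests on the measurability of local statistics, that is, on Borel functions which
  enumerate the neighbours of a point. They exist because a Borel set with finite sections has a
  Borel projection, which is reduced to the Lusin--Souslin theorem on injective images.\<close>

section \<open>Injective images of Borel sets of sequences\<close>

text \<open>A fixed countable partition need not separate the infinitely many vertices of a
  component, whereas finitely many chosen vertices are eventually separated. This is why a colouring
  is first cut down to finitely many weights, and why the resulting disagreement has to be
  controlled on whole balls.

  Weights belong to cells and not to roots, so they look the same from every root of a component;
  one outcome therefore defines a genuine colouring of the base whose balls are balls of the lift.

  Absence of atoms acts through components: they are countable, hence null, so two independent
  points almost surely lie in different components and have disjoint sets of chosen vertices.

  The lift measure is a \<open>bind\<close> over product spaces that vary with the base point. It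
  can be evaluated only once its kernel is known to be measurable, and this needs a Borel numbering
  of every component. The same numbering reduces coloured balls to finite tables and thereby makes
  their events measurable.\<close>

abbreviation seqs :: "(nat \<Rightarrow> 'a::countable) measure" where
  "seqs \<equiv> PiM UNIV (\<lambda>_. count_space UNIV)"

abbreviation prefix :: "nat \<Rightarrow> (nat \<Rightarrow> 'a) \<Rightarrow> 'a list" where
  "prefix n x \<equiv> map x [0..<n]"

lemma prefix_eq_iff: "prefix n x = prefix n y \<longleftrightarrow> (\<forall>i<n. x i = y i)"
  by (auto simp: list_eq_iff_nth_eq)

lemma prefix_limit:
  assumes "\<And>n. length (s n) = n" "\<And>n. \<exists>c. s (Suc n) = s n @ [c]"
  obtains z where "\<And>n. prefix n z = s n"
proof -
  define z where "z i = s (Suc i) ! i" for i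
  have "prefix n z = s n" for n
  proof (induction n)
    case 0
    then show ?case using assms(1)[of 0] by simp
  next
    case (Suc n)
    obtain c where c: "s (Suc n) = s n @ [c]" using assms(2) by blast
    have "z n = c" by (simp add: z_def c nth_append assms(1))
    with Suc c show ?case by simp
  qed
  then show ?thesis by (rule that)
qed

lemma space_seqs [simp]: "space seqs = UNIV"
  by (simp add: space_PiM PiE_UNIV_domain)

lemma measurable_count_space_binary:
  fixes f :: "'a \<Rightarrow> 'b::countable" and g :: "'a \<Rightarrow> 'c::countable"
  assumes "f \<in> measurable M (count_space UNIV)" "g \<in> measurable M (count_space UNIV)"
  shows "(\<lambda>x. h (f x) (g x)) \<in> measurable M (count_space UNIV)"
proof -
  have "(\<lambda>x. h i (g x)) \<in> measurable M (count_space UNIV)" for i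
    by (rule measurable_compose[OF assms(2)]) simp
  then show ?thesis
    by (rule measurable_compose_countable[OF _ assms(1)])
qed

lemma measurable_count_space_UNIV:
  assumes "c \<in> measurable M (count_space A)"
  shows "c \<in> measurable M (count_space UNIV)"
  using measurable_compose[OF assms, of "\<lambda>x. x" "count_space UNIV"] by simp

lemma measurable_map_list:
  fixes f :: "'b \<Rightarrow> 'a \<Rightarrow> 'c::countable"
  assumes "\<And>u. u \<in> set us \<Longrightarrow> f u \<in> measurable M (count_space UNIV)"
  shows "(\<lambda>x. map (\<lambda>u. f u x) us) \<in> measurable M (count_space UNIV)"
  using assms
proof (induction us)
  case (Cons u us)
  then have "(\<lambda>x. f u x # map (\<lambda>u. f u x) us) \<in> measurable M (count_space UNIV)"
    by (intro measurable_count_space_binary[where h="(#)"]) auto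
  then show ?case by simp
qed simp

lemma measurable_seqs_component [measurable]:
  "(\<lambda>x. x i) \<in> measurable seqs (count_space UNIV)"
  by measurable

lemma measurable_prefix [measurable]: "prefix n \<in> measurable seqs (count_space UNIV)"
  by (rule measurable_map_list) simp

lemma measurable_into_seqs:
  assumes "\<And>i. (\<lambda>x. f x i) \<in> measurable M (count_space UNIV)"
  shows "f \<in> measurable M seqs"
proof -
  have "(\<lambda>x i. f x i) \<in> measurable M seqs"
    using assms by (intro measurable_PiM_single') auto
  then show ?thesis by simp
qed

lemma prefix_sets: "{x. P (prefix n x)} \<in> sets seqs"
proof -
  have "prefix n -` Collect P \<inter> space seqs \<in> sets seqs"
    by (rule measurable_sets[OF measurable_prefix]) simp
  then show ?thesis by (simp add: vimage_def)
qed

text \<open>Closedness in the product of discrete topologies: \<open>F\<close> is the set of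
  branches of the tree of its prefixes.\<close>

definition seq_closed :: "(nat \<Rightarrow> 'a) set \<Rightarrow> bool" where
  "seq_closed F \<longleftrightarrow> (\<forall>z. (\<forall>n. \<exists>z'\<in>F. prefix n z' = prefix n z) \<longrightarrow> z \<in> F)"

lemma seq_closedD:
  assumes "seq_closed F" "\<And>n. \<exists>z'\<in>F. prefix n z' = prefix n z"
  shows "z \<in> F"
  using assms unfolding seq_closed_def by blast

definition borel_separated :: "(nat \<Rightarrow> 'a::countable) set \<Rightarrow> (nat \<Rightarrow> 'a) set \<Rightarrow> bool" where
  "borel_separated A B \<longleftrightarrow> (\<exists>C\<in>sets seqs. A \<subseteq> C \<and> C \<inter> B = {})"

text \<open>Used backwards: two countable unions that cannot be separated contain two pieces that
  cannot be separated. The separator is the union over \<open>i\<close> of the intersections over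
  \<open>j\<close>.\<close>

lemma borel_separated_UN:
  fixes A :: "'i::countable \<Rightarrow> (nat \<Rightarrow> 'a::countable) set" and B :: "'j::countable \<Rightarrow> (nat \<Rightarrow> 'a) set"
  assumes "\<And>i j. borel_separated (A i) (B j)"
  shows "borel_separated (\<Union>i. A i) (\<Union>j. B j)"
proof -
  have "\<exists>C. \<forall>i j. C i j \<in> sets seqs \<and> A i \<subseteq> C i j \<and> C i j \<inter> B j = {}"
    using assms unfolding borel_separated_def by meson
  then obtain C where C: "\<And>i j. C i j \<in> sets seqs" "\<And>i j. A i \<subseteq> C i j" "\<And>i j. C i j \<inter> B j = {}"
    by metis
  have "(\<Union>i. \<Inter>j. C i j) \<in> sets seqs"
    using sets.top[of "seqs :: (nat \<Rightarrow> 'a) measure"] by (intro sets.countable_UN'' sets.countable_INT'' C(1)) auto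
  moreover have "(\<Union>i. A i) \<subseteq> (\<Union>i. \<Inter>j. C i j)" using C(2) by blast
  moreover have "(\<Union>i. \<Inter>j. C i j) \<inter> (\<Union>j. B j) = {}" using C(3) by blast
  ultimately show ?thesis unfolding borel_separated_def by blast
qed

text \<open>Lusin's argument. A failure of separation descends along ever longer prefixes to one
  branch \<open>z\<close> of \<open>F\<close> and one branch \<open>w\<close> of \<open>F'\<close>.
  Their images differ at some coordinate, and fixing that coordinate already separates the images of
  small cylinders around them.\<close>

lemma borel_separation:
  fixes F :: "(nat \<Rightarrow> 'c::countable) set" and F' :: "(nat \<Rightarrow> 'd::countable) set"
    and p :: "'c \<Rightarrow> 'a::countable"
  assumes F: "seq_closed F" and F': "seq_closed F'"
    and disj: "(\<lambda>z i. p (z i)) ` F \<inter> (\<lambda>z i. q (z i)) ` F' = {}"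
  shows "borel_separated ((\<lambda>z i. p (z i)) ` F) ((\<lambda>z i. q (z i)) ` F')"
proof (rule ccontr)
  define A where "A s = (\<lambda>z i. p (z i)) ` {z\<in>F. prefix (length s) z = s}" for s
  define B where "B s = (\<lambda>z i. q (z i)) ` {z\<in>F'. prefix (length s) z = s}" for s
  assume "\<not> ?thesis"
  then have ns0: "\<not> borel_separated (A []) (B [])" by (simp add: A_def B_def)
  have A: "A s = (\<Union>c. A (s @ [c]))" and B: "B t = (\<Union>c. B (t @ [c]))" for s t
    by (auto simp: A_def B_def)
  define P where "P n st \<longleftrightarrow> length (fst st) = n \<and> length (snd st) = n \<and>
      \<not> borel_separated (A (fst st)) (B (snd st))" for n :: nat and st
  have "\<exists>f. \<forall>n. P n (f n) \<and> (\<exists>c e. f (Suc n) = (fst (f n) @ [c], snd (f n) @ [e]))"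
  proof (rule dependent_nat_choice[where Q="\<lambda>n x y. \<exists>c e. y = (fst x @ [c], snd x @ [e])"])
    show "\<exists>x. P 0 x" using ns0 by (intro exI[of _ "([],[])"]) (simp add: P_def)
  next
    fix x n assume "P n x"
    then have "\<not> borel_separated (\<Union>c. A (fst x @ [c])) (\<Union>c. B (snd x @ [c]))"
      unfolding P_def A[symmetric] B[symmetric] by simp
    then obtain c e where "\<not> borel_separated (A (fst x @ [c])) (B (snd x @ [e]))"
      using borel_separated_UN[of "\<lambda>c. A (fst x @ [c])" "\<lambda>c. B (snd x @ [c])"] by blast
    with \<open>P n x\<close> show "\<exists>y. P (Suc n) y \<and> (\<exists>c e. y = (fst x @ [c], snd x @ [e]))"
      by (intro exI[of _ "(fst x @ [c], snd x @ [e])"]) (auto simp: P_def)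
  qed
  then obtain f where f: "\<And>n. P n (f n)" "\<And>n. \<exists>c e. f (Suc n) = (fst (f n) @ [c], snd (f n) @ [e])"
    by metis
  have len: "length (fst (f n)) = n" "length (snd (f n)) = n" for n
    using f(1)[of n] by (auto simp: P_def)
  have ext: "\<exists>c. fst (f (Suc n)) = fst (f n) @ [c]" "\<exists>c. snd (f (Suc n)) = snd (f n) @ [c]" for n
    using f(2)[of n] by auto
  obtain z where z: "\<And>n. prefix n z = fst (f n)"
    using prefix_limit[of "\<lambda>n. fst (f n)"] len ext by metis
  obtain w where w: "\<And>n. prefix n w = snd (f n)"
    using prefix_limit[of "\<lambda>n. snd (f n)"] len ext by metis
  have ns: "\<not> borel_separated (A (prefix n z)) (B (prefix n w))" for n
    using f(1)[of n] by (simp add: P_def z w)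
  \<comment> \<open>An empty set is separated from every set, so each cylinder along the branch
    meets \<open>F\<close>.\<close>
  have "A (prefix n z) \<noteq> {}" for n
    using ns[of n] unfolding borel_separated_def by (metis Int_empty_left empty_subsetI sets.empty_sets)
  then have "z \<in> F"
    by (intro seq_closedD[OF F]) (auto simp: A_def)
  have "B (prefix n w) \<noteq> {}" for n
    using ns[of n] sets.top[of seqs] unfolding borel_separated_def by auto
  then have "w \<in> F'"
    by (intro seq_closedD[OF F']) (auto simp: B_def)
  have "(\<lambda>i. p (z i)) \<noteq> (\<lambda>i. q (w i))"
    using disj \<open>z \<in> F\<close> \<open>w \<in> F'\<close> by blast
  then obtain i where i: "p (z i) \<noteq> q (w i)" by auto
  have "{x. prefix (Suc i) x ! i = p (z i)} \<in> sets seqs" by (rule prefix_sets)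
  moreover have "A (prefix (Suc i) z) \<subseteq> {x. prefix (Suc i) x ! i = p (z i)}"
    by (auto simp: A_def prefix_eq_iff nth_append simp del: upt_Suc)
  moreover have "{x. prefix (Suc i) x ! i = p (z i)} \<inter> B (prefix (Suc i) w) = {}"
    using i by (auto simp: B_def prefix_eq_iff nth_append simp del: upt_Suc)
  ultimately show False using ns[of "Suc i"] unfolding borel_separated_def by blast
qed

lemma seq_closed_cylinder:
  assumes "seq_closed F"
  shows "seq_closed {z\<in>F. prefix n z = s}"
  unfolding seq_closed_def
proof (intro allI impI)
  fix z assume *: "\<forall>m. \<exists>z'\<in>{z\<in>F. prefix n z = s}. prefix m z' = prefix m z"
  then have "z \<in> F" by (intro seq_closedD[OF assms]) blast
  moreover have "prefix n z = s" using *[rule_format, of n] by auto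
  ultimately show "z \<in> {z\<in>F. prefix n z = s}" by simp
qed

text \<open>The images of the cylinders of a given length are disjoint; enlarging them to disjoint Borel sets
  exhibits the image as a Borel combination.\<close>

lemma closed_injective_image:
  fixes F :: "(nat \<Rightarrow> 'c::countable) set" and p :: "'c \<Rightarrow> 'a::countable"
  assumes F: "seq_closed F" and inj: "inj_on (\<lambda>z i. p (z i)) F"
  shows "(\<lambda>z i. p (z i)) ` F \<in> sets seqs"
proof -
  define A where "A s = (\<lambda>z i. p (z i)) ` {z\<in>F. prefix (length s) z = s}" for s
  have "borel_separated (A s) (A t)" if "length s = length t" "s \<noteq> t" for s t
    unfolding A_def
  proof (intro borel_separation seq_closed_cylinder F)
    show "(\<lambda>z i. p (z i)) ` {z \<in> F. prefix (length s) z = s} \<inter>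
          (\<lambda>z i. p (z i)) ` {z \<in> F. prefix (length t) z = t} = {}"
      using that inj by (auto simp: inj_on_def)
  qed
  then obtain C where C: "\<And>s t. length s = length t \<Longrightarrow> s \<noteq> t \<Longrightarrow> C s t \<in> sets seqs"
      "\<And>s t. length s = length t \<Longrightarrow> s \<noteq> t \<Longrightarrow> A s \<subseteq> C s t"
      "\<And>s t. length s = length t \<Longrightarrow> s \<noteq> t \<Longrightarrow> C s t \<inter> A t = {}"
    unfolding borel_separated_def by metis
  \<comment> \<open>Agreement with a point of \<open>A s\<close> on the first
    \<open>length s\<close> coordinates makes a point that lies in \<open>B\<close> along a whole
    branch a limit of images. The differences \<open>C s t - C t s\<close> make the sets for strings
    of one length disjoint.\<close>
  define B where "B s = {x. \<exists>y\<in>A s. prefix (length s) y = prefix (length s) x} \<inter>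
      (\<Inter>t. if length t = length s \<and> t \<noteq> s then C s t - C t s else UNIV)" for s
  have B_sets: "B s \<in> sets seqs" for s
    unfolding B_def using C(1) sets.top[of seqs]
    by (intro sets.Int sets.countable_INT'' prefix_sets) (auto intro!: sets.Diff)
  have B_iff: "x \<in> B s \<longleftrightarrow> (\<exists>y\<in>A s. prefix (length s) y = prefix (length s) x) \<and>
      (\<forall>t. length t = length s \<longrightarrow> t \<noteq> s \<longrightarrow> x \<in> C s t \<and> x \<notin> C t s)" for x s
    unfolding B_def Int_iff mem_Collect_eq INT_iff by (auto split: if_split_asm)
  have AB: "A s \<subseteq> B s" for s
  proof
    fix x assume x: "x \<in> A s"
    show "x \<in> B s"
      unfolding B_iff
    proof (intro conjI allI impI)
      show "\<exists>y\<in>A s. prefix (length s) y = prefix (length s) x" using x by blast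
      fix t assume t: "length t = length s" "t \<noteq> s"
      show "x \<in> C s t" using C(2)[of s t] t x by auto
      show "x \<notin> C t s" using C(3)[of t s] t x by auto
    qed
  qed
  have disj: "B s \<inter> B t = {}" if "length s = length t" "s \<noteq> t" for s t
  proof -
    have "B s \<subseteq> C s t - C t s" "B t \<subseteq> C t s - C s t"
      using that by (simp_all add: subset_iff B_iff)
    then show ?thesis by blast
  qed
  \<comment> \<open>The right side asks for one string per length. Disjointness within each length
    forces these strings to extend one another, so they define a branch; this turns a union over
    uncountably many branches into countable operations.\<close>
  have "(\<lambda>z i. p (z i)) ` F = (\<Inter>n. \<Union>s\<in>{s. length s = n}. \<Inter>m\<in>{..n}. B (take m s))" (is "?L = ?R")
  proof
    show "?L \<subseteq> ?R"
    proof
      fix x assume "x \<in> ?L"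
      then obtain z where z: "z \<in> F" "x = (\<lambda>i. p (z i))" by blast
      have "x \<in> B (take m (prefix n z))" if "m \<le> n" for m n
      proof -
        have "take m (prefix n z) = prefix m z" using that by (simp add: take_map)
        then show ?thesis using z AB[of "prefix m z"] by (auto simp: A_def)
      qed
      then show "x \<in> ?R"
        by (auto intro!: exI[of _ "prefix _ z"] simp del: upt_Suc)
    qed
    show "?R \<subseteq> ?L"
    proof
      fix x assume "x \<in> ?R"
      have "\<exists>s. length s = n \<and> (\<forall>m\<le>n. x \<in> B (take m s))" for n
      proof -
        have "x \<in> (\<Union>s\<in>{s. length s = n}. \<Inter>m\<in>{..n}. B (take m s))"
          using \<open>x \<in> ?R\<close> by (rule INT_D) simp
        then show ?thesis unfolding UN_iff INT_iff by auto
      qed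
      then obtain s where s: "\<And>n. length (s n) = n" "\<And>n m. m \<le> n \<Longrightarrow> x \<in> B (take m (s n))"
        by metis
      have "take n (s (Suc n)) = s n" for n
      proof (rule ccontr)
        assume "take n (s (Suc n)) \<noteq> s n"
        then have "B (take n (s (Suc n))) \<inter> B (s n) = {}" by (intro disj) (auto simp: s)
        moreover have "x \<in> B (take n (s (Suc n)))" "x \<in> B (s n)"
          using s(2)[of n "Suc n"] s(2)[of n n] by (auto simp: s(1))
        ultimately show False by blast
      qed
      then have "s (Suc n) = s n @ [last (s (Suc n))]" for n
        using s(1)[of "Suc n"]
        by (metis append_butlast_last_id butlast_conv_take diff_Suc_1 list.size(3) nat.distinct(1))
      then obtain z where z: "\<And>n. prefix n z = s n"
        using prefix_limit[of s] s(1) by metis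
      have close: "\<exists>z'\<in>F. prefix n z' = prefix n z \<and> prefix n (\<lambda>i. p (z' i)) = prefix n x" for n
      proof -
        have "x \<in> B (prefix n z)" using s(2)[of n n] by (simp add: z s(1))
        then show ?thesis by (auto simp: B_def A_def)
      qed
      then have "z \<in> F" by (intro seq_closedD[OF F]) blast
      moreover have "x i = p (z i)" for i
      proof -
        obtain z' where "prefix (Suc i) z' = prefix (Suc i) z" "prefix (Suc i) (\<lambda>i. p (z' i)) = prefix (Suc i) x"
          using close[of "Suc i"] by blast
        then show ?thesis unfolding prefix_eq_iff by (metis lessI)
      qed
      ultimately show "x \<in> ?L" by blast
    qed
  qed
  also have "\<dots> \<in> sets seqs"
    by (intro sets.countable_INT'' sets.countable_UN' sets.countable_INT' B_sets) (auto intro: B_sets)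
  finally show ?thesis .
qed

section \<open>Borel sets as injective projections of closed sets\<close>

text \<open>The second components are room for a witness of membership, unique because the
  projection is injective on \<open>F\<close>. Pairing with \<open>nat\<close> keeps a countable
  alphabet countable.\<close>

definition closed_projection :: "(nat \<Rightarrow> 'a) set \<Rightarrow> bool" where
  "closed_projection B \<longleftrightarrow> (\<exists>F :: (nat \<Rightarrow> 'a \<times> nat) set. seq_closed F \<and>
     inj_on (\<lambda>z i. fst (z i)) F \<and> B = (\<lambda>z i. fst (z i)) ` F)"

lemma closed_projection_basic: "closed_projection {x. x i \<in> A}"
  unfolding closed_projection_def
proof (intro exI[of _ "{z. fst (z i) \<in> A \<and> (\<forall>j. snd (z j) = 0)}"] conjI)
  show "seq_closed {z. fst (z i) \<in> A \<and> (\<forall>j. snd (z j) = (0::nat))}"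
    unfolding seq_closed_def
  proof (intro allI impI)
    fix z :: "nat \<Rightarrow> 'a \<times> nat"
    assume *: "\<forall>n. \<exists>z'\<in>{z. fst (z i) \<in> A \<and> (\<forall>j. snd (z j) = 0)}. prefix n z' = prefix n z"
    have "fst (z i) \<in> A"
      using *[rule_format, of "Suc i"] unfolding prefix_eq_iff by force
    moreover have "snd (z j) = 0" for j
      using *[rule_format, of "Suc j"] unfolding prefix_eq_iff by (metis (mono_tags, lifting) lessI mem_Collect_eq)
    ultimately show "z \<in> {z. fst (z i) \<in> A \<and> (\<forall>j. snd (z j) = 0)}" by simp
  qed
  show "inj_on (\<lambda>z i. fst (z i)) {z. fst (z i) \<in> A \<and> (\<forall>j. snd (z j) = 0)}"
    by (auto simp: inj_on_def fun_eq_iff prod_eq_iff)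
  show "{x. x i \<in> A} = (\<lambda>z i. fst (z i)) ` {z. fst (z i) \<in> A \<and> (\<forall>j. snd (z j) = (0::nat))}"
  proof (intro equalityI subsetI)
    fix x assume "x \<in> {x. x i \<in> A}"
    then show "x \<in> (\<lambda>z i. fst (z i)) ` {z. fst (z i) \<in> A \<and> (\<forall>j. snd (z j) = (0::nat))}"
      by (intro image_eqI[where x="\<lambda>i. (x i, 0)"]) auto
  qed auto
qed

text \<open>The witnesses for all \<open>n\<close> are stored in one label sequence through the
  pairing function. Each is determined by the point, hence so is the whole sequence.\<close>

lemma closed_projection_INT:
  fixes B :: "nat \<Rightarrow> (nat \<Rightarrow> 'a) set"
  assumes "\<And>n. closed_projection (B n)"
  shows "closed_projection (\<Inter>n. B n)"
proof -
  obtain F :: "nat \<Rightarrow> (nat \<Rightarrow> 'a \<times> nat) set" where F: "\<And>n. seq_closed (F n)"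
      "\<And>n. inj_on (\<lambda>z i. fst (z i)) (F n)" "\<And>n. B n = (\<lambda>z i. fst (z i)) ` F n"
    using assms unfolding closed_projection_def by metis
  define T :: "nat \<Rightarrow> (nat \<Rightarrow> 'a \<times> nat) \<Rightarrow> (nat \<Rightarrow> 'a \<times> nat)" where
    "T n z = (\<lambda>i. (fst (z i), snd (z (prod_encode (n, i)))))" for n z
  define G where "G = {z. \<forall>n. T n z \<in> F n}"
  have "seq_closed G"
    unfolding seq_closed_def G_def
  proof (intro allI impI CollectI)
    fix z n assume *: "\<forall>m. \<exists>z'\<in>{z. \<forall>n. T n z \<in> F n}. prefix m z' = prefix m z"
    show "T n z \<in> F n"
    proof (rule seq_closedD[OF F(1)])
      fix m
      \<comment> \<open>A prefix of length \<open>M\<close> covers the positions below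
        \<open>m\<close> and the positions where their labels for \<open>n\<close> are stored. The
        range \<open>{..m}\<close> is never empty, so \<open>Max\<close> is meaningful also for
        \<open>m = 0\<close>.\<close>
      define M where "M = m + Suc (Max ((\<lambda>i. prod_encode (n, i)) ` {..m}))"
      have M: "prod_encode (n, i) < M" if "i < m" for i
        unfolding M_def using that by (intro trans_less_add2 le_imp_less_Suc Max_ge) auto
      obtain z' where z': "\<And>n. T n z' \<in> F n" "prefix M z' = prefix M z"
        using *[rule_format, of M] by blast
      then have "prefix m (T n z') = prefix m (T n z)"
        using M unfolding prefix_eq_iff T_def by (metis M_def trans_less_add1)
      with z' show "\<exists>z'\<in>F n. prefix m z' = prefix m (T n z)" by blast
    qed
  qed
  moreover have "inj_on (\<lambda>z i. fst (z i)) G"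
  proof (rule inj_onI)
    fix z w assume zw: "z \<in> G" "w \<in> G" "(\<lambda>i. fst (z i)) = (\<lambda>i. fst (w i))"
    have "T n z = T n w" for n
      by (rule inj_onD[OF F(2)[of n]]) (use zw in \<open>auto simp: G_def T_def fun_eq_iff\<close>)
    then have *: "snd (z (prod_encode (n, i))) = snd (w (prod_encode (n, i)))" for n i
      by (auto simp: T_def fun_eq_iff)
    have "snd (z j) = snd (w j)" for j
      using *[of "fst (prod_decode j)" "snd (prod_decode j)"] by simp
    with zw(3) show "z = w" by (auto simp: fun_eq_iff prod_eq_iff)
  qed
  moreover have "(\<Inter>n. B n) = (\<lambda>z i. fst (z i)) ` G"
  proof (intro equalityI subsetI)
    fix x assume "x \<in> (\<Inter>n. B n)"
    then have "\<forall>n. \<exists>z\<in>F n. x = (\<lambda>i. fst (z i))" using F(3) by blast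
    then obtain Z where Z: "\<And>n. Z n \<in> F n" "\<And>n. x = (\<lambda>i. fst (Z n i))" by metis
    define z where "z = (\<lambda>j. (x j, snd (Z (fst (prod_decode j)) (snd (prod_decode j)))))"
    have "T n z = Z n" for n
      using Z(2)[of n] by (auto simp: T_def z_def fun_eq_iff prod_eq_iff)
    then have "z \<in> G" using Z by (simp add: G_def)
    then show "x \<in> (\<lambda>z i. fst (z i)) ` G"
      by (intro image_eqI[of _ _ z]) (auto simp: z_def)
  next
    fix x assume "x \<in> (\<lambda>z i. fst (z i)) ` G"
    then obtain z where "z \<in> G" "x = (\<lambda>i. fst (z i))" by blast
    then have "x = (\<lambda>i. fst (T n z i))" "T n z \<in> F n" for n
      by (auto simp: G_def T_def)
    then show "x \<in> (\<Inter>n. B n)" using F(3) by blast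
  qed
  ultimately show ?thesis unfolding closed_projection_def by blast
qed

text \<open>The label at position 0 names the piece; the remaining labels are its witness, shifted
  by one. Disjointness makes the name a function of the point, which keeps the projection
  injective.\<close>

lemma closed_projection_disjoint_UN:
  fixes B :: "nat \<Rightarrow> (nat \<Rightarrow> 'a) set"
  assumes "\<And>n. closed_projection (B n)" and disj: "disjoint_family B"
  shows "closed_projection (\<Union>n. B n)"
proof -
  obtain F :: "nat \<Rightarrow> (nat \<Rightarrow> 'a \<times> nat) set" where F: "\<And>n. seq_closed (F n)"
      "\<And>n. inj_on (\<lambda>z i. fst (z i)) (F n)" "\<And>n. B n = (\<lambda>z i. fst (z i)) ` F n"
    using assms(1) unfolding closed_projection_def by metis
  define T :: "(nat \<Rightarrow> 'a \<times> nat) \<Rightarrow> (nat \<Rightarrow> 'a \<times> nat)" where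
    "T z = (\<lambda>i. (fst (z i), snd (z (Suc i))))" for z
  define G where "G = {z. T z \<in> F (snd (z 0))}"
  have "seq_closed G"
    unfolding seq_closed_def G_def
  proof (intro allI impI CollectI)
    fix z assume *: "\<forall>m. \<exists>z'\<in>{z. T z \<in> F (snd (z 0))}. prefix m z' = prefix m z"
    show "T z \<in> F (snd (z 0))"
    proof (rule seq_closedD[OF F(1)])
      fix m
      obtain z' where z': "T z' \<in> F (snd (z' 0))" "\<forall>i<Suc m. z' i = z i"
        using *[rule_format, of "Suc m"] unfolding prefix_eq_iff by blast
      then have "prefix m (T z') = prefix m (T z)" "T z' \<in> F (snd (z 0))"
        by (auto simp: prefix_eq_iff T_def)
      then show "\<exists>z'\<in>F (snd (z 0)). prefix m z' = prefix m (T z)" by blast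
    qed
  qed
  moreover have "inj_on (\<lambda>z i. fst (z i)) G"
  proof (rule inj_onI)
    fix z w assume zw: "z \<in> G" "w \<in> G" "(\<lambda>i. fst (z i)) = (\<lambda>i. fst (w i))"
    have "(\<lambda>i. fst (z i)) \<in> B (snd (z 0))" "(\<lambda>i. fst (w i)) \<in> B (snd (w 0))"
      using zw(1,2) unfolding G_def F(3) T_def by (auto intro!: rev_image_eqI)
    with zw(3) disj have 0: "snd (z 0) = snd (w 0)"
      unfolding disjoint_family_on_def by (metis IntI UNIV_I empty_iff)
    have "T z = T w"
      by (rule inj_onD[OF F(2)]) (use zw 0 in \<open>auto simp: G_def T_def fun_eq_iff\<close>)
    then have "snd (z (Suc j)) = snd (w (Suc j))" for j
      by (auto simp: T_def fun_eq_iff)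
    then have "snd (z j) = snd (w j)" for j
      using 0 by (cases j) auto
    with zw(3) show "z = w" by (auto simp: fun_eq_iff prod_eq_iff)
  qed
  moreover have "(\<Union>n. B n) = (\<lambda>z i. fst (z i)) ` G"
  proof (intro equalityI subsetI)
    fix x assume "x \<in> (\<Union>n. B n)"
    then obtain n w where w: "w \<in> F n" "x = (\<lambda>i. fst (w i))" using F(3) by blast
    define z where "z = (\<lambda>j. (x j, case j of 0 \<Rightarrow> n | Suc i \<Rightarrow> snd (w i)))"
    have "T z = w"
      using w by (auto simp: T_def z_def fun_eq_iff prod_eq_iff)
    then have "z \<in> G" using w by (simp add: G_def z_def)
    then show "x \<in> (\<lambda>z i. fst (z i)) ` G"
      by (intro image_eqI[of _ _ z]) (auto simp: z_def)
  next
    fix x assume "x \<in> (\<lambda>z i. fst (z i)) ` G"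
    then obtain z where "z \<in> G" "x = (\<lambda>i. fst (z i))" by blast
    then have "x = (\<lambda>i. fst (T z i))" "T z \<in> F (snd (z 0))"
      by (auto simp: G_def T_def)
    then show "x \<in> (\<Union>n. B n)" using F(3) by blast
  qed
  ultimately show ?thesis unfolding closed_projection_def by blast
qed

text \<open>The property is not visibly stable under complements, so the induction carries a set
  together with its complement. A countable union is first made disjoint, which again uses
  complements.\<close>

lemma closed_projection_sets:
  fixes B :: "(nat \<Rightarrow> 'a::countable) set"
  assumes "B \<in> sets seqs"
  shows "closed_projection B"
proof -
  have "B \<in> sigma_sets UNIV {{f. f i \<in> A} | (i::nat) (A::'a set). True}"
    using assms unfolding sets_PiM_single by (simp add: PiE_UNIV_domain)
  then have "closed_projection B \<and> closed_projection (- B)"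
  proof induction
    case (Basic a)
    then obtain i A where "a = {f. f i \<in> A}" by auto
    moreover from this have "- a = {f. f i \<in> - A}" by auto
    ultimately show ?case using closed_projection_basic[of i] by metis
  next
    case Empty
    show ?case using closed_projection_basic[of 0 "{}"] closed_projection_basic[of 0 UNIV] by simp
  next
    case (Compl a)
    then show ?case by (simp add: Compl_eq_Diff_UNIV double_diff)
  next
    case (Union a)
    define b where "b n = (\<Inter>m::nat. if m < n then - a m else a n)" for n
    have b_iff: "x \<in> b n \<longleftrightarrow> x \<in> a n \<and> (\<forall>m<n. x \<notin> a m)" for x n
      unfolding b_def INT_iff by (auto split: if_split_asm)
    have "closed_projection (b n)" for n
      unfolding b_def using Union by (intro closed_projection_INT) auto
    moreover have "disjoint_family b"
      unfolding disjoint_family_on_def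
    proof (intro ballI impI)
      fix m n :: nat assume "m \<noteq> n"
      then consider "m < n" | "n < m" by linarith
      then show "b m \<inter> b n = {}"
        by cases (auto simp: b_iff)
    qed
    moreover have "(\<Union>n. a n) = (\<Union>n. b n)"
    proof (intro equalityI subsetI)
      fix x assume "x \<in> (\<Union>n. a n)"
      then have ex: "\<exists>n. x \<in> a n" by auto
      define n where "n = (LEAST n. x \<in> a n)"
      have "x \<in> a n" "\<And>m. m < n \<Longrightarrow> x \<notin> a m"
        unfolding n_def using ex by (auto intro: LeastI_ex dest: not_less_Least)
      then show "x \<in> (\<Union>n. b n)" by (auto simp: b_iff)
    next
      fix x assume "x \<in> (\<Union>n. b n)"
      then obtain n where "x \<in> b n" by auto
      then have "x \<in> a n" by (simp add: b_iff)
      then show "x \<in> (\<Union>n. a n)" by auto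
    qed
    moreover have "closed_projection (\<Inter>n. - a n)"
      using Union by (intro closed_projection_INT) auto
    ultimately have "closed_projection (\<Union>n. a n)" "closed_projection (\<Inter>n. - a n)"
      using closed_projection_disjoint_UN[of b] by metis+
    then show ?case by (simp only: Compl_UN simp_thms)
  qed
  then show ?thesis ..
qed

text \<open>The Lusin-Souslin theorem for coordinatewise maps. Composing with the injective
  projection of a closed set leaves a map that is again coordinatewise and injective, so the closed
  case suffices.\<close>

theorem injective_image_measurable:
  fixes B :: "(nat \<Rightarrow> 'c::countable) set" and p :: "'c \<Rightarrow> 'a::countable"
  assumes "B \<in> sets seqs" and inj: "inj_on (\<lambda>z i. p (z i)) B"
  shows "(\<lambda>z i. p (z i)) ` B \<in> sets seqs"
proof -
  obtain F :: "(nat \<Rightarrow> 'c \<times> nat) set" where F: "seq_closed F"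
      "inj_on (\<lambda>z i. fst (z i)) F" "B = (\<lambda>z i. fst (z i)) ` F"
    using closed_projection_sets[OF assms(1)] unfolding closed_projection_def by blast
  have "(\<lambda>z i. p (fst (z i))) ` F \<in> sets seqs"
  proof (rule closed_injective_image[OF F(1)])
    show "inj_on (\<lambda>z i. p (fst (z i))) F"
      using comp_inj_on[OF F(2) inj[unfolded F(3)]] by (simp add: o_def)
  qed
  then show ?thesis by (simp add: F(3) image_image)
qed

section \<open>Sets whose sections have boundedly many points\<close>

lemma finite_separated_prefix:
  assumes "finite (S :: (nat \<Rightarrow> 'a) set)"
  shows "\<exists>n. inj_on (prefix n) S"
proof -
  have "\<exists>i. x \<noteq> y \<longrightarrow> x i \<noteq> y i" for x y :: "nat \<Rightarrow> 'a" by auto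
  then obtain i where i: "\<And>x y :: nat \<Rightarrow> 'a. x \<noteq> y \<Longrightarrow> x (i x y) \<noteq> y (i x y)" by metis
  define n where "n = Suc (Max ((\<lambda>(x,y). i x y) ` (S \<times> S)))"
  have "i x y < n" if "x \<in> S" "y \<in> S" for x y
    unfolding n_def using that assms by (intro le_imp_less_Suc Max_ge) auto
  then have "inj_on (prefix n) S"
    unfolding inj_on_def prefix_eq_iff using i by blast
  then show ?thesis ..
qed

text \<open>If no section has more than \<open>m\<close> points, then an \<open>m\<close>-tuple of points of a section with prescribed
  distinct prefixes is determined by the base point, so the projection of the tuples is injective.\<close>

lemma exists_card_ge_measurable:
  fixes B :: "((nat \<Rightarrow> nat) \<times> (nat \<Rightarrow> nat)) set"
  assumes B: "B \<in> sets (seqs \<Otimes>\<^sub>M seqs)"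
    and fin: "\<And>x. finite (B `` {x}) \<and> card (B `` {x}) \<le> m"
  shows "{x. m \<le> card (B `` {x})} \<in> sets seqs"
proof -
  \<comment> \<open>The \<open>m\<close> points are stored as one sequence of lists, the
    \<open>i\<close>-th list holding their \<open>i\<close>-th entries, so that forgetting them is
    the coordinatewise map \<open>fst\<close>.\<close>
  define C :: "nat \<Rightarrow> nat list list \<Rightarrow> (nat \<Rightarrow> nat \<times> nat list) set" where
    "C n ss = {z. (\<forall>i. length (snd (z i)) = m) \<and>
      (\<forall>j<m. (\<lambda>i. fst (z i), \<lambda>i. snd (z i) ! j) \<in> B \<and> prefix n (\<lambda>i. snd (z i) ! j) = ss ! j)}" for n ss
  define S where "S n = {ss :: nat list list. length ss = m \<and> distinct ss}" for n :: nat
  have [measurable]: "(\<lambda>z. f (z i)) \<in> measurable (seqs :: (nat \<Rightarrow> nat \<times> nat list) measure) (count_space UNIV)"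
    for f :: "_ \<Rightarrow> 'z" and i
    by (rule measurable_compose[OF measurable_seqs_component]) simp
  have meas1: "(\<lambda>z. (\<lambda>i. fst (z i), \<lambda>i. snd (z i) ! j)) \<in> measurable (seqs :: (nat \<Rightarrow> nat \<times> nat list) measure) (seqs \<Otimes>\<^sub>M seqs)" for j
    by (intro measurable_Pair measurable_into_seqs) measurable
  have "C n ss \<in> sets seqs" for n ss
  proof -
    have "Measurable.pred (seqs :: (nat \<Rightarrow> nat \<times> nat list) measure) (\<lambda>z. (\<lambda>i. fst (z i), \<lambda>i. snd (z i) ! j) \<in> B)" for j
      by (rule pred_sets2[OF B meas1])
    moreover have "(\<lambda>z. prefix n (\<lambda>i. snd (z i) ! j)) \<in> measurable (seqs :: (nat \<Rightarrow> nat \<times> nat list) measure) (count_space UNIV)" for j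
      by (rule measurable_map_list) measurable
    then have "Measurable.pred (seqs :: (nat \<Rightarrow> nat \<times> nat list) measure) (\<lambda>z. prefix n (\<lambda>i. snd (z i) ! j) = ss ! j)" for j
      by (rule measurable_compose) simp
    ultimately have "Measurable.pred (seqs :: (nat \<Rightarrow> nat \<times> nat list) measure) (\<lambda>z. (\<forall>i. length (snd (z i)) = m) \<and>
      (\<forall>j<m. (\<lambda>i. fst (z i), \<lambda>i. snd (z i) ! j) \<in> B \<and> prefix n (\<lambda>i. snd (z i) ! j) = ss ! j))"
      by measurable
    then show ?thesis unfolding C_def by (simp add: pred_def)
  qed
  moreover have inj: "inj_on (\<lambda>z i. fst (z i)) (C n ss)" if ss: "ss \<in> S n" for n ss
  proof (rule inj_onI)
    fix z w assume zw: "z \<in> C n ss" "w \<in> C n ss" "(\<lambda>i. fst (z i)) = (\<lambda>i. fst (w i))"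
    define x where "x = (\<lambda>i. fst (z i))"
    define Z where "Z j = (\<lambda>i. snd (z i) ! j)" for j
    define W where "W j = (\<lambda>i. snd (w i) ! j)" for j
    have Z: "Z j \<in> B `` {x}" "prefix n (Z j) = ss ! j" if "j < m" for j
      using zw(1) that by (auto simp: C_def Z_def x_def)
    have W: "W j \<in> B `` {x}" "prefix n (W j) = ss ! j" if "j < m" for j
      using zw(2) that unfolding x_def zw(3) by (auto simp: C_def W_def)
    have injZ: "inj_on Z {..<m}"
    proof (rule inj_onI)
      fix j k assume "j \<in> {..<m}" "k \<in> {..<m}" "Z j = Z k"
      then have "ss ! j = ss ! k" using Z(2)[of j] Z(2)[of k] by simp
      then show "j = k" using ss \<open>j \<in> {..<m}\<close> \<open>k \<in> {..<m}\<close> by (auto simp: S_def nth_eq_iff_index_eq)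
    qed
    \<comment> \<open>A section of at most \<open>m\<close> points is exhausted by \<open>m\<close>
      distinct ones, so \<open>z\<close> and \<open>w\<close> list the same points; the prefixes
      then fix the order.\<close>
    have "Z ` {..<m} = B `` {x}"
      using Z fin[of x] by (intro card_seteq) (auto simp: card_image[OF injZ])
    then have ex: "\<exists>k<m. W j = Z k" if "j < m" for j using W(1)[OF that] by auto
    have WZ: "W j = Z j" if "j < m" for j
    proof -
      obtain k where k: "k < m" "W j = Z k" using ex[OF \<open>j < m\<close>] by blast
      then have "ss ! j = ss ! k" using Z(2)[of k] W(2)[OF that] by simp
      then have "j = k" using ss that k by (auto simp: S_def nth_eq_iff_index_eq)
      with k show ?thesis by simp
    qed
    have "snd (z i) = snd (w i)" for i
    proof (rule nth_equalityI)
      show len: "length (snd (z i)) = length (snd (w i))" using zw(1,2) by (simp add: C_def)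
      fix j assume "j < length (snd (z i))"
      then have "j < m" using zw(1) by (simp add: C_def)
      then show "snd (z i) ! j = snd (w i) ! j" using WZ[of j] by (simp add: Z_def W_def fun_eq_iff)
    qed
    then show "z = w" using zw(3) by (auto simp: fun_eq_iff prod_eq_iff)
  qed
  ultimately have im: "(\<lambda>z i. fst (z i)) ` C n ss \<in> sets seqs" if "ss \<in> S n" for n ss
    using that by (intro injective_image_measurable) auto
  have "{x. m \<le> card (B `` {x})} = (\<Union>n. \<Union>ss\<in>S n. (\<lambda>z i. fst (z i)) ` C n ss)"
  proof (intro equalityI subsetI)
    fix x assume "x \<in> {x. m \<le> card (B `` {x})}"
    then have card: "card (B `` {x}) = m" using fin[of x] by simp
    obtain n where n: "inj_on (prefix n) (B `` {x})" using finite_separated_prefix fin by blast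
    obtain ys where ys: "set ys = B `` {x}" "length ys = m" "distinct ys"
      using finite_distinct_list[of "B `` {x}"] fin[of x] card distinct_card by metis
    define z where "z i = (x i, map (\<lambda>y. y i) ys)" for i
    have "(\<lambda>i. snd (z i) ! j) = ys ! j" if "j < m" for j
      using that ys by (auto simp: z_def)
    then have "z \<in> C n (map (prefix n) ys)"
      using ys by (auto simp: C_def z_def)
    moreover have "map (prefix n) ys \<in> S n"
      using n ys by (simp add: S_def distinct_map)
    moreover have "x = (\<lambda>i. fst (z i))" by (simp add: z_def)
    ultimately show "x \<in> (\<Union>n. \<Union>ss\<in>S n. (\<lambda>z i. fst (z i)) ` C n ss)" by blast
  next
    fix x assume "x \<in> (\<Union>n. \<Union>ss\<in>S n. (\<lambda>z i. fst (z i)) ` C n ss)"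
    then obtain n ss z where z: "ss \<in> S n" "z \<in> C n ss" "x = (\<lambda>i. fst (z i))" by blast
    define Z where "Z j = (\<lambda>i. snd (z i) ! j)" for j
    have Z: "Z j \<in> B `` {x}" "prefix n (Z j) = ss ! j" if "j < m" for j
      using z that by (auto simp: C_def Z_def)
    have "inj_on Z {..<m}"
    proof (rule inj_onI)
      fix j k assume "j \<in> {..<m}" "k \<in> {..<m}" "Z j = Z k"
      then have "ss ! j = ss ! k" using Z(2)[of j] Z(2)[of k] by simp
      then show "j = k" using z(1) \<open>j \<in> {..<m}\<close> \<open>k \<in> {..<m}\<close> by (auto simp: S_def nth_eq_iff_index_eq)
    qed
    then have "card {..<m} \<le> card (B `` {x})"
      using Z fin[of x] by (intro card_inj_on_le[of Z]) auto
    then show "x \<in> {x. m \<le> card (B `` {x})}" by simp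
  qed
  also have "\<dots> \<in> sets seqs"
    by (intro sets.countable_UN'' sets.countable_UN' im) (auto intro: im)
  finally show ?thesis .
qed

text \<open>Descending induction on \<open>m\<close> from \<open>Suc d\<close>, where no section is
  large enough. Deleting the sections with more than \<open>m\<close> points, whose base points form
  a Borel set by induction, leaves sections of at most \<open>m\<close> points.\<close>

lemma card_ge_measurable_seqs:
  fixes B :: "((nat \<Rightarrow> nat) \<times> (nat \<Rightarrow> nat)) set"
  assumes B: "B \<in> sets (seqs \<Otimes>\<^sub>M seqs)"
    and fin: "\<And>x. finite (B `` {x}) \<and> card (B `` {x}) \<le> d"
  shows "{x. m \<le> card (B `` {x})} \<in> sets seqs"
proof (cases "m \<le> Suc d")
  case True
  then show ?thesis
  proof (induction rule: inc_induct)
    case base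
    have "{x. Suc d \<le> card (B `` {x})} = {}" using fin by (simp add: not_less_eq_eq)
    then show ?case by simp
  next
    case (step m)
    define D where "D = {x. Suc m \<le> card (B `` {x})}"
    define B' where "B' = B - D \<times> UNIV"
    have D: "D \<in> sets seqs" using step by (simp add: D_def)
    then have "B' \<in> sets (seqs \<Otimes>\<^sub>M seqs)"
      unfolding B'_def using sets.top[of seqs] by (intro sets.Diff B pair_measureI) auto
    moreover have B': "B' `` {x} = (if x \<in> D then {} else B `` {x})" for x by (auto simp: B'_def)
    ultimately have "{x. m \<le> card (B' `` {x})} \<in> sets seqs"
      using fin by (intro exists_card_ge_measurable) (auto simp: D_def)
    then have "D \<union> {x. m \<le> card (B' `` {x})} \<in> sets seqs" using D by auto
    also have "D \<union> {x. m \<le> card (B' `` {x})} = {x. m \<le> card (B `` {x})}"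
      unfolding B' by (auto simp: D_def)
    finally show ?case .
  qed
next
  case False
  then have "\<not> m \<le> card (B `` {x})" for x using fin[of x] by linarith
  then show ?thesis by simp
qed

section \<open>Borel enumeration of finite sections\<close>

text \<open>A point is coded, for every \<open>n\<close>, by the least index of a member of a dense
  sequence within distance \<open>(1/2)^n\<close>, and decoded as a limit. A measurable left inverse
  replaces any description of the range of the code.\<close>

lemma polish_retract_of_seqs:
  assumes X: "polish_topology X" and \<nu>: "space \<nu> = topspace X"
    "sets \<nu> = sigma_sets (topspace X) {U. openin X U}" and ne: "space \<nu> \<noteq> {}"
  shows "\<exists>h k. h \<in> measurable \<nu> (seqs :: (nat \<Rightarrow> nat) measure) \<and> k \<in> measurable seqs \<nu> \<and>
    (\<forall>x\<in>space \<nu>. k (h x) = x)"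
proof -
  obtain M D where "Metric_space M D" and complete: "Metric_space.mcomplete M D"
    and XM: "X = Metric_space.mtopology M D"
    using X unfolding polish_topology_def completely_metrizable_space_def by blast
  then interpret Metric_space M D by simp
  have [simp]: "space \<nu> = M" by (simp add: \<nu> XM)
  obtain C where C: "countable C" "C \<subseteq> M" "mtopology closure_of C = M"
    using X unfolding polish_topology_def separable_space_def XM by auto
  have "C \<noteq> {}" using C(3) ne by auto
  define q where "q = from_nat_into C"
  have q: "q i \<in> M" for i
    using from_nat_into[OF \<open>C \<noteq> {}\<close>, of i] C(2) by (auto simp: q_def)
  have dense: "\<exists>i. D x (q i) < e" if "x \<in> M" "e > 0" for x e
  proof -
    have "x \<in> mtopology closure_of C" using C(3) that by simp
    then have "\<forall>r>0. \<exists>y\<in>C. y \<in> mball x r" unfolding metric_closure_of by simp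
    then obtain y where "y \<in> C" "y \<in> mball x e" using \<open>e > 0\<close> by blast
    then have "y \<in> C" "D x y < e" by auto
    then show ?thesis
      unfolding q_def using C(1) from_nat_into_to_nat_on by metis
  qed
  have ball_sets: "{x\<in>M. D x c < e} \<in> sets \<nu>" if "c \<in> M" for c e
  proof -
    have "{x\<in>M. D x c < e} = mball c e" using that by (auto simp: commute)
    then show ?thesis unfolding \<nu>(2) XM by (simp add: sigma_sets.Basic)
  qed
  define h where "h x n = (LEAST i. D x (q i) < (1/2)^n)" for x n
  have h_meas: "h \<in> measurable \<nu> seqs"
  proof (rule measurable_into_seqs)
    fix n
    have "Measurable.pred \<nu> (\<lambda>x. D x (q i) < (1/2)^n)" for i
      using ball_sets[OF q] by (simp add: pred_def)
    then show "(\<lambda>x. h x n) \<in> measurable \<nu> (count_space UNIV)"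
      unfolding h_def by (rule measurable_Least)
  qed
  have h: "D x (q (h x n)) < (1/2)^n" if "x \<in> M" for x n
    unfolding h_def by (rule LeastI_ex) (rule dense[OF that], simp)
  \<comment> \<open>An explicit Cauchy rate, met by every code \<open>h x\<close> through the
    triangle inequality. It makes the domain of the limit Borel; off \<open>Z\<close> the decoder
    takes the constant value \<open>x0\<close>.\<close>
  define Z where "Z = {\<sigma>. \<forall>m n. D (q (\<sigma> m)) (q (\<sigma> n)) < (1/2)^m + (1/2)^n}"
  obtain x0 where x0: "x0 \<in> M" using ne by auto
  define k where "k \<sigma> = (if \<sigma> \<in> Z then (SOME l. limitin mtopology (\<lambda>n. q (\<sigma> n)) l sequentially) else x0)" for \<sigma>
  have k_lim: "limitin mtopology (\<lambda>n. q (\<sigma> n)) (k \<sigma>) sequentially" if "\<sigma> \<in> Z" for \<sigma>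
  proof -
    have "MCauchy (\<lambda>n. q (\<sigma> n))"
      unfolding MCauchy_def
    proof (intro conjI allI impI)
      show "range (\<lambda>n. q (\<sigma> n)) \<subseteq> M" using q by auto
      fix \<epsilon> :: real assume "0 < \<epsilon>"
      then obtain N where N: "(1/2)^N < \<epsilon>/2"
        using real_arch_pow_inv[of "\<epsilon>/2" "1/2"] by auto
      have "D (q (\<sigma> n)) (q (\<sigma> n')) < \<epsilon>" if "N \<le> n" "N \<le> n'" for n n'
      proof -
        have "(1/2::real)^n \<le> (1/2)^N" "(1/2::real)^n' \<le> (1/2)^N"
          using that by (auto intro: power_decreasing)
        moreover have "D (q (\<sigma> n)) (q (\<sigma> n')) < (1/2)^n + (1/2)^n'"
          using \<open>\<sigma> \<in> Z\<close> by (simp add: Z_def)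
        ultimately show ?thesis using N by linarith
      qed
      then show "\<exists>N. \<forall>n n'. N \<le> n \<longrightarrow> N \<le> n' \<longrightarrow> D (q (\<sigma> n)) (q (\<sigma> n')) < \<epsilon>" by blast
    qed
    then have "\<exists>l. limitin mtopology (\<lambda>n. q (\<sigma> n)) l sequentially"
      using complete unfolding mcomplete_def by blast
    then have "limitin mtopology (\<lambda>n. q (\<sigma> n)) (SOME l. limitin mtopology (\<lambda>n. q (\<sigma> n)) l sequentially) sequentially"
      by (rule someI_ex)
    then show ?thesis using that by (simp add: k_def)
  qed
  then have k_M: "k \<sigma> \<in> M" for \<sigma>
    using x0 limitin_mspace by (cases "\<sigma> \<in> Z") (auto simp: k_def)
  have D_lim: "(\<lambda>n. D (q (\<sigma> n)) c) \<longlonglongrightarrow> D (k \<sigma>) c" if "\<sigma> \<in> Z" "c \<in> M" for \<sigma> c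
  proof (rule LIMSEQ_I)
    fix r :: real assume "0 < r"
    then obtain N where N: "\<And>n. n \<ge> N \<Longrightarrow> D (q (\<sigma> n)) (k \<sigma>) < r"
      using k_lim[OF \<open>\<sigma> \<in> Z\<close>] unfolding limit_metric_sequentially by blast
    have "\<bar>D (q (\<sigma> n)) c - D (k \<sigma>) c\<bar> \<le> D (q (\<sigma> n)) (k \<sigma>)" for n
      using mdist_reverse_triangle[OF q k_M that(2), of "\<sigma> n" \<sigma>] mdist_reverse_triangle[of "q (\<sigma> n)" c "k \<sigma>"]
        q[of "\<sigma> n"] k_M[of \<sigma>] that(2) by (simp add: commute)
    with N show "\<exists>no. \<forall>n\<ge>no. norm (D (q (\<sigma> n)) c - D (k \<sigma>) c) < r"
      by (metis le_less_trans real_norm_def)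
  qed
  have q_meas [measurable]: "(\<lambda>\<sigma>. f (q (\<sigma> i))) \<in> measurable seqs borel" for f :: "'a \<Rightarrow> real" and i
    by (rule measurable_compose[OF measurable_seqs_component]) simp
  have D_meas[measurable]: "(\<lambda>\<sigma>. D (q (\<sigma> i)) (q (\<sigma> j))) \<in> measurable seqs borel" for i j
  proof -
    have "(\<lambda>\<sigma>. D (q a) (q (\<sigma> j))) \<in> measurable seqs borel" for a by (rule q_meas)
    then show ?thesis
      by (rule measurable_compose_countable[where g="\<lambda>\<sigma>. \<sigma> i"]) simp
  qed
  have Z_sets: "Z \<in> sets seqs"
  proof -
    have "Measurable.pred seqs (\<lambda>\<sigma>. \<forall>m n. D (q (\<sigma> m)) (q (\<sigma> n)) < (1/2)^m + (1/2)^n)"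
      by measurable
    then show ?thesis by (simp add: pred_def Z_def)
  qed
  \<comment> \<open>On a ball, measurability reduces to the real sequence of distances to the
    centre. Balls around dense points with radii \<open>(1/2)^n\<close> then exhaust every open
    set.\<close>
  have ball_pre: "k -` mball c e \<in> sets seqs" if "c \<in> M" for c e
  proof -
    have "Measurable.pred seqs (\<lambda>\<sigma>. lim (\<lambda>n. D (q (\<sigma> n)) c) < e)"
      by measurable
    then have L: "{\<sigma>. lim (\<lambda>n. D (q (\<sigma> n)) c) < e} \<in> sets seqs"
      by (simp add: pred_def)
    have mem: "k \<sigma> \<in> mball c e \<longleftrightarrow> (if \<sigma> \<in> Z then lim (\<lambda>n. D (q (\<sigma> n)) c) < e else x0 \<in> mball c e)" for \<sigma>
    proof (cases "\<sigma> \<in> Z")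
      case True
      then have "lim (\<lambda>n. D (q (\<sigma> n)) c) = D (k \<sigma>) c" using D_lim[OF _ that] by (intro limI)
      then show ?thesis using True k_M[of \<sigma>] that by (simp add: commute)
    qed (simp add: k_def)
    have "k -` mball c e = (Z \<inter> {\<sigma>. lim (\<lambda>n. D (q (\<sigma> n)) c) < e}) \<union> (if x0 \<in> mball c e then - Z else {})"
      unfolding vimage_def mem by auto
    also have "\<dots> \<in> sets seqs"
      using sets.compl_sets[OF Z_sets] by (intro sets.Un sets.Int Z_sets L) (simp add: Compl_eq_Diff_UNIV)
    finally show ?thesis .
  qed
  have "k \<in> measurable seqs \<nu>"
  proof (rule measurable_sigma_sets[OF \<nu>(2)])
    show "{U. openin X U} \<subseteq> Pow (topspace X)" using openin_subset by auto
    show "k \<in> space seqs \<rightarrow> topspace X" using k_M by (simp add: XM)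
    fix U assume "U \<in> {U. openin X U}"
    then have U: "openin mtopology U" by (simp add: XM)
    define J where "J = {(i, n). mball (q i) ((1/2)^n) \<subseteq> U}"
    have "U = (\<Union>(i,n)\<in>J. mball (q i) ((1/2)^n))"
    proof (intro equalityI subsetI)
      fix x assume x: "x \<in> U"
      then obtain r where r: "r > 0" "mball x r \<subseteq> U" "x \<in> M"
        using U unfolding openin_mtopology by blast
      obtain n where n: "(1/2)^n < r/2"
        using real_arch_pow_inv[of "r/2" "1/2"] r by auto
      obtain i where i: "D x (q i) < (1/2)^n" using dense[OF r(3), of "(1/2)^n"] by auto
      have "mball (q i) ((1/2)^n) \<subseteq> mball x r"
      proof
        fix y assume "y \<in> mball (q i) ((1/2)^n)"
        then have "y \<in> M" "D (q i) y < (1/2)^n" by auto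
        moreover have "D x y \<le> D x (q i) + D (q i) y" using triangle q r(3) \<open>y \<in> M\<close> by blast
        ultimately show "y \<in> mball x r" using i n r(3) by auto
      qed
      then have "(i, n) \<in> J" using r(2) by (auto simp: J_def)
      moreover have "x \<in> mball (q i) ((1/2)^n)" using i r(3) q by (simp add: commute)
      ultimately show "x \<in> (\<Union>(i,n)\<in>J. mball (q i) ((1/2)^n))" by blast
    qed (auto simp: J_def)
    then have "k -` U = (\<Union>(i,n)\<in>J. k -` mball (q i) ((1/2)^n))" by auto
    also have "\<dots> \<in> sets seqs"
      by (rule sets.countable_UN') (auto simp: split_beta intro: ball_pre[OF q])
    finally show "k -` U \<inter> space seqs \<in> sets seqs" by simp
  qed
  moreover have "k (h x) = x" if "x \<in> M" for x
  proof -
    have "D (q (h x m)) (q (h x n)) < (1/2)^m + (1/2)^n" for m n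
      using triangle[OF q that q, of "h x m" "h x n"] h[OF that, of m] h[OF that, of n]
      by (simp add: commute)
    then have "h x \<in> Z" by (simp add: Z_def)
    have "limitin mtopology (\<lambda>n. q (h x n)) x sequentially"
      unfolding limit_metric_sequentially
    proof (intro conjI allI impI that)
      fix \<epsilon> :: real assume "0 < \<epsilon>"
      then obtain N where N: "(1/2)^N < \<epsilon>"
        using real_arch_pow_inv[of "\<epsilon>" "1/2"] by auto
      have "q (h x n) \<in> M \<and> D (q (h x n)) x < \<epsilon>" if "N \<le> n" for n
      proof -
        have "(1/2::real)^n \<le> (1/2)^N" using that by (auto intro: power_decreasing)
        then have "D x (q (h x n)) < \<epsilon>" using h[OF \<open>x \<in> M\<close>, of n] N by linarith
        then show ?thesis using q by (simp add: commute)
      qed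
      then show "\<exists>N. \<forall>n\<ge>N. q (h x n) \<in> M \<and> D (q (h x n)) x < \<epsilon>" by blast
    qed
    with k_lim[OF \<open>h x \<in> Z\<close>] show ?thesis
      using limitin_metric_unique trivial_limit_sequentially by blast
  qed
  ultimately show ?thesis using h_meas by auto
qed

text \<open>Measurable retracts of the Baire space stand in for standard Borel spaces.\<close>

locale seqs_retract =
  fixes M :: "'a measure" and h :: "'a \<Rightarrow> nat \<Rightarrow> nat" and k :: "(nat \<Rightarrow> nat) \<Rightarrow> 'a"
  assumes h [measurable]: "h \<in> measurable M seqs" and k [measurable]: "k \<in> measurable seqs M"
    and k_h: "\<And>x. x \<in> space M \<Longrightarrow> k (h x) = x"
begin

lemma inj_on_h: "inj_on h (space M)"
  by (rule inj_on_inverseI[where g=k]) (rule k_h)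

text \<open>Injectivity of \<open>h\<close> turns equality of points into countably many equalities
  of natural numbers.\<close>

lemma pred_eq:
  assumes [measurable]: "f \<in> measurable N M" "g \<in> measurable N M"
  shows "Measurable.pred N (\<lambda>x. f x = g x)"
proof -
  have [measurable]: "(\<lambda>x. h (f x) i) \<in> measurable N (count_space UNIV)"
    "(\<lambda>x. h (g x) i) \<in> measurable N (count_space UNIV)" for i
    using assms[THEN measurable_compose[OF _ h], THEN measurable_compose[OF _ measurable_seqs_component]] by auto
  have "Measurable.pred N (\<lambda>x. \<forall>i. h (f x) i = h (g x) i)" by measurable
  also have "?this \<longleftrightarrow> ?thesis"
  proof (rule measurable_cong)
    fix x assume "x \<in> space N"
    then have "f x \<in> space M" "g x \<in> space M" using assms[THEN measurable_space] by auto
    then have "h (f x) = h (g x) \<longleftrightarrow> f x = g x" by (rule inj_on_eq_iff[OF inj_on_h])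
    then show "(\<forall>i. h (f x) i = h (g x) i) \<longleftrightarrow> f x = g x" by (simp add: fun_eq_iff)
  qed
  finally show ?thesis .
qed

lemma card_ge_measurable:
  assumes B: "B \<in> sets (M \<Otimes>\<^sub>M M)"
    and fin: "\<And>x. x \<in> space M \<Longrightarrow> finite (B `` {x}) \<and> card (B `` {x}) \<le> d"
  shows "{x\<in>space M. m \<le> card (B `` {x})} \<in> sets M"
proof -
  \<comment> \<open>The image of \<open>B\<close> under \<open>h\<close> in both coordinates. The
    range of \<open>h\<close> is the set of fixed points of \<open>\<lambda>a. h (k a)\<close>, a
    form in which it is visibly Borel.\<close>
  define B' where "B' = {p. fst p = h (k (fst p)) \<and> snd p = h (k (snd p)) \<and> (k (fst p), k (snd p)) \<in> B}"
  have BM: "B \<subseteq> space M \<times> space M" using sets.sets_into_space[OF B] by (simp add: space_pair_measure)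
  interpret S: seqs_retract seqs id id by unfold_locales (auto simp: id_def)
  have hk: "(\<lambda>p. h (k (fst p))) \<in> measurable (seqs \<Otimes>\<^sub>M seqs) seqs"
    "(\<lambda>p. h (k (snd p))) \<in> measurable (seqs \<Otimes>\<^sub>M seqs) seqs"
    by measurable
  have "Measurable.pred (seqs \<Otimes>\<^sub>M seqs) (\<lambda>p. fst p = h (k (fst p)))"
    by (rule S.pred_eq[OF measurable_fst hk(1)])
  moreover have "Measurable.pred (seqs \<Otimes>\<^sub>M seqs) (\<lambda>p. snd p = h (k (snd p)))"
    by (rule S.pred_eq[OF measurable_snd hk(2)])
  moreover have "Measurable.pred (seqs \<Otimes>\<^sub>M seqs) (\<lambda>p. (k (fst p), k (snd p)) \<in> B)"
    by (rule pred_sets2[OF B]) (rule measurable_Pair measurable_compose[OF measurable_fst k] measurable_compose[OF measurable_snd k])+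
  ultimately have "Measurable.pred (seqs \<Otimes>\<^sub>M seqs)
      (\<lambda>p. fst p = h (k (fst p)) \<and> snd p = h (k (snd p)) \<and> (k (fst p), k (snd p)) \<in> B)"
    by (intro pred_intros_logic)
  then have B'_sets: "B' \<in> sets (seqs \<Otimes>\<^sub>M seqs)"
    by (simp add: pred_def B'_def space_pair_measure)
  have sec: "B' `` {a} = (if a = h (k a) then h ` (B `` {k a}) else {})" for a
    using BM k_h by (auto simp: B'_def image_iff)
  have kM: "k a \<in> space M" for a using measurable_space[OF k, of a] by simp
  have card: "card (h ` (B `` {x})) = card (B `` {x})" for x
    using BM by (intro card_image inj_on_subset[OF inj_on_h]) auto
  have "{a. m \<le> card (B' `` {a})} \<in> sets seqs"
    using fin[OF kM] by (intro card_ge_measurable_seqs[OF B'_sets, of d]) (simp add: sec card)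
  then have "h -` {a. m \<le> card (B' `` {a})} \<inter> space M \<in> sets M"
    by (rule measurable_sets[OF h])
  also have "h -` {a. m \<le> card (B' `` {a})} \<inter> space M = {x\<in>space M. m \<le> card (B `` {x})}"
    using k_h by (auto simp: sec card)
  finally show ?thesis .
qed

lemma projection_measurable:
  assumes B: "B \<in> sets (M \<Otimes>\<^sub>M M)"
    and fin: "\<And>x. x \<in> space M \<Longrightarrow> finite (B `` {x}) \<and> card (B `` {x}) \<le> d"
  shows "{x\<in>space M. B `` {x} \<noteq> {}} \<in> sets M"
proof -
  have "{x\<in>space M. 1 \<le> card (B `` {x})} = {x\<in>space M. B `` {x} \<noteq> {}}"
    using fin by (auto simp: Suc_le_eq card_gt_0_iff)
  then show ?thesis using card_ge_measurable[OF assms, of 1] by simp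
qed

text \<open>A nonempty finite section is separated by prefixes of some length, so some string
  isolates exactly one of its points. The selector takes the point isolated by the first such
  string; on an empty section no string isolates anything and \<open>G\<close> returns
  \<open>x\<close>.\<close>

lemma measurable_selector:
  assumes B: "B \<in> sets (M \<Otimes>\<^sub>M M)"
    and fin: "\<And>x. x \<in> space M \<Longrightarrow> finite (B `` {x}) \<and> card (B `` {x}) \<le> d"
  shows "\<exists>g\<in>measurable M M. \<forall>x\<in>space M. if B `` {x} = {} then g x = x else g x \<in> B `` {x}"
proof -
  have BM: "B \<subseteq> space M \<times> space M" using sets.sets_into_space[OF B] by (simp add: space_pair_measure)
  define Bs where "Bs s = {p \<in> B. prefix (length s) (h (snd p)) = s}" for s
  have sub: "{p \<in> B. Q (snd p)} \<in> sets (M \<Otimes>\<^sub>M M)" if Q: "Measurable.pred M Q" for Q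
  proof -
    have "Measurable.pred (M \<Otimes>\<^sub>M M) (\<lambda>p. Q (snd p))"
      by (rule measurable_compose[OF measurable_snd Q])
    then have "{p\<in>space (M \<Otimes>\<^sub>M M). Q (snd p)} \<in> sets (M \<Otimes>\<^sub>M M)" by (simp add: pred_def)
    with B have "B \<inter> {p\<in>space (M \<Otimes>\<^sub>M M). Q (snd p)} \<in> sets (M \<Otimes>\<^sub>M M)" by (rule sets.Int)
    also have "B \<inter> {p\<in>space (M \<Otimes>\<^sub>M M). Q (snd p)} = {p \<in> B. Q (snd p)}"
      using sets.sets_into_space[OF B] by auto
    finally show ?thesis .
  qed
  have fin_sub: "finite (C `` {x}) \<and> card (C `` {x}) \<le> d" if "C \<subseteq> B" "x \<in> space M" for C x
  proof -
    have "C `` {x} \<subseteq> B `` {x}" using that(1) by auto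
    then show ?thesis using fin[OF that(2)] by (meson card_mono finite_subset le_trans)
  qed
  have h_prefix: "Measurable.pred M (\<lambda>y. prefix n (h y) = s)" for n s
  proof -
    have "(\<lambda>y. prefix n (h y)) \<in> measurable M (count_space UNIV)"
      by (rule measurable_compose[OF h measurable_prefix])
    then show ?thesis by (rule measurable_compose) simp
  qed
  have Bs: "Bs s \<in> sets (M \<Otimes>\<^sub>M M)" for s
    unfolding Bs_def by (rule sub[OF h_prefix])
  define U where "U s x \<longleftrightarrow> card (Bs s `` {x}) = 1" for s x
  have U: "Measurable.pred M (U s)" for s
  proof -
    have "{x\<in>space M. m \<le> card (Bs s `` {x})} \<in> sets M" for m
      by (rule card_ge_measurable[OF Bs, of _ d]) (rule fin_sub, auto simp: Bs_def)
    then have "Measurable.pred M (\<lambda>x. m \<le> card (Bs s `` {x}))" for m by (simp add: pred_def)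
    then have "Measurable.pred M (\<lambda>x. 1 \<le> card (Bs s `` {x}) \<and> \<not> 2 \<le> card (Bs s `` {x}))"
      by (intro pred_intros_logic)
    moreover have "1 \<le> card (Bs s `` {x}) \<and> \<not> 2 \<le> card (Bs s `` {x}) \<longleftrightarrow> U s x" for x
      by (auto simp: U_def)
    ultimately show ?thesis by simp
  qed
  define G where "G j x = (if U (from_nat j) x then THE y. y \<in> Bs (from_nat j) `` {x} else x)" for j x
  have G_in: "Bs (from_nat j) `` {x} = {G j x}" if U1: "U (from_nat j) x" for j x
  proof -
    obtain y where "Bs (from_nat j) `` {x} = {y}"
      using U1 unfolding U_def by (meson card_1_singletonE)
    then show ?thesis using U1 by (simp add: G_def)
  qed
  have G_meas: "G j \<in> measurable M M" for j
  proof (rule measurableI)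
    fix x assume x: "x \<in> space M"
    show "G j x \<in> space M"
    proof (cases "U (from_nat j) x")
      case True
      then have "G j x \<in> Bs (from_nat j) `` {x}" using G_in by blast
      then show ?thesis using BM by (auto simp: Bs_def)
    qed (simp add: G_def x)
  next
    fix S assume S: "S \<in> sets M"
    then have S': "Measurable.pred M (\<lambda>y. y \<in> S)" by simp
    \<comment> \<open>Where the string isolates a point, \<open>G j x\<close> lies in
      \<open>S\<close> exactly if the section of \<open>C\<close> is nonempty, and the projection of
      \<open>C\<close> is Borel.\<close>
    define C where "C = {p \<in> B. prefix (length (from_nat j :: nat list)) (h (snd p)) = from_nat j \<and> snd p \<in> S}"
    have "C \<in> sets (M \<Otimes>\<^sub>M M)"
      unfolding C_def by (rule sub) (intro pred_intros_logic h_prefix S')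
    then have "{x\<in>space M. C `` {x} \<noteq> {}} \<in> sets M"
      by (rule projection_measurable[of _ d]) (rule fin_sub, auto simp: C_def)
    then have C: "Measurable.pred M (\<lambda>x. C `` {x} \<noteq> {})" by (simp add: pred_def)
    have "Measurable.pred M (\<lambda>x. if U (from_nat j) x then C `` {x} \<noteq> {} else x \<in> S)"
      using U[of "from_nat j"] C S' by measurable
    then have "{x\<in>space M. if U (from_nat j) x then C `` {x} \<noteq> {} else x \<in> S} \<in> sets M"
      by (simp add: pred_def)
    also have "{x\<in>space M. if U (from_nat j) x then C `` {x} \<noteq> {} else x \<in> S} = G j -` S \<inter> space M"
    proof -
      have "C `` {x} \<noteq> {} \<longleftrightarrow> G j x \<in> S" if "U (from_nat j) x" for x
      proof -
        have "C `` {x} = Bs (from_nat j) `` {x} \<inter> S" by (auto simp: C_def Bs_def)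
        then show ?thesis using G_in[OF that] by auto
      qed
      then show ?thesis by (auto simp: G_def)
    qed
    finally show "G j -` S \<inter> space M \<in> sets M" .
  qed
  define g where "g x = G (LEAST j. U (from_nat j) x) x" for x
  have g_meas: "g \<in> measurable M M"
    unfolding g_def
    by (rule measurable_compose_countable[OF G_meas]) (rule measurable_Least, rule U)
  moreover have "if B `` {x} = {} then g x = x else g x \<in> B `` {x}" if x: "x \<in> space M" for x
  proof (cases "B `` {x} = {}")
    case True
    then have "\<not> U s x" for s by (auto simp: U_def Bs_def Image_def)
    then show ?thesis using True by (simp add: g_def G_def)
  next
    case False
    then obtain y where y: "y \<in> B `` {x}" by blast
    obtain n where n: "inj_on (prefix n) (h ` (B `` {x}))"
      using finite_separated_prefix fin[OF x] by blast
    have "Bs (prefix n (h y)) `` {x} = {y}"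
    proof -
      have "z = y" if "z \<in> B `` {x}" "prefix n (h z) = prefix n (h y)" for z
      proof -
        have "h z = h y" by (rule inj_onD[OF n]) (use that y in auto)
        then show ?thesis by (rule inj_onD[OF inj_on_h]) (use that y BM in blast)+
      qed
      then show ?thesis using y by (auto simp: Bs_def)
    qed
    then have "U (from_nat (to_nat (prefix n (h y)))) x" by (simp add: U_def)
    then have "U (from_nat (LEAST j. U (from_nat j) x)) x" by (rule LeastI)
    from G_in[OF this] have "g x \<in> Bs (from_nat (LEAST j. U (from_nat j) x)) `` {x}"
      by (simp add: g_def)
    then show ?thesis using False by (auto simp: Bs_def)
  qed
  ultimately show ?thesis by blast
qed

text \<open>Selecting a point and deleting it lowers the bound on the sections by one. Inserting
  \<open>x\<close> on both sides absorbs the surplus functions, since the selector returns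
  \<open>x\<close> when nothing is left.\<close>

theorem measurable_enumeration:
  assumes B: "B \<in> sets (M \<Otimes>\<^sub>M M)"
    and fin: "\<And>x. x \<in> space M \<Longrightarrow> finite (B `` {x}) \<and> card (B `` {x}) \<le> d"
  shows "\<exists>g. (\<forall>i. g i \<in> measurable M M) \<and>
    (\<forall>x\<in>space M. insert x (B `` {x}) = insert x ((\<lambda>i. g i x) ` {..<d::nat}))"
  using assms
proof (induction d arbitrary: B)
  case 0
  then have "B `` {x} = {}" if "x \<in> space M" for x using that by fastforce
  then show ?case by (intro exI[of _ "\<lambda>i x. x"]) auto
next
  case (Suc d)
  obtain g0 where g0: "g0 \<in> measurable M M"
      "\<And>x. x \<in> space M \<Longrightarrow> if B `` {x} = {} then g0 x = x else g0 x \<in> B `` {x}"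
    using measurable_selector[OF Suc.prems] by blast
  define C where "C = {p \<in> B. snd p \<noteq> g0 (fst p)}"
  have "Measurable.pred (M \<Otimes>\<^sub>M M) (\<lambda>p. snd p \<noteq> g0 (fst p))"
    using measurable_compose[OF measurable_fst g0(1)] by (intro pred_intros_logic pred_eq measurable_snd) auto
  then have "B \<inter> {p\<in>space (M \<Otimes>\<^sub>M M). snd p \<noteq> g0 (fst p)} \<in> sets (M \<Otimes>\<^sub>M M)"
    using Suc.prems(1) by (intro sets.Int) (auto simp: pred_def)
  also have "B \<inter> {p\<in>space (M \<Otimes>\<^sub>M M). snd p \<noteq> g0 (fst p)} = C"
    using sets.sets_into_space[OF Suc.prems(1)] by (auto simp: C_def)
  finally have C_sets: "C \<in> sets (M \<Otimes>\<^sub>M M)" .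
  have C: "C `` {x} = B `` {x} - {g0 x}" for x by (auto simp: C_def)
  have fin_C: "finite (C `` {x}) \<and> card (C `` {x}) \<le> d" if x: "x \<in> space M" for x
    using Suc.prems(2)[OF x] g0(2)[OF x] unfolding C
    by (cases "B `` {x} = {}") (auto simp: card_Diff_singleton)
  have "\<exists>g. (\<forall>i. g i \<in> measurable M M) \<and>
      (\<forall>x\<in>space M. insert x (C `` {x}) = insert x ((\<lambda>i. g i x) ` {..<d}))"
    by (rule Suc.IH[OF C_sets fin_C])
  then obtain g where g: "\<And>i. g i \<in> measurable M M"
      "\<And>x. x \<in> space M \<Longrightarrow> insert x (C `` {x}) = insert x ((\<lambda>i. g i x) ` {..<d})"
    by (elim exE conjE) (rule that, simp_all)
  define g' where "g' i = (case i of 0 \<Rightarrow> g0 | Suc j \<Rightarrow> g j)" for i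
  have im: "(\<lambda>i. g' i x) ` {..<Suc d} = insert (g0 x) ((\<lambda>i. g i x) ` {..<d})" for x
    unfolding lessThan_Suc_eq_insert_0 by (auto simp: g'_def image_image)
  have "insert x (B `` {x}) = insert x ((\<lambda>i. g' i x) ` {..<Suc d})" if x: "x \<in> space M" for x
  proof -
    have "insert x (B `` {x}) = insert (g0 x) (insert x (C `` {x}))"
      using g0(2)[OF x] unfolding C by (auto split: if_splits)
    also have "\<dots> = insert (g0 x) (insert x ((\<lambda>i. g i x) ` {..<d}))" by (simp only: g(2)[OF x])
    finally show ?thesis unfolding im by (simp add: insert_commute)
  qed
  moreover have "g' i \<in> measurable M M" for i
    using g0(1) g(1) by (cases i) (auto simp: g'_def)
  ultimately show ?case by blast
qed

end

section \<open>Balls, colourings and the sigma-algebras of the lift\<close>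

lemma rc_iso_trans:
  assumes "rc_iso G H" "rc_iso H K"
  shows "rc_iso G K"
proof -
  obtain p where p: "bij_betw p (verts G) (verts H)"
      "\<forall>u\<in>verts G. \<forall>v\<in>verts G. (u, v) \<in> edges G \<longleftrightarrow> (p u, p v) \<in> edges H"
      "p (root G) = root H" "\<forall>v\<in>verts G. colour H (p v) = colour G v"
    using assms(1) unfolding rc_iso_def by blast
  obtain q where q: "bij_betw q (verts H) (verts K)"
      "\<forall>u\<in>verts H. \<forall>v\<in>verts H. (u, v) \<in> edges H \<longleftrightarrow> (q u, q v) \<in> edges K"
      "q (root H) = root K" "\<forall>v\<in>verts H. colour K (q v) = colour H v"
    using assms(2) unfolding rc_iso_def by blast
  have pH: "p v \<in> verts H" if "v \<in> verts G" for v
    using p(1) that by (rule bij_betwE[rule_format])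
  show ?thesis
    unfolding rc_iso_def
  proof (intro exI[of _ "q \<circ> p"] conjI ballI)
    show "bij_betw (q \<circ> p) (verts G) (verts K)" using p(1) q(1) by (rule bij_betw_trans)
  qed (use p q pH in auto)
qed

text \<open>The vertices of both balls are addressed by one index set \<open>W\<close>, possibly
  several times. Equal coincidences among the addresses make the map from \<open>a u\<close> to
  \<open>b u\<close> well defined and injective.\<close>

lemma rc_iso_coloured_ballI:
  assumes ball1: "ball_verts E1 r x = a ` W" and ball2: "ball_verts E2 r y = b ` W"
    and eq: "\<And>u v. u \<in> W \<Longrightarrow> v \<in> W \<Longrightarrow> a u = a v \<longleftrightarrow> b u = b v"
    and edge: "\<And>u v. u \<in> W \<Longrightarrow> v \<in> W \<Longrightarrow> (a u, a v) \<in> E1 \<longleftrightarrow> (b u, b v) \<in> E2"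
    and root: "w \<in> W" "a w = x" "b w = y"
    and col: "\<And>u. u \<in> W \<Longrightarrow> c2 (b u) = c1 (a u)"
  shows "rc_iso (coloured_ball E1 r c1 x) (coloured_ball E2 r c2 y)"
proof -
  define p where "p v = b (SOME u. u \<in> W \<and> a u = v)" for v
  have p: "p (a u) = b u" if "u \<in> W" for u
  proof -
    have "(SOME u'. u' \<in> W \<and> a u' = a u) \<in> W \<and> a (SOME u'. u' \<in> W \<and> a u' = a u) = a u"
      by (rule someI[of _ u]) (simp add: that)
    then show ?thesis unfolding p_def using eq that by blast
  qed
  have "inj_on p (a ` W)"
  proof (rule inj_onI)
    fix s t assume "s \<in> a ` W" "t \<in> a ` W" and st: "p s = p t"
    then obtain u v where "u \<in> W" "v \<in> W" "s = a u" "t = a v" by blast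
    then show "s = t" using st p eq by simp
  qed
  moreover have "p ` (a ` W) = b ` W"
    unfolding image_image by (rule image_cong[OF refl p])
  ultimately have bij: "bij_betw p (a ` W) (b ` W)" by (simp add: bij_betw_def)
  show ?thesis
    unfolding rc_iso_def
  proof (intro exI[of _ p] conjI ballI)
    show "bij_betw p (verts (coloured_ball E1 r c1 x)) (verts (coloured_ball E2 r c2 y))"
      using bij by (simp add: coloured_ball_def ball1 ball2)
    show "p (rcgraph.root (coloured_ball E1 r c1 x)) = rcgraph.root (coloured_ball E2 r c2 y)"
      using p[OF root(1)] root by (simp add: coloured_ball_def)
  next
    fix s assume "s \<in> verts (coloured_ball E1 r c1 x)"
    then obtain u where "u \<in> W" "s = a u" by (auto simp: coloured_ball_def ball1)
    then show "colour (coloured_ball E2 r c2 y) (p s) = colour (coloured_ball E1 r c1 x) s"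
      using p col by (simp add: coloured_ball_def)
  next
    fix s t assume "s \<in> verts (coloured_ball E1 r c1 x)" "t \<in> verts (coloured_ball E1 r c1 x)"
    then obtain u v where "u \<in> W" "s = a u" "v \<in> W" "t = a v"
      by (auto simp: coloured_ball_def ball1)
    then show "(s, t) \<in> edges (coloured_ball E1 r c1 x) \<longleftrightarrow>
        (p s, p t) \<in> edges (coloured_ball E2 r c2 y)"
      using p edge by (simp add: coloured_ball_def ball1 ball2)
  qed
qed

definition ball_in ::
    "('v \<times> 'v) set \<Rightarrow> nat \<Rightarrow> ('v \<Rightarrow> nat) \<Rightarrow> nat rcgraph set \<Rightarrow> 'v \<Rightarrow> bool" where
  "ball_in E r c F x \<longleftrightarrow> (\<exists>H\<in>F. rc_iso (coloured_ball E r c x) H)"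

lemma ball_in_cong:
  assumes ball1: "ball_verts E1 r x = a ` W" and ball2: "ball_verts E2 r y = b ` W"
    and eq: "\<And>u v. u \<in> W \<Longrightarrow> v \<in> W \<Longrightarrow> a u = a v \<longleftrightarrow> b u = b v"
    and edge: "\<And>u v. u \<in> W \<Longrightarrow> v \<in> W \<Longrightarrow> (a u, a v) \<in> E1 \<longleftrightarrow> (b u, b v) \<in> E2"
    and root: "w \<in> W" "a w = x" "b w = y"
    and col: "\<And>u. u \<in> W \<Longrightarrow> c2 (b u) = c1 (a u)"
  shows "ball_in E1 r c1 F x \<longleftrightarrow> ball_in E2 r c2 F y"
proof -
  have "rc_iso (coloured_ball E1 r c1 x) (coloured_ball E2 r c2 y)"
    by (rule rc_iso_coloured_ballI[OF ball1 ball2 _ _ root]) (auto simp: eq edge col)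
  moreover have "rc_iso (coloured_ball E2 r c2 y) (coloured_ball E1 r c1 x)"
    by (rule rc_iso_coloured_ballI[OF ball2 ball1 _ _ root(1,3,2)]) (auto simp: eq edge col)
  ultimately show ?thesis unfolding ball_in_def by (meson rc_iso_trans)
qed

text \<open>Up to isomorphism the coloured ball is determined by a finite table of coincidences,
  adjacencies and colours of the addressed vertices. The table takes countably many values, so any
  union of its fibres is measurable.\<close>

lemma ball_in_measurable:
  fixes a :: "'i \<Rightarrow> 'v \<Rightarrow> 'v"
  assumes W: "finite W" and w: "w \<in> W" "\<And>x. x \<in> space N \<Longrightarrow> a w x = x"
    and ball: "\<And>x. x \<in> space N \<Longrightarrow> ball_verts E r x = (\<lambda>u. a u x) ` W"
    and eq: "\<And>u v. u \<in> W \<Longrightarrow> v \<in> W \<Longrightarrow> Measurable.pred N (\<lambda>x. a u x = a v x)"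
    and edge: "\<And>u v. u \<in> W \<Longrightarrow> v \<in> W \<Longrightarrow> Measurable.pred N (\<lambda>x. (a u x, a v x) \<in> E)"
    and col: "\<And>u. u \<in> W \<Longrightarrow> (\<lambda>x. c (a u x)) \<in> measurable N (count_space UNIV)"
  shows "{x\<in>space N. ball_in E r c F x} \<in> sets N"
proof -
  obtain ws where ws: "set ws = W" using finite_list[OF W] by blast
  define D where "D x = map (\<lambda>u. map (\<lambda>v. (c (a u x), a u x = a v x, (a u x, a v x) \<in> E)) ws) ws" for x
  have bools: "(\<lambda>x. (a u x = a v x, (a u x, a v x) \<in> E)) \<in> measurable N (count_space UNIV)"
    if "u \<in> W" "v \<in> W" for u v
    using that by (intro measurable_count_space_binary[where h=Pair] eq edge)
  have "(\<lambda>x. (c (a u x), a u x = a v x, (a u x, a v x) \<in> E)) \<in> measurable N (count_space UNIV)"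
    if "u \<in> W" "v \<in> W" for u v
    using that by (intro measurable_count_space_binary[where h=Pair] col bools)
  then have D_meas: "D \<in> measurable N (count_space UNIV)"
    unfolding D_def[abs_def] by (intro measurable_map_list) (auto simp: ws)
  have D_eq: "ball_in E r c F x \<longleftrightarrow> ball_in E r c F y" if "D x = D y" "x \<in> space N" "y \<in> space N" for x y
  proof -
    have *: "c (a u x) = c (a u y)" "a u x = a v x \<longleftrightarrow> a u y = a v y"
        "(a u x, a v x) \<in> E \<longleftrightarrow> (a u y, a v y) \<in> E" if "u \<in> W" "v \<in> W" for u v
      using \<open>D x = D y\<close> that unfolding D_def ws[symmetric] map_eq_conv by auto
    show ?thesis
      by (rule ball_in_cong[OF ball[OF that(2)] ball[OF that(3)] _ _ w(1) w(2)[OF that(2)] w(2)[OF that(3)]])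
        (use * in auto)
  qed
  have "{x\<in>space N. ball_in E r c F x} = D -` (D ` {x\<in>space N. ball_in E r c F x}) \<inter> space N"
    using D_eq by auto
  also have "\<dots> \<in> sets N" by (rule measurable_sets[OF D_meas]) simp
  finally show ?thesis .
qed

lemma component_refl: "x \<in> component E x"
  by (simp add: component_def)

lemma component_eq:
  assumes "sym E" "y \<in> component E x"
  shows "component E y = component E x"
proof -
  have "(x, y) \<in> E\<^sup>*" "(y, x) \<in> E\<^sup>*"
    using assms sym_rtrancl[OF assms(1)] by (auto simp: component_def sym_def)
  then show ?thesis unfolding component_def by (auto intro: rtrancl_trans)
qed

section \<open>Uniform weights and graphs with enumerated neighbours\<close>

abbreviation unit_measure :: "real measure" where
  "unit_measure \<equiv> restrict_space lborel {0..1}"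

lemma prob_space_unit_measure: "prob_space unit_measure"
  by (rule prob_spaceI) (simp add: space_restrict_space emeasure_restrict_space)

lemma space_unit_measure [simp]: "space unit_measure = {0..1}"
  by (simp add: space_restrict_space)

lemma unit_measure_borel: "(\<lambda>t. t) \<in> borel_measurable unit_measure"
  by (rule measurable_restrict_space1) simp

abbreviation weights :: "(nat \<Rightarrow> real) measure" where
  "weights \<equiv> PiM UNIV (\<lambda>_. unit_measure)"

lemma prob_space_PiM_unit: "prob_space (PiM I (\<lambda>_. unit_measure))"
  by (intro prob_space_PiM prob_space_unit_measure)

lemma PiM_unit_component:
  assumes "i \<in> I"
  shows "(\<lambda>\<omega>. \<omega> i) \<in> borel_measurable (PiM I (\<lambda>_. unit_measure))"
  by (rule measurable_compose[OF measurable_component_singleton[OF assms] unit_measure_borel])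

text \<open>Each \<open>g i\<close> stays or moves along an edge. The invariance of the graphing
  enters only as \<open>g_emeasure\<close>, whose factor allows for \<open>d\<close> edges and for
  staying. By \<open>g_id\<close> letters from \<open>d\<close> on act trivially, so every list of
  numbers is a legitimate word.\<close>

locale enumerated_graph = seqs_retract \<nu> h k + prob_space \<nu>
  for \<nu> :: "'a measure" and h k +
  fixes E :: "('a \<times> 'a) set" and g :: "nat \<Rightarrow> 'a \<Rightarrow> 'a" and d :: nat
  assumes E_sets: "E \<in> sets (\<nu> \<Otimes>\<^sub>M \<nu>)" and sym_E: "sym E"
    and g_measurable: "g i \<in> measurable \<nu> \<nu>"
    and g_neighbours: "x \<in> space \<nu> \<Longrightarrow> insert x (E `` {x}) = insert x ((\<lambda>i. g i x) ` {..<d})"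
    and g_id: "d \<le> i \<Longrightarrow> g i x = x"
    and g_emeasure: "A \<in> sets \<nu> \<Longrightarrow> emeasure \<nu> (g i -` A \<inter> space \<nu>) \<le> of_nat (Suc d) * emeasure \<nu> A"
begin

definition act :: "nat list \<Rightarrow> 'a \<Rightarrow> 'a" where
  "act u x = foldr g u x"

lemma act_simps [simp]: "act [] x = x" "act (i # u) x = g i (act u x)"
  by (simp_all add: act_def)

definition words :: "nat \<Rightarrow> nat list set" where
  "words r = {u. set u \<subseteq> {..<d} \<and> length u \<le> r}"

lemma finite_words: "finite (words r)"
  unfolding words_def by (rule finite_lists_length_le) simp

lemma Nil_words: "[] \<in> words r"
  by (simp add: words_def)

lemma act_measurable: "act u \<in> measurable \<nu> \<nu>"
proof (induction u)
  case (Cons i u)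
  then have "(\<lambda>x. g i (act u x)) \<in> measurable \<nu> \<nu>"
    by (rule measurable_compose) (rule g_measurable)
  then show ?case by simp
qed (simp add: act_def)

lemma act_space: "x \<in> space \<nu> \<Longrightarrow> act u x \<in> space \<nu>"
  using act_measurable by (rule measurable_space)

lemma E_space: "E \<subseteq> space \<nu> \<times> space \<nu>"
  using sets.sets_into_space[OF E_sets] by (simp add: space_pair_measure)

lemma g_step:
  assumes "x \<in> space \<nu>"
  shows "g i x = x \<or> (x, g i x) \<in> E"
  using g_neighbours[OF assms] g_id[of i x] by (cases "i < d") (blast, simp)

lemma relpow_words:
  assumes "x \<in> space \<nu>" "(x, y) \<in> E ^^ n"
  shows "\<exists>u\<in>words n. y = act u x"
  using assms(2)
proof (induction n arbitrary: y)
  case 0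
  then show ?case by (auto intro!: bexI[of _ "[]"] simp: words_def)
next
  case (Suc n)
  then obtain z where z: "(x, z) \<in> E ^^ n" "(z, y) \<in> E" by auto
  from Suc.IH[OF z(1)] obtain u where u: "u \<in> words n" "z = act u x" by blast
  have "y \<in> insert z ((\<lambda>i. g i z) ` {..<d})"
    using g_neighbours[of z] z(2) E_space by blast
  then consider "y = z" | i where "i < d" "y = g i z" by blast
  then show ?case
  proof cases
    case 1
    then show ?thesis using u by (intro bexI[of _ u]) (auto simp: words_def)
  next
    case 2
    then show ?thesis using u by (intro bexI[of _ "i # u"]) (auto simp: words_def)
  qed
qed

lemma act_relpow:
  assumes "x \<in> space \<nu>"
  shows "\<exists>n\<le>length u. (x, act u x) \<in> E ^^ n"
proof (induction u)
  case (Cons i u)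
  then obtain n where n: "n \<le> length u" "(x, act u x) \<in> E ^^ n" by blast
  show ?case
  proof (cases "g i (act u x) = act u x")
    case True
    then show ?thesis using n by (intro exI[of _ n]) simp
  next
    case False
    then have "(act u x, g i (act u x)) \<in> E" using g_step[OF act_space[OF assms]] by blast
    then show ?thesis using n by (intro exI[of _ "Suc n"]) auto
  qed
qed simp

lemma ball_verts_words:
  assumes "x \<in> space \<nu>"
  shows "ball_verts E r x = (\<lambda>u. act u x) ` words r"
proof
  show "ball_verts E r x \<subseteq> (\<lambda>u. act u x) ` words r"
  proof
    fix y assume "y \<in> ball_verts E r x"
    then obtain n where "n \<le> r" "(x, y) \<in> E ^^ n" by (auto simp: ball_verts_def)
    then obtain u where "u \<in> words n" "y = act u x" using relpow_words[OF assms] by blast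
    then show "y \<in> (\<lambda>u. act u x) ` words r" using \<open>n \<le> r\<close> by (auto simp: words_def)
  qed
  show "(\<lambda>u. act u x) ` words r \<subseteq> ball_verts E r x"
  proof
    fix y assume "y \<in> (\<lambda>u. act u x) ` words r"
    then obtain u where u: "length u \<le> r" "y = act u x" by (auto simp: words_def)
    then show "y \<in> ball_verts E r x" using act_relpow[OF assms, of u]
      by (auto simp: ball_verts_def intro: le_trans)
  qed
qed

lemma component_act:
  assumes "x \<in> space \<nu>"
  shows "component E x = range (\<lambda>u. act u x)"
proof
  show "component E x \<subseteq> range (\<lambda>u. act u x)"
    using relpow_words[OF assms] by (fastforce simp: component_def rtrancl_power)
  show "range (\<lambda>u. act u x) \<subseteq> component E x"
    using act_relpow[OF assms] by (fastforce simp: component_def rtrancl_power)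
qed

lemma component_space: "x \<in> space \<nu> \<Longrightarrow> component E x \<subseteq> space \<nu>"
  using component_act act_space by auto

lemma countable_component: "x \<in> space \<nu> \<Longrightarrow> countable (component E x)"
  by (simp add: component_act)

lemma component_act_eq: "x \<in> space \<nu> \<Longrightarrow> component E (act u x) = component E x"
  using component_eq[OF sym_E] component_act by blast

abbreviation "\<Omega> \<equiv> lift_space \<nu> E"

lemma lift_space_iff: "(x, \<xi>) \<in> \<Omega> \<longleftrightarrow> x \<in> space \<nu> \<and> \<xi> \<in> component E x \<rightarrow>\<^sub>E {0..1}"
  by (simp add: lift_space_def)

lemma lift_act: "(x, \<xi>) \<in> \<Omega> \<Longrightarrow> (act u x, \<xi>) \<in> \<Omega>"
  by (simp add: lift_space_iff act_space component_act_eq)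

lemma lift_edges_act:
  assumes "(x, \<xi>) \<in> \<Omega>"
  shows "((act u x, \<xi>), (act v x, \<xi>)) \<in> lift_edges \<nu> E \<longleftrightarrow> (act u x, act v x) \<in> E"
  using assms by (simp add: lift_edges_def lift_act)

text \<open>Edges of the lift keep the weights, and all vertices on a walk from \<open>x\<close>
  have the same component, hence the same domain of weights; so walks lift uniquely with
  \<open>\<xi>\<close> unchanged.\<close>

lemma relpow_lift_edges:
  assumes "(x, \<xi>) \<in> \<Omega>"
  shows "((x, \<xi>), q) \<in> lift_edges \<nu> E ^^ n \<longleftrightarrow> snd q = \<xi> \<and> (x, fst q) \<in> E ^^ n"
proof (induction n arbitrary: q)
  case 0
  then show ?case by (auto simp: prod_eq_iff)
next
  case (Suc n)
  have in_lift: "(y, \<xi>) \<in> \<Omega>" if "(x, y) \<in> E ^^ m" for y m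
    using relpow_words[of x y m] that assms lift_act by (auto simp: lift_space_iff)
  show ?case
  proof
    assume "((x, \<xi>), q) \<in> lift_edges \<nu> E ^^ Suc n"
    then obtain p where "((x, \<xi>), p) \<in> lift_edges \<nu> E ^^ n" "(p, q) \<in> lift_edges \<nu> E" by auto
    then show "snd q = \<xi> \<and> (x, fst q) \<in> E ^^ Suc n"
      using Suc.IH by (auto simp: lift_edges_def)
  next
    assume q: "snd q = \<xi> \<and> (x, fst q) \<in> E ^^ Suc n"
    then obtain z where z: "(x, z) \<in> E ^^ n" "(z, fst q) \<in> E" by auto
    have "((x, \<xi>), (z, \<xi>)) \<in> lift_edges \<nu> E ^^ n" using Suc.IH z(1) by simp
    moreover have "((z, \<xi>), q) \<in> lift_edges \<nu> E"
      using q z in_lift[of z n] in_lift[of "fst q" "Suc n"] by (cases q) (simp add: lift_edges_def)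
    ultimately show "((x, \<xi>), q) \<in> lift_edges \<nu> E ^^ Suc n" by auto
  qed
qed

lemma ball_verts_lift:
  assumes "(x, \<xi>) \<in> \<Omega>"
  shows "ball_verts (lift_edges \<nu> E) r (x, \<xi>) = (\<lambda>u. (act u x, \<xi>)) ` words r"
proof -
  have "ball_verts (lift_edges \<nu> E) r (x, \<xi>) = (\<lambda>y. (y, \<xi>)) ` ball_verts E r x"
    unfolding ball_verts_def relpow_lift_edges[OF assms] by (auto simp: image_iff)
  then show ?thesis
    using assms by (simp add: ball_verts_words lift_space_iff image_image)
qed

text \<open>Serves both directions: for a base colouring \<open>c'\<close> pulled back to the lift,
  and for a lift colouring \<open>c\<close> evaluated at weights drawn for the base.\<close>

lemma ball_in_lift:
  assumes "(x, \<xi>) \<in> \<Omega>" and "\<And>u. u \<in> words r \<Longrightarrow> c' (act u x) = c (act u x, \<xi>)"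
  shows "ball_in E r c' F x \<longleftrightarrow> ball_in (lift_edges \<nu> E) r c F (x, \<xi>)"
proof -
  have "x \<in> space \<nu>" using assms by (simp add: lift_space_iff)
  show ?thesis
    by (rule ball_in_cong[OF ball_verts_words[OF \<open>x \<in> space \<nu>\<close>] ball_verts_lift[OF assms(1)] _ _ Nil_words])
      (use assms in \<open>auto simp: lift_edges_act\<close>)
qed

lemma ball_in_lift_cong:
  assumes "(x, \<xi>) \<in> \<Omega>" and "\<And>u. u \<in> words r \<Longrightarrow> c' (act u x, \<xi>) = c (act u x, \<xi>)"
  shows "ball_in (lift_edges \<nu> E) r c' F (x, \<xi>) \<longleftrightarrow> ball_in (lift_edges \<nu> E) r c F (x, \<xi>)"
  by (rule ball_in_cong[OF ball_verts_lift[OF assms(1)] ball_verts_lift[OF assms(1)] _ _ Nil_words])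
    (use assms in auto)

lemma ball_in_base_measurable:
  assumes "c \<in> measurable \<nu> (count_space UNIV)"
  shows "{x\<in>space \<nu>. ball_in E r c F x} \<in> sets \<nu>"
proof (rule ball_in_measurable[OF finite_words Nil_words, where a=act])
  fix u v
  show "Measurable.pred \<nu> (\<lambda>x. act u x = act v x)" by (rule pred_eq[OF act_measurable act_measurable])
  show "Measurable.pred \<nu> (\<lambda>x. (act u x, act v x) \<in> E)"
    by (rule pred_sets2[OF E_sets measurable_Pair[OF act_measurable act_measurable]])
  show "(\<lambda>x. c (act u x)) \<in> measurable \<nu> (count_space UNIV)"
    by (rule measurable_compose[OF act_measurable assms])
qed (auto simp: ball_verts_words)

section \<open>Choices of vertices and the sigma-algebras they generate\<close>

definition choices :: "('a \<Rightarrow> 'a) set" where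
  "choices = {f \<in> measurable \<nu> \<nu>. \<forall>x\<in>space \<nu>. f x \<in> component E x}"

text \<open>The generators of \<open>lift_algebra\<close> with weights read only through
  \<open>Fs\<close>. Finite \<open>Fs\<close> give the events that involve finitely many
  weights.\<close>

definition lift_sub :: "('a \<Rightarrow> 'a) set \<Rightarrow> ('a \<times> ('a \<Rightarrow> real)) measure" where
  "lift_sub Fs = sigma \<Omega> ({{(x, \<xi>) \<in> \<Omega>. x \<in> A} | A. A \<in> sets \<nu>} \<union>
     {{(x, \<xi>) \<in> \<Omega>. \<xi> (f x) \<in> B} | f B. f \<in> Fs \<and> B \<in> sets borel})"

lemma lift_algebra_eq: "lift_algebra \<nu> E = lift_sub choices"
  unfolding lift_algebra_def lift_sub_def choices_def mem_Collect_eq conj_assoc ..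

lemma space_lift_sub [simp]: "space (lift_sub Fs) = \<Omega>"
  by (simp add: lift_sub_def space_measure_of_conv)

lemma sets_lift_sub: "sets (lift_sub Fs) = sigma_sets \<Omega> ({{(x, \<xi>) \<in> \<Omega>. x \<in> A} | A. A \<in> sets \<nu>} \<union>
     {{(x, \<xi>) \<in> \<Omega>. \<xi> (f x) \<in> B} | f B. f \<in> Fs \<and> B \<in> sets borel})"
  unfolding lift_sub_def by (rule sets_measure_of) auto

lemma measurable_into_lift_sub:
  assumes "\<And>p. p \<in> space N \<Longrightarrow> T p \<in> \<Omega>"
    and "(\<lambda>p. fst (T p)) \<in> measurable N \<nu>"
    and "\<And>f. f \<in> Fs \<Longrightarrow> (\<lambda>p. snd (T p) (f (fst (T p)))) \<in> borel_measurable N"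
  shows "T \<in> measurable N (lift_sub Fs)"
  unfolding lift_sub_def
proof (rule measurable_measure_of)
  show "T \<in> space N \<rightarrow> \<Omega>" using assms(1) by auto
  fix Y assume "Y \<in> {{(x, \<xi>) \<in> \<Omega>. x \<in> A} | A. A \<in> sets \<nu>} \<union>
     {{(x, \<xi>) \<in> \<Omega>. \<xi> (f x) \<in> B} | f B. f \<in> Fs \<and> B \<in> sets borel}"
  then consider A where "A \<in> sets \<nu>" "Y = {(x, \<xi>) \<in> \<Omega>. x \<in> A}"
    | f B where "f \<in> Fs" "B \<in> sets borel" "Y = {(x, \<xi>) \<in> \<Omega>. \<xi> (f x) \<in> B}" by blast
  then show "T -` Y \<inter> space N \<in> sets N"
  proof cases
    case 1
    have "T -` Y \<inter> space N = (\<lambda>p. fst (T p)) -` A \<inter> space N"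
      using assms(1) by (auto simp: 1 split_beta)
    then show ?thesis using measurable_sets[OF assms(2) 1(1)] by simp
  next
    case 2
    have "T -` Y \<inter> space N = (\<lambda>p. snd (T p) (f (fst (T p)))) -` B \<inter> space N"
      using assms(1) by (auto simp: 2 split_beta)
    then show ?thesis using measurable_sets[OF assms(3)[OF 2(1)] 2(2)] by simp
  qed
qed auto

lemma fst_lift_sub: "fst \<in> measurable (lift_sub Fs) \<nu>"
proof (rule measurableI)
  fix A assume "A \<in> sets \<nu>"
  then have "{(x, \<xi>) \<in> \<Omega>. x \<in> A} \<in> sets (lift_sub Fs)"
    unfolding sets_lift_sub by (intro sigma_sets.Basic) blast
  moreover have "fst -` A \<inter> space (lift_sub Fs) = {(x, \<xi>) \<in> \<Omega>. x \<in> A}" by auto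
  ultimately show "fst -` A \<inter> space (lift_sub Fs) \<in> sets (lift_sub Fs)" by simp
qed (auto simp: lift_space_def)

lemma weight_lift_sub:
  assumes "f \<in> Fs"
  shows "(\<lambda>p. snd p (f (fst p))) \<in> borel_measurable (lift_sub Fs)"
proof (rule measurableI)
  fix B :: "real set" assume "B \<in> sets borel"
  then have "{(x, \<xi>) \<in> \<Omega>. \<xi> (f x) \<in> B} \<in> sets (lift_sub Fs)"
    unfolding sets_lift_sub using assms by (intro sigma_sets.Basic) blast
  moreover have "(\<lambda>p. snd p (f (fst p))) -` B \<inter> space (lift_sub Fs) = {(x, \<xi>) \<in> \<Omega>. \<xi> (f x) \<in> B}" by auto
  ultimately show "(\<lambda>p. snd p (f (fst p))) -` B \<inter> space (lift_sub Fs) \<in> sets (lift_sub Fs)" by simp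
qed simp

lemma lift_sub_mono:
  assumes "Fs \<subseteq> Gs"
  shows "sets (lift_sub Fs) \<subseteq> sets (lift_sub Gs)"
proof
  fix T assume T: "T \<in> sets (lift_sub Fs)"
  have "(\<lambda>p. p) \<in> measurable (lift_sub Gs) (lift_sub Fs)"
    by (rule measurable_into_lift_sub) (use assms fst_lift_sub weight_lift_sub in auto)
  from measurable_sets[OF this T] show "T \<in> sets (lift_sub Gs)"
    using sets.sets_into_space[OF T] by (simp add: Int_absorb2 vimage_def)
qed

text \<open>Reading \<open>f\<close> from the shifted root is reading
  \<open>\<lambda>x. f (act u x)\<close> from the original one. Ball events of radius
  \<open>r\<close> thus need the choices in \<open>Fs\<close> composed with \<open>words r\<close>,
  still finitely many when \<open>Fs\<close> is finite.\<close>

lemma shift_measurable: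
  assumes "\<And>f. f \<in> Fs \<Longrightarrow> (\<lambda>x. f (act u x)) \<in> Gs"
  shows "(\<lambda>p. (act u (fst p), snd p)) \<in> measurable (lift_sub Gs) (lift_sub Fs)"
proof (rule measurable_into_lift_sub)
  show "(\<lambda>p. fst (act u (fst p), snd p)) \<in> measurable (lift_sub Gs) \<nu>"
    using measurable_compose[OF fst_lift_sub act_measurable] by simp
  show "(\<lambda>p. snd (act u (fst p), snd p) (f (fst (act u (fst p), snd p)))) \<in> borel_measurable (lift_sub Gs)"
    if "f \<in> Fs" for f
    using weight_lift_sub[OF assms[OF that]] by simp
qed (auto simp: lift_act)

lemma choices_act:
  assumes "f \<in> choices"
  shows "(\<lambda>x. f (act u x)) \<in> choices"
  unfolding choices_def
proof (intro CollectI conjI ballI)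
  show "(\<lambda>x. f (act u x)) \<in> measurable \<nu> \<nu>"
    using assms by (intro measurable_compose[OF act_measurable]) (simp add: choices_def)
  fix x assume "x \<in> space \<nu>"
  then have "f (act u x) \<in> component E (act u x)"
    using assms act_space by (simp add: choices_def)
  then show "f (act u x) \<in> component E x" by (simp only: component_act_eq[OF \<open>x \<in> space \<nu>\<close>])
qed

lemma ball_in_lift_measurable:
  assumes c: "c \<in> measurable (lift_sub Fs) (count_space UNIV)"
    and Gs: "\<And>u f. u \<in> words r \<Longrightarrow> f \<in> Fs \<Longrightarrow> (\<lambda>x. f (act u x)) \<in> Gs"
  shows "{p\<in>\<Omega>. ball_in (lift_edges \<nu> E) r c F p} \<in> sets (lift_sub Gs)"
proof -
  have "{p\<in>space (lift_sub Gs). ball_in (lift_edges \<nu> E) r c F p} \<in> sets (lift_sub Gs)"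
  proof (rule ball_in_measurable[OF finite_words Nil_words, where a="\<lambda>u p. (act u (fst p), snd p)"])
    fix u v
    have 1: "Measurable.pred (lift_sub Gs) (\<lambda>p. act u (fst p) = act v (fst p))"
      by (rule pred_eq[OF measurable_compose[OF fst_lift_sub act_measurable]
            measurable_compose[OF fst_lift_sub act_measurable]])
    then show "Measurable.pred (lift_sub Gs) (\<lambda>p. (act u (fst p), snd p) = (act v (fst p), snd p))"
      by simp
    have "Measurable.pred (lift_sub Gs) (\<lambda>p. (act u (fst p), act v (fst p)) \<in> E)"
      by (rule pred_sets2[OF E_sets measurable_Pair[OF measurable_compose[OF fst_lift_sub act_measurable]
            measurable_compose[OF fst_lift_sub act_measurable]]])
    also have "?this \<longleftrightarrow> Measurable.pred (lift_sub Gs)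
        (\<lambda>p. ((act u (fst p), snd p), (act v (fst p), snd p)) \<in> lift_edges \<nu> E)"
      by (rule measurable_cong) (auto simp: lift_edges_act)
    finally show "Measurable.pred (lift_sub Gs)
        (\<lambda>p. ((act u (fst p), snd p), (act v (fst p), snd p)) \<in> lift_edges \<nu> E)" .
  next
    fix u assume "u \<in> words r"
    then show "(\<lambda>p. c (act u (fst p), snd p)) \<in> measurable (lift_sub Gs) (count_space UNIV)"
      by (intro measurable_compose[OF shift_measurable c] Gs)
  qed (auto simp: ball_verts_lift)
  then show ?thesis by simp
qed

section \<open>The lift measure as an image of independent weights\<close>

text \<open>Both ways of producing weights have this form. A labelling injective on the component,
  possibly depending on the root \<open>x\<close>, gives the true kernel; a labelling that ignores
  \<open>x\<close> gives weights that agree for all roots of a component.\<close>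

definition labelled :: "('a \<Rightarrow> 'a \<Rightarrow> nat) \<Rightarrow> 'a \<Rightarrow> (nat \<Rightarrow> real) \<Rightarrow> 'a \<times> ('a \<Rightarrow> real)" where
  "labelled \<iota> x \<omega> = (x, \<lambda>v\<in>component E x. \<omega> (\<iota> x v))"

lemma space_weights: "\<omega> \<in> space weights \<longleftrightarrow> range \<omega> \<subseteq> {0..1}"
  by (auto simp: space_PiM PiE_UNIV_domain)

lemma labelled_lift_space: "x \<in> space \<nu> \<Longrightarrow> \<omega> \<in> space weights \<Longrightarrow> labelled \<iota> x \<omega> \<in> \<Omega>"
  by (auto simp: labelled_def lift_space_iff space_weights)

lemma labelled_measurable:
  assumes "Fs \<subseteq> choices" and \<iota>: "\<And>f. f \<in> Fs \<Longrightarrow> (\<lambda>x. \<iota> x (f x)) \<in> measurable \<nu> (count_space UNIV)"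
  shows "(\<lambda>p. labelled \<iota> (fst p) (snd p)) \<in> measurable (\<nu> \<Otimes>\<^sub>M weights) (lift_sub Fs)"
proof (rule measurable_into_lift_sub)
  show "labelled \<iota> (fst p) (snd p) \<in> \<Omega>" if "p \<in> space (\<nu> \<Otimes>\<^sub>M weights)" for p
    using that by (intro labelled_lift_space) (auto simp: space_pair_measure)
  show "(\<lambda>p. fst (labelled \<iota> (fst p) (snd p))) \<in> measurable (\<nu> \<Otimes>\<^sub>M weights) \<nu>"
    by (simp add: labelled_def)
  fix f assume f: "f \<in> Fs"
  have "(\<lambda>p. \<iota> (fst p) (f (fst p))) \<in> measurable (\<nu> \<Otimes>\<^sub>M weights) (count_space UNIV)"
    by (rule measurable_compose[OF measurable_fst \<iota>[OF f]])
  then have "(\<lambda>p. snd p (\<iota> (fst p) (f (fst p)))) \<in> borel_measurable (\<nu> \<Otimes>\<^sub>M weights)"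
    by (rule measurable_compose_countable[rotated])
      (rule measurable_compose[OF measurable_snd PiM_unit_component], simp)
  also have "?this \<longleftrightarrow> (\<lambda>p. snd (labelled \<iota> (fst p) (snd p)) (f (fst (labelled \<iota> (fst p) (snd p)))))
      \<in> borel_measurable (\<nu> \<Otimes>\<^sub>M weights)"
    using f assms(1) by (intro measurable_cong) (auto simp: labelled_def choices_def space_pair_measure)
  finally show "(\<lambda>p. snd (labelled \<iota> (fst p) (snd p)) (f (fst (labelled \<iota> (fst p) (snd p)))))
      \<in> borel_measurable (\<nu> \<Otimes>\<^sub>M weights)" .
qed

lemma labelled_measurable_section:
  assumes "(\<lambda>p. labelled \<iota> (fst p) (snd p)) \<in> measurable (\<nu> \<Otimes>\<^sub>M weights) N" "x \<in> space \<nu>"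
  shows "labelled \<iota> x \<in> measurable weights N"
  using measurable_compose[OF measurable_Pair1'[OF assms(2)] assms(1)] by simp

text \<open>Numbering each component injects its vertices into \<open>nat\<close>, which turns the lift measure into the
  image of one product measure and makes the kernel measurable.\<close>

definition index :: "'a \<Rightarrow> 'a \<Rightarrow> nat" where
  "index x v = (LEAST n. act (from_nat n) x = v)"

lemma index_measurable:
  assumes "f \<in> choices"
  shows "(\<lambda>x. index x (f x)) \<in> measurable \<nu> (count_space UNIV)"
  unfolding index_def using assms
  by (intro measurable_Least pred_eq act_measurable) (simp add: choices_def)

lemma act_index:
  assumes "x \<in> space \<nu>" "v \<in> component E x"
  shows "act (from_nat (index x v)) x = v"
proof -
  obtain u where "v = act u x" using assms by (auto simp: component_act)
  then have "act (from_nat (to_nat u)) x = v" by simp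
  then show ?thesis unfolding index_def by (rule LeastI)
qed

lemma inj_on_index: "x \<in> space \<nu> \<Longrightarrow> inj_on (index x) (component E x)"
  by (rule inj_on_inverseI[where g="\<lambda>n. act (from_nat n) x"]) (rule act_index)

definition kernel :: "'a \<Rightarrow> ('a \<times> ('a \<Rightarrow> real)) measure" where
  "kernel x = distr (PiM (component E x) (\<lambda>_. unit_measure)) (lift_algebra \<nu> E) (Pair x)"

lemma sets_kernel [simp]: "sets (kernel x) = sets (lift_algebra \<nu> E)"
  by (simp add: kernel_def)

lemma space_kernel [simp]: "space (kernel x) = \<Omega>"
  by (simp add: kernel_def lift_algebra_eq)

lemma labelled_index_measurable:
  "(\<lambda>p. labelled index (fst p) (snd p)) \<in> measurable (\<nu> \<Otimes>\<^sub>M weights) (lift_algebra \<nu> E)"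
  unfolding lift_algebra_eq by (intro labelled_measurable index_measurable) auto

lemma Pair_lift_sub:
  assumes "Fs \<subseteq> choices" "x \<in> space \<nu>"
  shows "Pair x \<in> measurable (PiM (component E x) (\<lambda>_. unit_measure)) (lift_sub Fs)"
proof (rule measurable_into_lift_sub)
  show "(x, \<xi>) \<in> \<Omega>" if "\<xi> \<in> space (PiM (component E x) (\<lambda>_. unit_measure))" for \<xi>
    using that assms by (simp add: lift_space_iff space_PiM)
  fix f assume "f \<in> Fs"
  then have "f x \<in> component E x" using assms by (auto simp: choices_def)
  then show "(\<lambda>\<xi>. snd (x, \<xi>) (f (fst (x, \<xi>)))) \<in> borel_measurable (PiM (component E x) (\<lambda>_. unit_measure))"
    by (simp add: PiM_unit_component)
qed (use assms in simp)

lemma kernel_eq: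
  assumes x: "x \<in> space \<nu>"
  shows "kernel x = distr weights (lift_algebra \<nu> E) (labelled index x)"
proof -
  let ?C = "component E x"
  have "distr weights (PiM ?C (\<lambda>_. unit_measure)) (\<lambda>\<omega>. \<lambda>v\<in>?C. \<omega> (index x v)) = PiM ?C (\<lambda>_. unit_measure)"
    by (rule distr_PiM_reindex[where M="\<lambda>_. unit_measure"])
      (auto intro: prob_space_unit_measure inj_on_index x)
  then have "kernel x = distr (distr weights (PiM ?C (\<lambda>_. unit_measure)) (\<lambda>\<omega>. \<lambda>v\<in>?C. \<omega> (index x v)))
      (lift_algebra \<nu> E) (Pair x)"
    by (simp add: kernel_def)
  also have "\<dots> = distr weights (lift_algebra \<nu> E) (labelled index x)"
    by (subst distr_distr)
      (auto simp: lift_algebra_eq labelled_def[abs_def] comp_def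
        intro!: Pair_lift_sub x measurable_restrict measurable_component_singleton)
  finally show ?thesis .
qed

lemma kernel_measurable: "kernel \<in> measurable \<nu> (subprob_algebra (lift_algebra \<nu> E))"
proof -
  have "weights \<in> space (subprob_algebra weights)"
    by (simp add: space_subprob_algebra prob_space_imp_subprob_space prob_space_PiM_unit)
  then have "(\<lambda>x. distr weights (lift_algebra \<nu> E) (labelled index x))
      \<in> measurable \<nu> (subprob_algebra (lift_algebra \<nu> E))"
    using labelled_index_measurable
    by (intro measurable_distr2[where M=weights]) (auto simp: split_beta' intro: measurable_const)
  also have "?this \<longleftrightarrow> ?thesis"
    by (rule measurable_cong) (simp add: kernel_eq)
  finally show ?thesis .
qed

lemma space_nonempty: "space \<nu> \<noteq> {}"
  by (rule not_empty)

lemma lift_measure_eq: "lift_measure \<nu> E = \<nu> \<bind> kernel"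
  unfolding lift_measure_def kernel_def ..

lemma sets_lift_measure [simp]: "sets (lift_measure \<nu> E) = sets (lift_algebra \<nu> E)"
  unfolding lift_measure_eq by (rule sets_bind[OF sets_kernel space_nonempty])

lemma space_lift_measure [simp]: "space (lift_measure \<nu> E) = \<Omega>"
  using sets_eq_imp_space_eq[OF sets_lift_measure] by (simp add: lift_algebra_eq)

lemma emeasure_lift_measure:
  "T \<in> sets (lift_algebra \<nu> E) \<Longrightarrow> emeasure (lift_measure \<nu> E) T = (\<integral>\<^sup>+x. emeasure (kernel x) T \<partial>\<nu>)"
  unfolding lift_measure_eq by (rule emeasure_bind[OF space_nonempty kernel_measurable])

lemma emeasure_kernel:
  assumes "x \<in> space \<nu>" "T \<in> sets (lift_algebra \<nu> E)"
  shows "emeasure (kernel x) T = emeasure (PiM (component E x) (\<lambda>_. unit_measure))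
      {\<xi> \<in> component E x \<rightarrow>\<^sub>E {0..1}. (x, \<xi>) \<in> T}"
proof -
  have "emeasure (kernel x) T = emeasure (PiM (component E x) (\<lambda>_. unit_measure))
      (Pair x -` T \<inter> space (PiM (component E x) (\<lambda>_. unit_measure)))"
    unfolding kernel_def using assms Pair_lift_sub[of choices x]
    by (intro emeasure_distr) (auto simp: lift_algebra_eq)
  also have "Pair x -` T \<inter> space (PiM (component E x) (\<lambda>_. unit_measure))
      = {\<xi> \<in> component E x \<rightarrow>\<^sub>E {0..1}. (x, \<xi>) \<in> T}"
    by (auto simp: space_PiM)
  finally show ?thesis .
qed

lemma prob_space_kernel: "x \<in> space \<nu> \<Longrightarrow> prob_space (kernel x)"
  unfolding kernel_def using Pair_lift_sub[of choices x]
  by (intro prob_space.prob_space_distr prob_space_PiM_unit) (auto simp: lift_algebra_eq)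

lemma Omega_sets: "\<Omega> \<in> sets (lift_algebra \<nu> E)"
  using sets.top[of "lift_algebra \<nu> E"] by (simp add: lift_algebra_eq)

lemma prob_space_lift_measure: "prob_space (lift_measure \<nu> E)"
proof (rule prob_spaceI)
  have "emeasure (kernel x) \<Omega> = 1" if "x \<in> space \<nu>" for x
    using prob_space.emeasure_space_1[OF prob_space_kernel[OF that]] by simp
  then have "(\<integral>\<^sup>+x. emeasure (kernel x) \<Omega> \<partial>\<nu>) = (\<integral>\<^sup>+x. 1 \<partial>\<nu>)"
    by (intro nn_integral_cong) simp
  then show "emeasure (lift_measure \<nu> E) (space (lift_measure \<nu> E)) = 1"
    by (simp add: emeasure_lift_measure[OF Omega_sets] emeasure_space_1)
qed

lemma emeasure_lift_measure_fst:
  assumes "A \<in> sets \<nu>"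
  shows "emeasure (lift_measure \<nu> E) {p\<in>\<Omega>. fst p \<in> A} = emeasure \<nu> A"
proof -
  have A: "{p\<in>\<Omega>. fst p \<in> A} \<in> sets (lift_algebra \<nu> E)"
    using measurable_sets[OF fst_lift_sub assms, of choices]
    by (simp add: lift_algebra_eq vimage_def Int_def conj_commute)
  have "emeasure (kernel x) {p\<in>\<Omega>. fst p \<in> A} = indicator A x" if x: "x \<in> space \<nu>" for x
  proof -
    have "{\<xi> \<in> component E x \<rightarrow>\<^sub>E {0..1::real}. (x, \<xi>) \<in> {p\<in>\<Omega>. fst p \<in> A}} =
        (if x \<in> A then space (PiM (component E x) (\<lambda>_. unit_measure)) else {})"
      using x by (auto simp: lift_space_iff space_PiM)
    then show ?thesis
      using prob_space.emeasure_space_1[OF prob_space_PiM_unit[of "component E x"]]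
      by (simp add: emeasure_kernel[OF x A] indicator_def)
  qed
  then have "(\<integral>\<^sup>+x. emeasure (kernel x) {p\<in>\<Omega>. fst p \<in> A} \<partial>\<nu>) = (\<integral>\<^sup>+x. indicator A x \<partial>\<nu>)"
    by (intro nn_integral_cong) simp
  then show ?thesis using assms by (simp add: emeasure_lift_measure[OF A])
qed

lemma act_emeasure:
  assumes "A \<in> sets \<nu>"
  shows "emeasure \<nu> (act u -` A \<inter> space \<nu>) \<le> of_nat (Suc d) ^ length u * emeasure \<nu> A"
  using assms
proof (induction u arbitrary: A)
  case Nil
  then have "act [] -` A \<inter> space \<nu> = A" using sets.sets_into_space by auto
  then show ?case by (simp only: list.size power_0 mult_1 order_refl)
next
  case (Cons i u)
  have gA: "g i -` A \<inter> space \<nu> \<in> sets \<nu>" using measurable_sets[OF g_measurable Cons.prems] .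
  have "act (i # u) -` A \<inter> space \<nu> = act u -` (g i -` A \<inter> space \<nu>) \<inter> space \<nu>"
    using act_space by auto
  then have "emeasure \<nu> (act (i # u) -` A \<inter> space \<nu>) \<le>
      of_nat (Suc d) ^ length u * emeasure \<nu> (g i -` A \<inter> space \<nu>)"
    using Cons.IH[OF gA] by simp
  also have "\<dots> \<le> of_nat (Suc d) ^ length u * (of_nat (Suc d) * emeasure \<nu> A)"
    by (intro mult_left_mono g_emeasure Cons.prems) simp
  finally show ?case by (simp only: power_Suc list.size add_0_right mult_ac One_nat_def add_Suc_right)
qed

lemma act_nn_integral:
  assumes "\<phi> \<in> borel_measurable \<nu>"
  shows "(\<integral>\<^sup>+x. \<phi> (act u x) \<partial>\<nu>) \<le> of_nat (Suc d) ^ length u * (\<integral>\<^sup>+x. \<phi> x \<partial>\<nu>)"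
proof -
  let ?C = "of_nat (Suc d) ^ length u :: ennreal"
  have "(\<integral>\<^sup>+x. \<phi> (act u x) \<partial>\<nu>) = (\<integral>\<^sup>+x. \<phi> x \<partial>distr \<nu> \<nu> (act u))"
    by (rule nn_integral_distr[symmetric, OF act_measurable]) (use assms in simp)
  also have "\<dots> \<le> (\<integral>\<^sup>+x. \<phi> x \<partial>scale_measure ?C \<nu>)"
  proof (rule nn_integral_mono_measure)
    show "distr \<nu> \<nu> (act u) \<le> scale_measure ?C \<nu>"
      by (subst le_measure) (auto simp: emeasure_distr[OF act_measurable] act_emeasure simp del: of_nat_Suc)
  qed simp
  also have "\<dots> = ?C * (\<integral>\<^sup>+x. \<phi> x \<partial>\<nu>)"
    by (rule nn_integral_scale_measure) (use assms in simp)
  finally show ?thesis .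
qed

text \<open>The fibres over \<open>x\<close> and \<open>act u x\<close> carry the same product
  measure, because both points have the same component. Moving the root costs only the factor for
  the base measure.\<close>

lemma act_emeasure_lift:
  assumes T: "T \<in> sets (lift_algebra \<nu> E)"
  shows "emeasure (lift_measure \<nu> E) {p\<in>\<Omega>. (act u (fst p), snd p) \<in> T}
    \<le> of_nat (Suc d) ^ length u * emeasure (lift_measure \<nu> E) T"
proof -
  let ?T = "{p\<in>\<Omega>. (act u (fst p), snd p) \<in> T}"
  have "(\<lambda>p. (act u (fst p), snd p)) \<in> measurable (lift_sub choices) (lift_sub choices)"
    by (intro shift_measurable choices_act)
  from measurable_sets[OF this T[unfolded lift_algebra_eq]] have T': "?T \<in> sets (lift_algebra \<nu> E)"
    by (simp add: lift_algebra_eq vimage_def Int_def conj_commute)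
  have "emeasure (kernel x) ?T = emeasure (kernel (act u x)) T" if x: "x \<in> space \<nu>" for x
  proof -
    have "{\<xi> \<in> component E x \<rightarrow>\<^sub>E {0..1}. (x, \<xi>) \<in> ?T} =
        {\<xi> \<in> component E (act u x) \<rightarrow>\<^sub>E {0..1}. (act u x, \<xi>) \<in> T}"
      using x by (auto simp: component_act_eq lift_space_iff)
    then show ?thesis
      using x by (simp add: emeasure_kernel T T' act_space component_act_eq)
  qed
  then have "emeasure (lift_measure \<nu> E) ?T = (\<integral>\<^sup>+x. emeasure (kernel (act u x)) T \<partial>\<nu>)"
    unfolding emeasure_lift_measure[OF T'] by (intro nn_integral_cong) simp
  also have "\<dots> \<le> of_nat (Suc d) ^ length u * (\<integral>\<^sup>+x. emeasure (kernel x) T \<partial>\<nu>)"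
    by (rule act_nn_integral) (rule measurable_emeasure_kernel[OF kernel_measurable T])
  finally show ?thesis by (simp add: emeasure_lift_measure[OF T])
qed

section \<open>Approximation by finitely many weights\<close>

text \<open>The events approximable by finitely many weights contain the generators and are stable
  under complements and countable unions; a union is cut off at \<open>n\<close> before its members
  are approximated.\<close>

lemma lift_approximation:
  assumes T: "T \<in> sets (lift_algebra \<nu> E)" and "\<epsilon> > 0"
  shows "\<exists>Fs S. finite Fs \<and> Fs \<subseteq> choices \<and> S \<in> sets (lift_sub Fs) \<and>
    measure (lift_measure \<nu> E) ((T - S) \<union> (S - T)) < \<epsilon>"
proof -
  interpret L: prob_space "lift_measure \<nu> E" by (rule prob_space_lift_measure)
  let ?G = "{{(x, \<xi>) \<in> \<Omega>. x \<in> A} | A. A \<in> sets \<nu>} \<union>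
     {{(x, \<xi>) \<in> \<Omega>. \<xi> (f x) \<in> B} | f B. f \<in> choices \<and> B \<in> sets borel}"
  have sets_L: "sets (lift_measure \<nu> E) = sigma_sets \<Omega> ?G"
    by (simp add: lift_algebra_eq sets_lift_sub)
  have sub_L: "S \<in> L.events" if "S \<in> sets (lift_sub Fs)" "Fs \<subseteq> choices" for S Fs
    using lift_sub_mono[OF that(2)] that(1) by (auto simp: lift_algebra_eq)
  have "T \<in> sigma_sets \<Omega> ?G" using T sets_L by simp
  then show ?thesis using \<open>\<epsilon> > 0\<close>
  proof (induction arbitrary: \<epsilon>)
    case (Basic T)
    then consider A where "A \<in> sets \<nu>" "T = {(x, \<xi>) \<in> \<Omega>. x \<in> A}"
      | f B where "f \<in> choices" "B \<in> sets borel" "T = {(x, \<xi>) \<in> \<Omega>. \<xi> (f x) \<in> B}" by blast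
    then obtain Fs where Fs: "finite Fs" "Fs \<subseteq> choices" "T \<in> sets (lift_sub Fs)"
    proof cases
      case 1
      then have "T \<in> sets (lift_sub {})" unfolding sets_lift_sub by (intro sigma_sets.Basic) blast
      then show ?thesis by (intro that[of "{}"]) auto
    next
      case 2
      then have "T \<in> sets (lift_sub {f})" unfolding sets_lift_sub by (intro sigma_sets.Basic) blast
      then show ?thesis using 2 by (intro that[of "{f}"]) auto
    qed
    then show ?case using Basic by (intro exI[of _ Fs] exI[of _ T]) simp
  next
    case Empty
    then show ?case by (intro exI[of _ "{}"]) auto
  next
    case (Compl T)
    then obtain Fs S where S: "finite Fs" "Fs \<subseteq> choices" "S \<in> sets (lift_sub Fs)"
      "L.prob ((T - S) \<union> (S - T)) < \<epsilon>" by blast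
    have "S \<subseteq> \<Omega>" "T \<subseteq> \<Omega>"
      using sets.sets_into_space[OF S(3)] sigma_sets_into_sp[OF _ Compl.hyps] by auto
    then have "((\<Omega> - T) - (\<Omega> - S)) \<union> ((\<Omega> - S) - (\<Omega> - T)) = (T - S) \<union> (S - T)" by auto
    moreover have "\<Omega> - S \<in> sets (lift_sub Fs)" using sets.compl_sets[OF S(3)] by simp
    ultimately show ?case using S by (intro exI[of _ Fs] exI[of _ "\<Omega> - S"]) simp
  next
    case (Union T)
    have T_L: "T i \<in> L.events" for i using Union.hyps(1) sets_L by blast
    define A where "A n = (\<Union>i<n. T i)" for n
    have A_L: "A n \<in> L.events" for n unfolding A_def using T_L by (intro sets.finite_UN) auto
    have "(\<lambda>n. L.prob (A n)) \<longlonglongrightarrow> L.prob (\<Union>n. A n)"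
    proof (rule L.finite_Lim_measure_incseq)
      show "incseq A" unfolding A_def by (intro monoI UN_mono) auto
    qed (use A_L in auto)
    moreover have UA: "(\<Union>n. A n) = (\<Union>i. T i)" by (auto simp: A_def)
    ultimately have lim: "(\<lambda>n. L.prob (A n)) \<longlonglongrightarrow> L.prob (\<Union>i. T i)" by simp
    obtain n where n: "norm (L.prob (A n) - L.prob (\<Union>i. T i)) < \<epsilon> / 2"
      using LIMSEQ_D[OF lim, of "\<epsilon> / 2"] Union.prems by auto
    have U_L: "(\<Union>i. T i) \<in> L.events" using T_L by auto
    have diff: "L.prob ((\<Union>i. T i) - A n) < \<epsilon> / 2"
    proof -
      have "A n \<subseteq> (\<Union>i. T i)" by (auto simp: A_def)
      from L.finite_measure_Diff[OF U_L A_L this] show ?thesis using n unfolding real_norm_def by linarith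
    qed
    \<comment> \<open>Half of \<open>\<epsilon>\<close> pays for the cut-off, and \<open>n\<close>
      errors of size \<open>\<delta>\<close> stay within the other half; the added 1 keeps the
      quotient meaningful for \<open>n = 0\<close>.\<close>
    define \<delta> where "\<delta> = \<epsilon> / (2 * (real n + 1))"
    have "\<delta> > 0" using Union.prems by (simp add: \<delta>_def)
    have "\<forall>i. \<exists>Fs S. finite Fs \<and> Fs \<subseteq> choices \<and> S \<in> sets (lift_sub Fs) \<and>
        L.prob ((T i - S) \<union> (S - T i)) < \<delta>"
      using Union.IH[OF \<open>\<delta> > 0\<close>] by blast
    then obtain Fs S where S: "\<And>i. finite (Fs i)" "\<And>i. Fs i \<subseteq> choices" "\<And>i. S i \<in> sets (lift_sub (Fs i))"
      "\<And>i. L.prob ((T i - S i) \<union> (S i - T i)) < \<delta>" by metis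
    define Gs where "Gs = (\<Union>i<n. Fs i)"
    define S' where "S' = (\<Union>i<n. S i)"
    have SL: "S i \<in> L.events" for i using sub_L[OF S(3) S(2)] .
    have S': "S' \<in> sets (lift_sub Gs)"
      unfolding S'_def
    proof (rule sets.finite_UN)
      fix i assume "i \<in> {..<n}"
      then have "Fs i \<subseteq> Gs" by (auto simp: Gs_def)
      from lift_sub_mono[OF this] S(3) show "S i \<in> sets (lift_sub Gs)" by blast
    qed simp
    define D where "D i = (T i - S i) \<union> (S i - T i)" for i
    have D_L: "D i \<in> L.events" for i unfolding D_def using T_L SL by auto
    have UD_L: "(\<Union>i<n. D i) \<in> L.events" using D_L by (intro sets.finite_UN) auto
    have diff_L: "(\<Union>i. T i) - A n \<in> L.events" by (rule sets.Diff[OF U_L A_L])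
    have "L.prob (((\<Union>i. T i) - S') \<union> (S' - (\<Union>i. T i))) \<le> L.prob (((\<Union>i. T i) - A n) \<union> (\<Union>i<n. D i))"
    proof (rule L.finite_measure_mono)
      show "((\<Union>i. T i) - S') \<union> (S' - (\<Union>i. T i)) \<subseteq> ((\<Union>i. T i) - A n) \<union> (\<Union>i<n. D i)"
        by (auto simp: A_def D_def S'_def)
      show "((\<Union>i. T i) - A n) \<union> (\<Union>i<n. D i) \<in> L.events"
        by (rule sets.Un[OF diff_L UD_L])
    qed
    also have "\<dots> \<le> L.prob ((\<Union>i. T i) - A n) + L.prob (\<Union>i<n. D i)"
      by (rule measure_Un_le[OF diff_L UD_L])
    also have "L.prob (\<Union>i<n. D i) \<le> (\<Sum>i<n. L.prob (D i))"
      using D_L by (intro L.finite_measure_subadditive_finite) auto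
    also have "(\<Sum>i<n. L.prob (D i)) \<le> (\<Sum>i<n. \<delta>)"
      unfolding D_def using S(4) by (intro sum_mono less_imp_le)
    also have "(\<Sum>i<n. \<delta>) \<le> \<epsilon> / 2"
      using Union.prems by (simp add: \<delta>_def field_simps)
    finally have "L.prob (((\<Union>i. T i) - S') \<union> (S' - (\<Union>i. T i))) < \<epsilon>" using diff by linarith
    moreover have "finite Gs" "Gs \<subseteq> choices" using S(1,2) by (auto simp: Gs_def)
    ultimately show ?case using S' by blast
  qed
qed

lemma colouring_approximation:
  fixes m :: nat
  assumes c: "c \<in> measurable (lift_algebra \<nu> E) (count_space {1..m})" and "m \<ge> 1" "\<epsilon> > 0"
  shows "\<exists>Fs c'. finite Fs \<and> Fs \<subseteq> choices \<and> c' \<in> measurable (lift_sub Fs) (count_space {1..m}) \<and>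
    measure (lift_measure \<nu> E) {p\<in>\<Omega>. c p \<noteq> c' p} < \<epsilon>"
proof -
  interpret L: prob_space "lift_measure \<nu> E" by (rule prob_space_lift_measure)
  define T where "T j = c -` {j} \<inter> \<Omega>" for j
  have T: "T j \<in> sets (lift_algebra \<nu> E)" if "j \<in> {1..m}" for j
    using measurable_sets[OF c, of "{j}"] that by (simp add: T_def lift_algebra_eq)
  have cr: "c p \<in> {1..m}" if "p \<in> \<Omega>" for p
    using measurable_space[OF c, of p] that by (simp add: lift_algebra_eq)
  have "\<forall>j\<in>{1..m}. \<exists>Fs S. finite Fs \<and> Fs \<subseteq> choices \<and> S \<in> sets (lift_sub Fs) \<and>
      L.prob ((T j - S) \<union> (S - T j)) < \<epsilon> / real m"
    using lift_approximation[OF T, of _ "\<epsilon> / real m"] assms(2,3) by auto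
  then obtain Fs S where S: "\<And>j. j \<in> {1..m} \<Longrightarrow> finite (Fs j)" "\<And>j. j \<in> {1..m} \<Longrightarrow> Fs j \<subseteq> choices"
      "\<And>j. j \<in> {1..m} \<Longrightarrow> S j \<in> sets (lift_sub (Fs j))"
      "\<And>j. j \<in> {1..m} \<Longrightarrow> L.prob ((T j - S j) \<union> (S j - T j)) < \<epsilon> / real m"
    by metis
  define Gs where "Gs = (\<Union>j\<in>{1..m}. Fs j)"
  have Gs: "finite Gs" "Gs \<subseteq> choices" unfolding Gs_def using S(1,2) by (blast, blast)
  have SG: "S j \<in> sets (lift_sub Gs)" if "j \<in> {1..m}" for j
  proof -
    have "Fs j \<subseteq> Gs" using that by (auto simp: Gs_def)
    from lift_sub_mono[OF this] S(3)[OF that] show ?thesis by blast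
  qed
  have SL: "S j \<in> L.events" if "j \<in> {1..m}" for j
    using lift_sub_mono[OF Gs(2)] SG[OF that] by (auto simp: lift_algebra_eq)
  \<comment> \<open>The approximate colour classes may overlap or leave gaps: the least available
    colour is taken, and 1 in the gaps. If \<open>c p\<close> and \<open>c' p\<close> differ, then
    either \<open>S (c p)\<close> misses \<open>p\<close>, or \<open>S (c' p)\<close> contains
    \<open>p\<close> although \<open>T (c' p)\<close> does not.\<close>
  define c' where "c' p = (if \<exists>j\<in>{1..m}. p \<in> S j then (LEAST j. j \<in> {1..m} \<and> p \<in> S j) else 1)" for p
  have c'_S: "c' p \<in> {1..m} \<and> p \<in> S (c' p)" if "\<exists>j\<in>{1..m}. p \<in> S j" for p
  proof -
    have "\<exists>j. j \<in> {1..m} \<and> p \<in> S j" using that by blast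
    from LeastI_ex[OF this] show ?thesis using that by (simp add: c'_def)
  qed
  have c'_range: "c' p \<in> {1..m}" for p
    using c'_S[of p] assms(2) by (cases "\<exists>j\<in>{1..m}. p \<in> S j") (auto simp: c'_def)
  have "Measurable.pred (lift_sub Gs) (\<lambda>p. j \<in> {1..m} \<and> p \<in> S j)" for j
    using SG[of j] by (cases "j \<in> {1..m}") auto
  then have lea: "(\<lambda>p. LEAST j. j \<in> {1..m} \<and> p \<in> S j) \<in> measurable (lift_sub Gs) (count_space UNIV)"
    by (rule measurable_Least)
  have "Measurable.pred (lift_sub Gs) (\<lambda>p. \<exists>j\<in>{1..m}. p \<in> S j)"
    using SG by (intro pred_intros_finite) auto
  then have ex: "{p\<in>space (lift_sub Gs). \<exists>j\<in>{1..m}. p \<in> S j} \<in> sets (lift_sub Gs)"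
    by (simp only: pred_def)
  have "c' \<in> measurable (lift_sub Gs) (count_space UNIV)"
    unfolding c'_def[abs_def] by (rule measurable_If[OF lea measurable_count_space_const ex])
  then have c'_meas: "c' \<in> measurable (lift_sub Gs) (count_space {1..m})"
    using c'_range by (intro measurable_count_space_extend[of "{1..m}" UNIV]) auto
  define D where "D j = (T j - S j) \<union> (S j - T j)" for j
  have D_L: "D j \<in> L.events" if "j \<in> {1..m}" for j
    unfolding D_def using T[OF that] SL[OF that] by auto
  have "L.prob {p\<in>\<Omega>. c p \<noteq> c' p} \<le> L.prob (\<Union>j\<in>{1..m}. D j)"
  proof (rule L.finite_measure_mono)
    show "{p\<in>\<Omega>. c p \<noteq> c' p} \<subseteq> (\<Union>j\<in>{1..m}. D j)"
    proof
      fix p assume p: "p \<in> {p\<in>\<Omega>. c p \<noteq> c' p}"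
      then have j: "c p \<in> {1..m}" "p \<in> T (c p)" using cr by (auto simp: T_def)
      show "p \<in> (\<Union>j\<in>{1..m}. D j)"
      proof (cases "p \<in> S (c p)")
        case True
        then have "c' p \<in> {1..m} \<and> p \<in> S (c' p)" using c'_S j by blast
        moreover have "p \<notin> T (c' p)" using p by (auto simp: T_def)
        ultimately show ?thesis by (auto simp: D_def)
      next
        case False
        then show ?thesis using j by (auto simp: D_def)
      qed
    qed
  qed (use D_L in \<open>auto intro!: sets.finite_UN\<close>)
  also have "\<dots> \<le> (\<Sum>j\<in>{1..m}. L.prob (D j))"
    using D_L by (intro L.finite_measure_subadditive_finite) auto
  also have "\<dots> < (\<Sum>j\<in>{1..m}. \<epsilon> / real m)"
    unfolding D_def using S(4) assms(2) by (intro sum_strict_mono) auto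
  also have "\<dots> = \<epsilon>" using assms(2) by simp
  finally show ?thesis using Gs c'_meas by blast
qed

section \<open>Independence of the weights at finitely many vertices\<close>

lemma lift_sub_depends:
  assumes "T \<in> sets (lift_sub Fs)" "(x, \<xi>) \<in> \<Omega>" "(x, \<xi>') \<in> \<Omega>" "\<And>f. f \<in> Fs \<Longrightarrow> \<xi> (f x) = \<xi>' (f x)"
  shows "(x, \<xi>) \<in> T \<longleftrightarrow> (x, \<xi>') \<in> T"
  using assms(1) unfolding sets_lift_sub
  by induction (use assms(2-4) in auto)

text \<open>On a fixed component an event of \<open>lift_sub Fs\<close> depends only on the weights at the vertices
  \<open>f x\<close>; \<open>trace\<close> is the event in these coordinates. The value 0 fills the irrelevant ones.\<close>

definition sites :: "('a \<Rightarrow> 'a) set \<Rightarrow> 'a \<Rightarrow> 'a set" where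
  "sites Fs x = (\<lambda>f. f x) ` Fs"

definition trace :: "('a \<Rightarrow> 'a) set \<Rightarrow> 'a \<Rightarrow> ('a \<times> ('a \<Rightarrow> real)) set \<Rightarrow> ('a \<Rightarrow> real) set" where
  "trace Fs x T = {\<eta> \<in> space (PiM (sites Fs x) (\<lambda>_. unit_measure)).
     (x, \<lambda>v\<in>component E x. if v \<in> sites Fs x then \<eta> v else 0) \<in> T}"

lemma sites_component: "Fs \<subseteq> choices \<Longrightarrow> x \<in> space \<nu> \<Longrightarrow> sites Fs x \<subseteq> component E x"
  by (auto simp: sites_def choices_def)

lemma extend_lift_space:
  assumes "x \<in> space \<nu>" "\<eta> \<in> space (PiM V (\<lambda>_. unit_measure))"
  shows "(x, \<lambda>v\<in>component E x. if v \<in> V then \<eta> v else 0) \<in> \<Omega>"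
proof -
  have "\<eta> v \<in> {0..1}" if "v \<in> V" for v using assms(2) that by (auto simp: space_PiM)
  then show ?thesis using assms(1) by (auto simp: lift_space_iff)
qed

lemma trace_sets:
  assumes Fs: "Fs \<subseteq> choices" and x: "x \<in> space \<nu>" and T: "T \<in> sets (lift_sub Fs)"
  shows "trace Fs x T \<in> sets (PiM (sites Fs x) (\<lambda>_. unit_measure))"
proof -
  let ?V = "sites Fs x"
  have "(\<lambda>\<eta>. (x, \<lambda>v\<in>component E x. if v \<in> ?V then \<eta> v else 0))
      \<in> measurable (PiM ?V (\<lambda>_. unit_measure)) (lift_sub Fs)"
  proof (rule measurable_into_lift_sub)
    show "(x, \<lambda>v\<in>component E x. if v \<in> ?V then \<eta> v else 0) \<in> \<Omega>"
      if "\<eta> \<in> space (PiM ?V (\<lambda>_. unit_measure))" for \<eta>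
      using x that by (rule extend_lift_space)
    fix f assume "f \<in> Fs"
    then have "f x \<in> ?V" "f x \<in> component E x" using sites_component[OF Fs x] by (auto simp: sites_def)
    then show "(\<lambda>\<eta>. snd (x, \<lambda>v\<in>component E x. if v \<in> ?V then \<eta> v else 0)
        (f (fst (x, \<lambda>v\<in>component E x. if v \<in> ?V then \<eta> v else 0))))
      \<in> borel_measurable (PiM ?V (\<lambda>_. unit_measure))"
      by (simp add: PiM_unit_component)
  qed (use x in simp)
  from measurable_sets[OF this T] show ?thesis
    by (simp add: trace_def vimage_def Int_def conj_commute)
qed

text \<open>Valid for every labelling: true weights and cell weights are tested against the same set
  \<open>trace Fs x T\<close>, and labels have to be distinct on the sites only.\<close>

lemma labelled_trace:
  assumes Fs: "Fs \<subseteq> choices" and x: "x \<in> space \<nu>" and T: "T \<in> sets (lift_sub Fs)"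
    and \<omega>: "\<omega> \<in> space weights"
  shows "labelled \<iota> x \<omega> \<in> T \<longleftrightarrow> (\<lambda>v\<in>sites Fs x. \<omega> (\<iota> x v)) \<in> trace Fs x T"
proof -
  let ?V = "sites Fs x" and ?\<eta> = "\<lambda>v\<in>sites Fs x. \<omega> (\<iota> x v)"
  have \<eta>: "?\<eta> \<in> space (PiM ?V (\<lambda>_. unit_measure))"
    using \<omega> by (auto simp: space_PiM PiE_iff)
  have "labelled \<iota> x \<omega> \<in> T \<longleftrightarrow> (x, \<lambda>v\<in>component E x. if v \<in> ?V then ?\<eta> v else 0) \<in> T"
    unfolding labelled_def
  proof (rule lift_sub_depends[OF T])
    show "(x, \<lambda>v\<in>component E x. \<omega> (\<iota> x v)) \<in> \<Omega>"
      using labelled_lift_space[OF x \<omega>] by (simp add: labelled_def)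
    show "(x, \<lambda>v\<in>component E x. if v \<in> ?V then ?\<eta> v else 0) \<in> \<Omega>"
      by (rule extend_lift_space[OF x \<eta>])
    show "(\<lambda>v\<in>component E x. \<omega> (\<iota> x v)) (f x) =
        (\<lambda>v\<in>component E x. if v \<in> ?V then ?\<eta> v else 0) (f x)" if "f \<in> Fs" for f
      using that by (auto simp: sites_def restrict_def)
  qed
  then show ?thesis using \<eta> by (simp add: trace_def)
qed

lemma distr_weights:
  assumes "inj_on a V"
  shows "distr weights (PiM V (\<lambda>_. unit_measure)) (\<lambda>\<omega>. \<lambda>v\<in>V. \<omega> (a v)) = PiM V (\<lambda>_. unit_measure)"
  by (rule distr_PiM_reindex[where M="\<lambda>_. unit_measure"]) (auto intro: prob_space_unit_measure assms)

lemma weights_restrict_measurable: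
  "(\<lambda>\<omega>. \<lambda>v\<in>V. \<omega> (a v)) \<in> measurable weights (PiM V (\<lambda>_. unit_measure))"
  by (intro measurable_restrict measurable_component_singleton) simp

lemma emeasure_kernel_trace:
  assumes Fs: "Fs \<subseteq> choices" and x: "x \<in> space \<nu>" and T: "T \<in> sets (lift_sub Fs)"
  shows "emeasure (kernel x) T = emeasure (PiM (sites Fs x) (\<lambda>_. unit_measure)) (trace Fs x T)"
proof -
  let ?V = "sites Fs x"
  have T': "T \<in> sets (lift_algebra \<nu> E)"
    using lift_sub_mono[OF Fs] T by (auto simp: lift_algebra_eq)
  have "inj_on (index x) ?V"
    using inj_on_index[OF x] sites_component[OF Fs x] by (rule inj_on_subset)
  then have "emeasure (PiM ?V (\<lambda>_. unit_measure)) (trace Fs x T) =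
      emeasure (distr weights (PiM ?V (\<lambda>_. unit_measure)) (\<lambda>\<omega>. \<lambda>v\<in>?V. \<omega> (index x v))) (trace Fs x T)"
    by (simp only: distr_weights)
  also have "\<dots> = emeasure weights ((\<lambda>\<omega>. \<lambda>v\<in>?V. \<omega> (index x v)) -` trace Fs x T \<inter> space weights)"
    by (rule emeasure_distr[OF weights_restrict_measurable trace_sets[OF assms]])
  also have "(\<lambda>\<omega>. \<lambda>v\<in>?V. \<omega> (index x v)) -` trace Fs x T \<inter> space weights = labelled index x -` T \<inter> space weights"
    using labelled_trace[OF Fs x T, of _ index] by blast
  also have "emeasure weights \<dots> = emeasure (kernel x) T"
    unfolding kernel_eq[OF x]
    by (rule emeasure_distr[symmetric, OF labelled_measurable_section[OF labelled_index_measurable x] T'])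
  finally show ?thesis ..
qed

text \<open>Distinct labels make the weights at all sites independent and uniform; disjointness of
  the two sets of sites then factors the product measure on their union. The labelling
  \<open>a\<close> is shared by both roots, as cell weights require.\<close>

lemma emeasure_labelled_pair:
  assumes Fs: "finite Fs" "Fs \<subseteq> choices" and x: "x \<in> space \<nu>" and y: "y \<in> space \<nu>"
    and T: "T \<in> sets (lift_sub Fs)" and T': "T' \<in> sets (lift_sub Fs)"
    and disj: "sites Fs x \<inter> sites Fs y = {}" and inj: "inj_on a (sites Fs x \<union> sites Fs y)"
  shows "emeasure weights {\<omega>\<in>space weights. labelled (\<lambda>_. a) x \<omega> \<in> T \<and> labelled (\<lambda>_. a) y \<omega> \<in> T'} =
    emeasure (kernel x) T * emeasure (kernel y) T'"
proof -
  let ?V = "sites Fs x" and ?W = "sites Fs y"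
  let ?P = "\<lambda>U. PiM U (\<lambda>_. unit_measure)"
  interpret P: product_prob_space "\<lambda>_. unit_measure" "?V \<union> ?W"
    using prob_space_unit_measure by (simp add: product_prob_space_def product_sigma_finite_def
        product_prob_space_axioms_def prob_space_imp_sigma_finite)
  interpret W: sigma_finite_measure "?P ?W" by (intro prob_space_imp_sigma_finite prob_space_PiM_unit)
  have tr: "trace Fs x T \<in> sets (?P ?V)" "trace Fs y T' \<in> sets (?P ?W)"
    using trace_sets[OF Fs(2) x T] trace_sets[OF Fs(2) y T'] .
  define R where "R = {\<eta>\<in>space (?P (?V \<union> ?W)). restrict \<eta> ?V \<in> trace Fs x T \<and> restrict \<eta> ?W \<in> trace Fs y T'}"
  have R: "R \<in> sets (?P (?V \<union> ?W))"
  proof -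
    have "Measurable.pred (?P (?V \<union> ?W)) (\<lambda>\<eta>. restrict \<eta> ?V \<in> trace Fs x T)"
      by (rule pred_sets2[OF tr(1) measurable_restrict_subset]) simp
    moreover have "Measurable.pred (?P (?V \<union> ?W)) (\<lambda>\<eta>. restrict \<eta> ?W \<in> trace Fs y T')"
      by (rule pred_sets2[OF tr(2) measurable_restrict_subset]) simp
    ultimately have "Measurable.pred (?P (?V \<union> ?W)) (\<lambda>\<eta>. restrict \<eta> ?V \<in> trace Fs x T \<and> restrict \<eta> ?W \<in> trace Fs y T')"
      by (rule pred_intros_logic)
    then show ?thesis by (simp add: pred_def R_def)
  qed
  have "{\<omega>\<in>space weights. labelled (\<lambda>_. a) x \<omega> \<in> T \<and> labelled (\<lambda>_. a) y \<omega> \<in> T'} =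
      (\<lambda>\<omega>. \<lambda>v\<in>?V \<union> ?W. \<omega> (a v)) -` R \<inter> space weights"
  proof -
    have 1: "restrict (\<lambda>v\<in>?V \<union> ?W. \<omega> (a v)) ?V = (\<lambda>v\<in>?V. \<omega> (a v))"
      "restrict (\<lambda>v\<in>?V \<union> ?W. \<omega> (a v)) ?W = (\<lambda>v\<in>?W. \<omega> (a v))" for \<omega> :: "nat \<Rightarrow> real"
      by (auto simp: restrict_def)
    have 2: "(\<lambda>v\<in>?V \<union> ?W. \<omega> (a v)) \<in> space (?P (?V \<union> ?W))" if "\<omega> \<in> space weights" for \<omega>
      using measurable_space[OF weights_restrict_measurable that] .
    show ?thesis
      using labelled_trace[OF Fs(2) x T, of _ "\<lambda>_. a"] labelled_trace[OF Fs(2) y T', of _ "\<lambda>_. a"] 2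
      unfolding R_def by (auto simp: 1)
  qed
  then have "emeasure weights {\<omega>\<in>space weights. labelled (\<lambda>_. a) x \<omega> \<in> T \<and> labelled (\<lambda>_. a) y \<omega> \<in> T'} =
      emeasure (distr weights (?P (?V \<union> ?W)) (\<lambda>\<omega>. \<lambda>v\<in>?V \<union> ?W. \<omega> (a v))) R"
    by (simp only: emeasure_distr[OF weights_restrict_measurable R])
  also have "\<dots> = emeasure (?P (?V \<union> ?W)) R" by (simp only: distr_weights[OF inj])
  also have "\<dots> = emeasure (distr (?P ?V \<Otimes>\<^sub>M ?P ?W) (?P (?V \<union> ?W)) (merge ?V ?W)) R"
    using Fs(1) by (subst P.distr_merge[OF disj]) (simp_all add: sites_def)
  also have "\<dots> = emeasure (?P ?V \<Otimes>\<^sub>M ?P ?W) (merge ?V ?W -` R \<inter> space (?P ?V \<Otimes>\<^sub>M ?P ?W))"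
    by (rule emeasure_distr[OF measurable_merge R])
  also have "merge ?V ?W -` R \<inter> space (?P ?V \<Otimes>\<^sub>M ?P ?W) = trace Fs x T \<times> trace Fs y T'"
  proof (intro equalityI subsetI)
    fix p assume "p \<in> merge ?V ?W -` R \<inter> space (?P ?V \<Otimes>\<^sub>M ?P ?W)"
    then obtain \<eta> \<theta> where p: "p = (\<eta>, \<theta>)" "\<eta> \<in> space (?P ?V)" "\<theta> \<in> space (?P ?W)" "merge ?V ?W (\<eta>, \<theta>) \<in> R"
      by (auto simp: space_pair_measure)
    have "restrict \<eta> ?V = \<eta>" "restrict \<theta> ?W = \<theta>" using p by (auto simp: space_PiM PiE_restrict)
    then show "p \<in> trace Fs x T \<times> trace Fs y T'" using p disj by (simp add: R_def)
  next
    fix p assume "p \<in> trace Fs x T \<times> trace Fs y T'"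
    then obtain \<eta> \<theta> where p: "p = (\<eta>, \<theta>)" "\<eta> \<in> trace Fs x T" "\<theta> \<in> trace Fs y T'" by blast
    then have sp: "\<eta> \<in> space (?P ?V)" "\<theta> \<in> space (?P ?W)" by (auto simp: trace_def)
    then have sp2: "(\<eta>, \<theta>) \<in> space (?P ?V \<Otimes>\<^sub>M ?P ?W)" by (simp add: space_pair_measure)
    have "restrict \<eta> ?V = \<eta>" "restrict \<theta> ?W = \<theta>" using sp by (auto simp: space_PiM PiE_restrict)
    then show "p \<in> merge ?V ?W -` R \<inter> space (?P ?V \<Otimes>\<^sub>M ?P ?W)"
      using p sp2 disj measurable_space[OF measurable_merge sp2] by (simp add: R_def)
  qed
  also have "emeasure (?P ?V \<Otimes>\<^sub>M ?P ?W) (trace Fs x T \<times> trace Fs y T') =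
      emeasure (?P ?V) (trace Fs x T) * emeasure (?P ?W) (trace Fs y T')"
    by (rule W.emeasure_pair_measure_Times[OF tr])
  finally show ?thesis
    by (simp only: emeasure_kernel_trace[OF Fs(2) x T] emeasure_kernel_trace[OF Fs(2) y T'])
qed

section \<open>Second moments of random weights on cells\<close>

text \<open>Cells are preimages under \<open>h\<close> of cylinders of length \<open>n\<close>. They
  refine as \<open>n\<close> grows and, \<open>h\<close> being injective, eventually separate any
  finite set of points; \<open>to_nat\<close> turns a cell into the index of its weight.\<close>

definition cell :: "nat \<Rightarrow> 'a \<Rightarrow> nat" where
  "cell n x = to_nat (prefix n (h x))"

lemma cell_measurable: "cell n \<in> measurable \<nu> (count_space UNIV)"
  unfolding cell_def[abs_def]
  by (rule measurable_compose[OF measurable_compose[OF h measurable_prefix]]) simp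

lemma cell_eq_iff: "cell n x = cell n y \<longleftrightarrow> prefix n (h x) = prefix n (h y)"
  by (simp only: cell_def to_nat_split)

lemma singleton_sets: "a \<in> space \<nu> \<Longrightarrow> {a} \<in> sets \<nu>"
proof -
  assume a: "a \<in> space \<nu>"
  have "Measurable.pred \<nu> (\<lambda>x. x = a)"
    by (rule pred_eq[OF measurable_ident measurable_const[OF a], simplified])
  then have "{x\<in>space \<nu>. x = a} \<in> sets \<nu>" by (simp add: pred_def)
  also have "{x\<in>space \<nu>. x = a} = {a}" using a by auto
  finally show ?thesis .
qed

text \<open>Components are countable, being addressed by words. This is where the absence of atoms
  enters.\<close>

lemma component_null:
  assumes "atom_free \<nu>" "x \<in> space \<nu>"
  shows "component E x \<in> null_sets \<nu>"
proof -
  have "{a} \<in> null_sets \<nu>" if "a \<in> component E x" for a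
  proof -
    have "a \<in> space \<nu>" using component_space[OF assms(2)] that by blast
    then show ?thesis
      using assms(1) singleton_sets by (simp add: atom_free_def null_sets_def emeasure_eq_measure)
  qed
  then have "(\<Union>a\<in>component E x. {a}) \<in> null_sets \<nu>"
    by (rule null_sets_UN'[OF countable_component[OF assms(2)]])
  then show ?thesis by simp
qed

text \<open>Outside a collision the weights seen from the two points are independent and uniform.\<close>

definition collision :: "('a \<Rightarrow> 'a) set \<Rightarrow> nat \<Rightarrow> ('a \<times> 'a) set" where
  "collision Fs n = {p \<in> space (\<nu> \<Otimes>\<^sub>M \<nu>). \<exists>f\<in>Fs. \<exists>f'\<in>Fs. f (fst p) = f' (snd p) \<or>
     (f (fst p) \<noteq> f' (snd p) \<and> cell n (f (fst p)) = cell n (f' (snd p))) \<or>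
     (f (fst p) \<noteq> f' (fst p) \<and> cell n (f (fst p)) = cell n (f' (fst p))) \<or>
     (f (snd p) \<noteq> f' (snd p) \<and> cell n (f (snd p)) = cell n (f' (snd p)))}"

lemma not_collision:
  assumes "x \<in> space \<nu>" "y \<in> space \<nu>" "(x, y) \<notin> collision Fs n"
  shows "sites Fs x \<inter> sites Fs y = {}" "inj_on (cell n) (sites Fs x \<union> sites Fs y)"
proof -
  have *: "\<not> (\<exists>f\<in>Fs. \<exists>f'\<in>Fs. f x = f' y \<or>
     (f x \<noteq> f' y \<and> cell n (f x) = cell n (f' y)) \<or>
     (f x \<noteq> f' x \<and> cell n (f x) = cell n (f' x)) \<or>
     (f y \<noteq> f' y \<and> cell n (f y) = cell n (f' y)))"
    using assms by (simp add: collision_def space_pair_measure) blast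
  show "sites Fs x \<inter> sites Fs y = {}" using * by (auto simp: sites_def)
  show "inj_on (cell n) (sites Fs x \<union> sites Fs y)"
  proof (rule inj_onI)
    fix a b assume ab: "a \<in> sites Fs x \<union> sites Fs y" "b \<in> sites Fs x \<union> sites Fs y" "cell n a = cell n b"
    show "a = b"
    proof (rule ccontr)
      assume "a \<noteq> b"
      with ab * show False unfolding sites_def by (elim UnE imageE) metis+
    qed
  qed
qed

lemma collision_sets:
  assumes Fs: "finite Fs" "Fs \<subseteq> choices"
  shows "collision Fs n \<in> sets (\<nu> \<Otimes>\<^sub>M \<nu>)"
proof -
  let ?N = "\<nu> \<Otimes>\<^sub>M \<nu>"
  have f: "f \<in> measurable \<nu> \<nu>" if "f \<in> Fs" for f using that Fs(2) by (auto simp: choices_def)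
  have eq: "Measurable.pred ?N (\<lambda>p. f (s p) = f' (t p))"
    if "f \<in> Fs" "f' \<in> Fs" "s \<in> measurable ?N \<nu>" "t \<in> measurable ?N \<nu>" for f f' s t
    by (rule pred_eq[OF measurable_compose[OF that(3) f[OF that(1)]] measurable_compose[OF that(4) f[OF that(2)]]])
  have cell: "Measurable.pred ?N (\<lambda>p. cell n (f (s p)) = cell n (f' (t p)))"
    if "f \<in> Fs" "f' \<in> Fs" "s \<in> measurable ?N \<nu>" "t \<in> measurable ?N \<nu>" for f f' s t
    by (rule measurable_count_space_binary[where h="(=)",
        OF measurable_compose[OF measurable_compose[OF that(3) f[OF that(1)]] cell_measurable]
           measurable_compose[OF measurable_compose[OF that(4) f[OF that(2)]] cell_measurable]])
  have "Measurable.pred ?N (\<lambda>p. f (fst p) = f' (snd p) \<or>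
     (f (fst p) \<noteq> f' (snd p) \<and> cell n (f (fst p)) = cell n (f' (snd p))) \<or>
     (f (fst p) \<noteq> f' (fst p) \<and> cell n (f (fst p)) = cell n (f' (fst p))) \<or>
     (f (snd p) \<noteq> f' (snd p) \<and> cell n (f (snd p)) = cell n (f' (snd p))))"
    if "f \<in> Fs" "f' \<in> Fs" for f f'
  proof -
    note e = eq[OF that measurable_fst measurable_snd] eq[OF that measurable_fst measurable_fst]
      eq[OF that measurable_snd measurable_snd]
    note c = cell[OF that measurable_fst measurable_snd] cell[OF that measurable_fst measurable_fst]
      cell[OF that measurable_snd measurable_snd]
    note neg = pred_intros_logic(2) and conj = pred_intros_logic(3) and disj = pred_intros_logic(5)
    note ec = conj[OF neg[OF e(1)] c(1)] conj[OF neg[OF e(2)] c(2)] conj[OF neg[OF e(3)] c(3)]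
    show ?thesis by (rule disj[OF e(1) disj[OF ec(1) disj[OF ec(2) ec(3)]]])
  qed
  then have "Measurable.pred ?N (\<lambda>p. \<exists>f\<in>Fs. \<exists>f'\<in>Fs. f (fst p) = f' (snd p) \<or>
     (f (fst p) \<noteq> f' (snd p) \<and> cell n (f (fst p)) = cell n (f' (snd p))) \<or>
     (f (fst p) \<noteq> f' (fst p) \<and> cell n (f (fst p)) = cell n (f' (fst p))) \<or>
     (f (snd p) \<noteq> f' (snd p) \<and> cell n (f (snd p)) = cell n (f' (snd p))))"
    by (intro pred_intros_finite(4)[OF Fs(1)])
  then show ?thesis by (simp add: pred_def collision_def)
qed

text \<open>For fixed \<open>x\<close> and \<open>y\<close>, fine cells separate their finitely many
  sites, so a collision at every level means that a site of \<open>x\<close> equals a site of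
  \<open>y\<close>. Then \<open>y\<close> lies in the component of that site, a null set, and Fubini
  concludes.\<close>

lemma collision_null:
  assumes Fs: "finite Fs" "Fs \<subseteq> choices" and "atom_free \<nu>"
  shows "emeasure (\<nu> \<Otimes>\<^sub>M \<nu>) (\<Inter>n. collision Fs n) = 0"
proof -
  have sets: "(\<Inter>n. collision Fs n) \<in> sets (\<nu> \<Otimes>\<^sub>M \<nu>)"
    using collision_sets[OF Fs] by (intro sets.countable_INT) auto
  have null: "emeasure \<nu> (Pair x -` (\<Inter>n. collision Fs n)) = 0" if x: "x \<in> space \<nu>" for x
  proof -
    have "Pair x -` (\<Inter>n. collision Fs n) \<subseteq> (\<Union>f\<in>Fs. component E (f x))"
    proof
      fix y assume "y \<in> Pair x -` (\<Inter>n. collision Fs n)"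
      then have xy: "(x, y) \<in> collision Fs n" for n by auto
      then have y: "y \<in> space \<nu>" by (auto simp: collision_def space_pair_measure)
      have "finite (h ` (sites Fs x \<union> sites Fs y))" using Fs(1) by (simp add: sites_def)
      from finite_separated_prefix[OF this] obtain n where n: "inj_on (prefix n) (h ` (sites Fs x \<union> sites Fs y))" ..
      have sp: "sites Fs x \<union> sites Fs y \<subseteq> space \<nu>"
        using sites_component[OF Fs(2)] component_space x y by blast
      have inj: "a = b" if "a \<in> sites Fs x \<union> sites Fs y" "b \<in> sites Fs x \<union> sites Fs y" "cell n a = cell n b" for a b
      proof -
        have "h a = h b" by (rule inj_onD[OF n]) (use that in \<open>auto simp: cell_eq_iff\<close>)
        then show ?thesis by (rule inj_onD[OF inj_on_h]) (use that sp in blast)+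
      qed
      obtain f f' where ff: "f \<in> Fs" "f' \<in> Fs" and cases: "f x = f' y \<or>
          (f x \<noteq> f' y \<and> cell n (f x) = cell n (f' y)) \<or>
          (f x \<noteq> f' x \<and> cell n (f x) = cell n (f' x)) \<or>
          (f y \<noteq> f' y \<and> cell n (f y) = cell n (f' y))"
        using xy[of n] unfolding collision_def mem_Collect_eq fst_conv snd_conv by blast
      have "f x \<in> sites Fs x" "f' x \<in> sites Fs x" "f y \<in> sites Fs y" "f' y \<in> sites Fs y"
        using ff by (simp_all add: sites_def)
      then have eq: "f x = f' y" using cases inj[of "f x" "f' y"] inj[of "f x" "f' x"] inj[of "f y" "f' y"] by blast
      then have "f x \<in> component E y" using Fs(2) ff y by (auto simp: choices_def)
      then have "component E (f x) = component E y" by (rule component_eq[OF sym_E])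
      then show "y \<in> (\<Union>f\<in>Fs. component E (f x))" using ff(1) component_refl by fast
    qed
    moreover have "(\<Union>f\<in>Fs. component E (f x)) \<in> null_sets \<nu>"
    proof (rule null_sets_UN'[OF countable_finite[OF Fs(1)]])
      fix f assume "f \<in> Fs"
      then have "f x \<in> space \<nu>" using Fs(2) x component_space by (auto simp: choices_def)
      then show "component E (f x) \<in> null_sets \<nu>" by (rule component_null[OF assms(3)])
    qed
    moreover have "Pair x -` (\<Inter>n. collision Fs n) \<in> sets \<nu>" by (rule sets_Pair1[OF sets])
    ultimately have "Pair x -` (\<Inter>n. collision Fs n) \<in> null_sets \<nu>" by (metis null_sets_subset)
    then show ?thesis by (rule null_setsD1)
  qed
  have "emeasure (\<nu> \<Otimes>\<^sub>M \<nu>) (\<Inter>n. collision Fs n) = (\<integral>\<^sup>+x. emeasure \<nu> (Pair x -` (\<Inter>n. collision Fs n)) \<partial>\<nu>)"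
    by (rule emeasure_pair_measure_alt[OF sets])
  also have "\<dots> = (\<integral>\<^sup>+x. 0 \<partial>\<nu>)" by (rule nn_integral_cong) (rule null)
  finally show ?thesis by simp
qed

lemma collision_small:
  assumes Fs: "finite Fs" "Fs \<subseteq> choices" and "atom_free \<nu>" and "\<delta> > 0"
  shows "\<exists>n. measure (\<nu> \<Otimes>\<^sub>M \<nu>) (collision Fs n) < \<delta>"
proof -
  interpret PP: pair_prob_space \<nu> \<nu> ..
  have mono: "cell n a = cell n b" if "cell (Suc n) a = cell (Suc n) b" for n a b
    using that unfolding cell_eq_iff prefix_eq_iff by simp
  have "(\<lambda>n. measure (\<nu> \<Otimes>\<^sub>M \<nu>) (collision Fs n)) \<longlonglongrightarrow> measure (\<nu> \<Otimes>\<^sub>M \<nu>) (\<Inter>n. collision Fs n)"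
  proof (rule PP.finite_Lim_measure_decseq)
    show "range (collision Fs) \<subseteq> sets (\<nu> \<Otimes>\<^sub>M \<nu>)" using collision_sets[OF Fs] by auto
    show "decseq (collision Fs)"
    proof (rule decseq_SucI)
      fix n show "collision Fs (Suc n) \<subseteq> collision Fs n"
      proof
        fix p assume "p \<in> collision Fs (Suc n)"
        then obtain f f' where f: "p \<in> space (\<nu> \<Otimes>\<^sub>M \<nu>)" "f \<in> Fs" "f' \<in> Fs" and "f (fst p) = f' (snd p) \<or>
            (f (fst p) \<noteq> f' (snd p) \<and> cell (Suc n) (f (fst p)) = cell (Suc n) (f' (snd p))) \<or>
            (f (fst p) \<noteq> f' (fst p) \<and> cell (Suc n) (f (fst p)) = cell (Suc n) (f' (fst p))) \<or>
            (f (snd p) \<noteq> f' (snd p) \<and> cell (Suc n) (f (snd p)) = cell (Suc n) (f' (snd p)))"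
          unfolding collision_def mem_Collect_eq by blast
        then have "f (fst p) = f' (snd p) \<or>
            (f (fst p) \<noteq> f' (snd p) \<and> cell n (f (fst p)) = cell n (f' (snd p))) \<or>
            (f (fst p) \<noteq> f' (fst p) \<and> cell n (f (fst p)) = cell n (f' (fst p))) \<or>
            (f (snd p) \<noteq> f' (snd p) \<and> cell n (f (snd p)) = cell n (f' (snd p)))"
          using mono[of n] by blast
        with f show "p \<in> collision Fs n" unfolding collision_def mem_Collect_eq by blast
      qed
    qed
  qed
  moreover have "measure (\<nu> \<Otimes>\<^sub>M \<nu>) (\<Inter>n. collision Fs n) = 0"
    using collision_null[OF assms(1-3)] by (simp add: measure_def)
  ultimately have "(\<lambda>n. measure (\<nu> \<Otimes>\<^sub>M \<nu>) (collision Fs n)) \<longlonglongrightarrow> 0" by simp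
  from LIMSEQ_D[OF this assms(4)] obtain n where "norm (measure (\<nu> \<Otimes>\<^sub>M \<nu>) (collision Fs n) - 0) < \<delta>" by blast
  then show ?thesis by auto
qed

abbreviation drawn :: "nat \<Rightarrow> 'a \<Rightarrow> (nat \<Rightarrow> real) \<Rightarrow> 'a \<times> ('a \<Rightarrow> real)" where
  "drawn n \<equiv> labelled (\<lambda>_. cell n)"

lemma drawn_measurable:
  assumes "Fs \<subseteq> choices"
  shows "(\<lambda>p. drawn n (fst p) (snd p)) \<in> measurable (\<nu> \<Otimes>\<^sub>M weights) (lift_sub Fs)"
proof (rule labelled_measurable[OF assms])
  show "(\<lambda>x. cell n (f x)) \<in> measurable \<nu> (count_space UNIV)" if "f \<in> Fs" for f
    using that assms by (intro measurable_compose[OF _ cell_measurable]) (auto simp: choices_def)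
qed

definition frequency :: "nat \<Rightarrow> ('a \<times> ('a \<Rightarrow> real)) set \<Rightarrow> (nat \<Rightarrow> real) \<Rightarrow> real" where
  "frequency n T \<omega> = measure \<nu> {x\<in>space \<nu>. drawn n x \<omega> \<in> T}"

lemma frequency_measurable:
  assumes Fs: "Fs \<subseteq> choices" and T: "T \<in> sets (lift_sub Fs)"
  shows "frequency n T \<in> borel_measurable weights"
    and "\<omega> \<in> space weights \<Longrightarrow> {x\<in>space \<nu>. drawn n x \<omega> \<in> T} \<in> sets \<nu>"
proof -
  interpret W: prob_space weights by (rule prob_space_PiM_unit)
  have swap: "(\<lambda>p. drawn n (snd p) (fst p)) \<in> measurable (weights \<Otimes>\<^sub>M \<nu>) (lift_sub Fs)"
    using measurable_compose[OF measurable_pair_swap' drawn_measurable[OF Fs, of n]] by (simp add: split_beta')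
  define A where "A = (\<lambda>p. drawn n (snd p) (fst p)) -` T \<inter> space (weights \<Otimes>\<^sub>M \<nu>)"
  have A: "A \<in> sets (weights \<Otimes>\<^sub>M \<nu>)" unfolding A_def by (rule measurable_sets[OF swap T])
  have sec: "Pair \<omega> -` A = {x\<in>space \<nu>. drawn n x \<omega> \<in> T}" if "\<omega> \<in> space weights" for \<omega>
    using that by (auto simp: A_def space_pair_measure)
  show "{x\<in>space \<nu>. drawn n x \<omega> \<in> T} \<in> sets \<nu>" if "\<omega> \<in> space weights"
    using sets_Pair1[OF A, of \<omega>] sec[OF that] by simp
  have "(\<lambda>\<omega>. measure \<nu> (Pair \<omega> -` A)) \<in> borel_measurable weights"
    unfolding measure_def using measurable_emeasure_Pair[OF A] by simp
  also have "?this \<longleftrightarrow> frequency n T \<in> borel_measurable weights"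
    by (rule measurable_cong) (simp add: sec frequency_def)
  finally show "frequency n T \<in> borel_measurable weights" .
qed

text \<open>The product of two frequencies is the probability that two independent points, given the
  same \<open>\<omega>\<close>, realise \<open>T\<close> and \<open>T'\<close>. Exchanging integrals
  turns its mean into an average of joint probabilities over pairs of points, and these factor
  except on collisions.\<close>

lemma frequency_product:
  assumes Fs: "finite Fs" "Fs \<subseteq> choices" and T: "T \<in> sets (lift_sub Fs)" and T': "T' \<in> sets (lift_sub Fs)"
  shows "\<bar>(\<integral>\<omega>. frequency n T \<omega> * frequency n T' \<omega> \<partial>weights) -
    measure (lift_measure \<nu> E) T * measure (lift_measure \<nu> E) T'\<bar> \<le> measure (\<nu> \<Otimes>\<^sub>M \<nu>) (collision Fs n)"
proof -
  interpret W: prob_space weights by (rule prob_space_PiM_unit)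
  interpret L: prob_space "lift_measure \<nu> E" by (rule prob_space_lift_measure)
  interpret PP: pair_prob_space \<nu> \<nu> ..
  interpret WP: pair_prob_space weights "\<nu> \<Otimes>\<^sub>M \<nu>" ..
  let ?N = "weights \<Otimes>\<^sub>M (\<nu> \<Otimes>\<^sub>M \<nu>)"
  let ?f = "frequency n"
  have TL: "T \<in> sets (lift_algebra \<nu> E)" "T' \<in> sets (lift_algebra \<nu> E)"
    using lift_sub_mono[OF Fs(2)] T T' by (auto simp: lift_algebra_eq)
  define C where "C = {p\<in>space ?N. drawn n (fst (snd p)) (fst p) \<in> T \<and> drawn n (snd (snd p)) (fst p) \<in> T'}"
  have C: "C \<in> sets ?N"
  proof -
    have "(\<lambda>p. drawn n (fst (snd p)) (fst p)) \<in> measurable ?N (lift_sub Fs)"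
      "(\<lambda>p. drawn n (snd (snd p)) (fst p)) \<in> measurable ?N (lift_sub Fs)"
      using measurable_compose[OF measurable_Pair[OF measurable_compose[OF measurable_snd measurable_fst] measurable_fst]
          drawn_measurable[OF Fs(2), of n]]
        measurable_compose[OF measurable_Pair[OF measurable_compose[OF measurable_snd measurable_snd] measurable_fst]
          drawn_measurable[OF Fs(2), of n]] by simp_all
    then have "Measurable.pred ?N (\<lambda>p. drawn n (fst (snd p)) (fst p) \<in> T \<and> drawn n (snd (snd p)) (fst p) \<in> T')"
      by (intro pred_intros_logic pred_sets2[OF T] pred_sets2[OF T'])
    then show ?thesis by (simp add: pred_def C_def)
  qed
  define pr where "pr z = emeasure weights ((\<lambda>\<omega>. (\<omega>, z)) -` C)" for z
  have pr_meas: "pr \<in> borel_measurable (\<nu> \<Otimes>\<^sub>M \<nu>)"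
    unfolding pr_def by (rule WP.measurable_emeasure_Pair2[OF C])
  define qq where "qq z = emeasure (kernel (fst z)) T * emeasure (kernel (snd z)) T'" for z
  have q_meas: "(\<lambda>x. emeasure (kernel x) S) \<in> borel_measurable \<nu>" if "S \<in> sets (lift_algebra \<nu> E)" for S
    by (rule measurable_emeasure_kernel[OF kernel_measurable that])
  have qq_meas: "qq \<in> borel_measurable (\<nu> \<Otimes>\<^sub>M \<nu>)"
    unfolding qq_def
    by (intro borel_measurable_times_ennreal measurable_compose[OF measurable_fst q_meas[OF TL(1)]]
        measurable_compose[OF measurable_snd q_meas[OF TL(2)]])
  let ?c = "indicator (collision Fs n) :: _ \<Rightarrow> ennreal"
  have c_meas: "?c \<in> borel_measurable (\<nu> \<Otimes>\<^sub>M \<nu>)"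
    using collision_sets[OF Fs] by (rule borel_measurable_indicator)
  \<comment> \<open>Closeness is stated as two inequalities because subtraction in
    \<open>ennreal\<close> is truncated. On collisions both quantities are at most 1.\<close>
  have close: "pr z \<le> qq z + ?c z \<and> qq z \<le> pr z + ?c z" if z: "z \<in> space (\<nu> \<Otimes>\<^sub>M \<nu>)" for z
  proof -
    obtain x y where xy: "z = (x, y)" "x \<in> space \<nu>" "y \<in> space \<nu>" using z by (auto simp: space_pair_measure)
    show ?thesis
    proof (cases "z \<in> collision Fs n")
      case True
      have "pr z \<le> 1" unfolding pr_def by (rule W.emeasure_le_1)
      moreover have "qq z \<le> 1 * 1" unfolding qq_def xy fst_conv snd_conv
        using xy prob_space.emeasure_le_1[OF prob_space_kernel] by (intro mult_mono) auto
      ultimately show ?thesis using True by (auto intro: add_increasing)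
    next
      case False
      have "(\<lambda>\<omega>. (\<omega>, z)) -` C = {\<omega>\<in>space weights. drawn n x \<omega> \<in> T \<and> drawn n y \<omega> \<in> T'}"
        using xy by (auto simp: C_def space_pair_measure)
      then have "pr z = qq z"
        using emeasure_labelled_pair[OF Fs xy(2,3) T T' not_collision[OF xy(2,3) False[unfolded xy(1)]]]
        by (simp add: pr_def qq_def xy(1))
      then show ?thesis by simp
    qed
  qed
  have fs: "{x\<in>space \<nu>. drawn n x \<omega> \<in> S} \<in> sets \<nu>" if "\<omega> \<in> space weights" "S \<in> sets (lift_sub Fs)" for \<omega> S
    using frequency_measurable(2)[OF Fs(2) that(2,1)] .
  have "ennreal (?f T \<omega> * ?f T' \<omega>) = emeasure (\<nu> \<Otimes>\<^sub>M \<nu>) (Pair \<omega> -` C)" if \<omega>: "\<omega> \<in> space weights" for \<omega>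
  proof -
    have "Pair \<omega> -` C = {x\<in>space \<nu>. drawn n x \<omega> \<in> T} \<times> {x\<in>space \<nu>. drawn n x \<omega> \<in> T'}"
      using \<omega> by (auto simp: C_def space_pair_measure)
    then show ?thesis
      using emeasure_pair_measure_Times[OF fs[OF \<omega> T] fs[OF \<omega> T']]
      by (simp add: frequency_def emeasure_eq_measure ennreal_mult)
  qed
  then have "(\<integral>\<^sup>+\<omega>. ennreal (?f T \<omega> * ?f T' \<omega>) \<partial>weights) = (\<integral>\<^sup>+\<omega>. emeasure (\<nu> \<Otimes>\<^sub>M \<nu>) (Pair \<omega> -` C) \<partial>weights)"
    by (rule nn_integral_cong)
  also have "\<dots> = emeasure ?N C" by (rule PP.emeasure_pair_measure_alt[OF C, symmetric])
  also have "\<dots> = (\<integral>\<^sup>+z. pr z \<partial>(\<nu> \<Otimes>\<^sub>M \<nu>))"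
    unfolding pr_def by (rule WP.emeasure_pair_measure_alt2[OF C])
  finally have Epr: "(\<integral>\<^sup>+\<omega>. ennreal (?f T \<omega> * ?f T' \<omega>) \<partial>weights) = (\<integral>\<^sup>+z. pr z \<partial>(\<nu> \<Otimes>\<^sub>M \<nu>))" .
  have fm: "?f S \<in> borel_measurable weights" if "S \<in> sets (lift_sub Fs)" for S
    using frequency_measurable(1)[OF Fs(2) that] .
  have f01: "0 \<le> ?f S \<omega>" "?f S \<omega> \<le> 1" for S \<omega> by (simp_all add: frequency_def)
  have int: "integrable weights (\<lambda>\<omega>. ?f T \<omega> * ?f T' \<omega>)"
  proof (rule W.integrable_const_bound[where B=1])
    show "AE \<omega> in weights. norm (?f T \<omega> * ?f T' \<omega>) \<le> 1"
      using f01 by (intro AE_I2) (simp add: mult_le_one)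
  qed (intro borel_measurable_times fm T T')
  have Epr': "ennreal (\<integral>\<omega>. ?f T \<omega> * ?f T' \<omega> \<partial>weights) = (\<integral>\<^sup>+z. pr z \<partial>(\<nu> \<Otimes>\<^sub>M \<nu>))"
    unfolding Epr[symmetric] using f01 by (intro nn_integral_eq_integral[symmetric] int) auto
  have "(\<integral>\<^sup>+z. qq z \<partial>(\<nu> \<Otimes>\<^sub>M \<nu>)) = (\<integral>\<^sup>+x. \<integral>\<^sup>+y. qq (x, y) \<partial>\<nu> \<partial>\<nu>)"
    by (rule nn_integral_fst[OF qq_meas, symmetric])
  also have "\<dots> = (\<integral>\<^sup>+x. emeasure (kernel x) T * emeasure (lift_measure \<nu> E) T' \<partial>\<nu>)"
    by (simp add: qq_def nn_integral_cmult q_meas TL emeasure_lift_measure)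
  also have "\<dots> = emeasure (lift_measure \<nu> E) T * emeasure (lift_measure \<nu> E) T'"
    by (simp add: nn_integral_multc q_meas TL emeasure_lift_measure)
  also have "\<dots> = ennreal (L.prob T * L.prob T')"
    by (simp add: L.emeasure_eq_measure ennreal_mult)
  finally have Eqq: "(\<integral>\<^sup>+z. qq z \<partial>(\<nu> \<Otimes>\<^sub>M \<nu>)) = ennreal (L.prob T * L.prob T')" .
  have Ec: "(\<integral>\<^sup>+z. ?c z \<partial>(\<nu> \<Otimes>\<^sub>M \<nu>)) = ennreal (PP.prob (collision Fs n))"
    using collision_sets[OF Fs] by (simp add: PP.emeasure_eq_measure)
  have "(\<integral>\<^sup>+z. pr z \<partial>(\<nu> \<Otimes>\<^sub>M \<nu>)) \<le> (\<integral>\<^sup>+z. qq z + ?c z \<partial>(\<nu> \<Otimes>\<^sub>M \<nu>))"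
    using close by (intro nn_integral_mono) blast
  also have "\<dots> = (\<integral>\<^sup>+z. qq z \<partial>(\<nu> \<Otimes>\<^sub>M \<nu>)) + (\<integral>\<^sup>+z. ?c z \<partial>(\<nu> \<Otimes>\<^sub>M \<nu>))"
    by (rule nn_integral_add[OF qq_meas c_meas])
  finally have 1: "ennreal (\<integral>\<omega>. ?f T \<omega> * ?f T' \<omega> \<partial>weights) \<le> ennreal (L.prob T * L.prob T' + PP.prob (collision Fs n))"
    by (simp add: Epr' Eqq Ec)
  have "(\<integral>\<^sup>+z. qq z \<partial>(\<nu> \<Otimes>\<^sub>M \<nu>)) \<le> (\<integral>\<^sup>+z. pr z + ?c z \<partial>(\<nu> \<Otimes>\<^sub>M \<nu>))"
    using close by (intro nn_integral_mono) blast
  also have "\<dots> = (\<integral>\<^sup>+z. pr z \<partial>(\<nu> \<Otimes>\<^sub>M \<nu>)) + (\<integral>\<^sup>+z. ?c z \<partial>(\<nu> \<Otimes>\<^sub>M \<nu>))"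
    by (rule nn_integral_add[OF pr_meas c_meas])
  finally have 2: "ennreal (L.prob T * L.prob T') \<le> ennreal ((\<integral>\<omega>. ?f T \<omega> * ?f T' \<omega> \<partial>weights) + PP.prob (collision Fs n))"
    using f01 by (simp add: Epr'[symmetric] Eqq Ec integral_nonneg_AE)
  have "0 \<le> (\<integral>\<omega>. ?f T \<omega> * ?f T' \<omega> \<partial>weights)"
    using f01 by (intro integral_nonneg_AE AE_I2) simp
  then have nn: "0 \<le> (\<integral>\<omega>. ?f T \<omega> * ?f T' \<omega> \<partial>weights) + PP.prob (collision Fs n)" by simp
  have "(\<integral>\<omega>. ?f T \<omega> * ?f T' \<omega> \<partial>weights) \<le> L.prob T * L.prob T' + PP.prob (collision Fs n)"
    by (rule ennreal_le_iff[THEN iffD1, OF _ 1]) simp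
  moreover have "L.prob T * L.prob T' \<le> (\<integral>\<omega>. ?f T \<omega> * ?f T' \<omega> \<partial>weights) + PP.prob (collision Fs n)"
    by (rule ennreal_le_iff[THEN iffD1, OF nn 2])
  ultimately show ?thesis by linarith
qed

lemma frequency_variance:
  assumes Fs: "finite Fs" "Fs \<subseteq> choices" and T: "T \<in> sets (lift_sub Fs)"
  shows "integrable weights (\<lambda>\<omega>. (frequency n T \<omega> - measure (lift_measure \<nu> E) T)\<^sup>2)"
    and "(\<integral>\<omega>. (frequency n T \<omega> - measure (lift_measure \<nu> E) T)\<^sup>2 \<partial>weights)
      \<le> 3 * measure (\<nu> \<Otimes>\<^sub>M \<nu>) (collision Fs n)"
proof -
  interpret W: prob_space weights by (rule prob_space_PiM_unit)
  interpret L: prob_space "lift_measure \<nu> E" by (rule prob_space_lift_measure)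
  let ?f = "frequency n T" and ?m = "L.prob T" and ?\<beta> = "measure (\<nu> \<Otimes>\<^sub>M \<nu>) (collision Fs n)"
  have fm: "?f \<in> borel_measurable weights"
    using frequency_measurable(1)[OF Fs(2) T] .
  have f01: "0 \<le> ?f \<omega>" "?f \<omega> \<le> 1" for \<omega> by (simp_all add: frequency_def)
  have int1: "integrable weights ?f"
    by (rule W.integrable_const_bound[where B=1]) (use f01 fm in auto)
  have int2: "integrable weights (\<lambda>\<omega>. ?f \<omega> * ?f \<omega>)"
    by (rule W.integrable_const_bound[where B=1]) (use f01 fm in \<open>auto simp: mult_le_one\<close>)
  have expand: "(?f \<omega> - ?m)\<^sup>2 = ?f \<omega> * ?f \<omega> - 2 * ?m * ?f \<omega> + ?m * ?m" for \<omega>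
    by (simp add: power2_eq_square algebra_simps)
  show "integrable weights (\<lambda>\<omega>. (?f \<omega> - ?m)\<^sup>2)"
    unfolding expand using int1 int2 by simp
  \<comment> \<open>The estimate of the mean is \<open>frequency_product\<close> with a certain
    second event, whose frequency is 1.\<close>
  have \<Omega>_sub: "\<Omega> \<in> sets (lift_sub Fs)" using sets.top[of "lift_sub Fs"] by simp
  have one: "frequency n \<Omega> \<omega> = 1" if "\<omega> \<in> space weights" for \<omega>
  proof -
    have "{x\<in>space \<nu>. drawn n x \<omega> \<in> \<Omega>} = space \<nu>" using labelled_lift_space that by auto
    then show ?thesis by (simp add: frequency_def prob_space)
  qed
  have "(\<integral>\<omega>. ?f \<omega> * frequency n \<Omega> \<omega> \<partial>weights) = (\<integral>\<omega>. ?f \<omega> \<partial>weights)"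
    by (rule Bochner_Integration.integral_cong) (simp_all add: one)
  moreover have "L.prob \<Omega> = 1" using L.prob_space by simp
  ultimately have 1: "\<bar>(\<integral>\<omega>. ?f \<omega> \<partial>weights) - ?m\<bar> \<le> ?\<beta>"
    using frequency_product[OF Fs T \<Omega>_sub, of n] by simp
  have 2: "\<bar>(\<integral>\<omega>. ?f \<omega> * ?f \<omega> \<partial>weights) - ?m * ?m\<bar> \<le> ?\<beta>"
    using frequency_product[OF Fs T T, of n] .
  have "(\<integral>\<omega>. (?f \<omega> - ?m)\<^sup>2 \<partial>weights) =
      (\<integral>\<omega>. ?f \<omega> * ?f \<omega> \<partial>weights) - 2 * ?m * (\<integral>\<omega>. ?f \<omega> \<partial>weights) + ?m * ?m"
    unfolding expand using int1 int2 by (simp add: W.prob_space)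
  also have "\<dots> = ((\<integral>\<omega>. ?f \<omega> * ?f \<omega> \<partial>weights) - ?m * ?m) - 2 * (?m * ((\<integral>\<omega>. ?f \<omega> \<partial>weights) - ?m))"
    by (simp add: algebra_simps)
  \<comment> \<open>One error from the second moment and two from the cross term, where
    \<open>?m\<close> is at most 1; hence the constant 3.\<close>
  also have "\<dots> \<le> ?\<beta> + 2 * (1 * ?\<beta>)"
  proof -
    have "\<bar>?m * ((\<integral>\<omega>. ?f \<omega> \<partial>weights) - ?m)\<bar> \<le> 1 * ?\<beta>"
      unfolding abs_mult using 1 by (intro mult_mono) auto
    then show ?thesis using 2 by linarith
  qed
  finally show "(\<integral>\<omega>. (?f \<omega> - ?m)\<^sup>2 \<partial>weights) \<le> 3 * ?\<beta>" by simp
qed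

text \<open>Summing the squared deviations over \<open>TT\<close> lets a single bound on a mean
  yield one outcome that is good for all events at once.\<close>

lemma weights_realising_frequencies:
  assumes Fs: "finite Fs" "Fs \<subseteq> choices" and "atom_free \<nu>"
    and TT: "finite TT" "TT \<subseteq> sets (lift_sub Fs)" and "\<epsilon> > 0"
  shows "\<exists>n. \<exists>\<omega>\<in>space weights. \<forall>T\<in>TT. \<bar>frequency n T \<omega> - measure (lift_measure \<nu> E) T\<bar> < \<epsilon>"
proof -
  interpret W: prob_space weights by (rule prob_space_PiM_unit)
  let ?m = "measure (lift_measure \<nu> E)"
  \<comment> \<open>Then \<open>card TT\<close> variances of at most \<open>3 * \<delta>\<close> add
    up to less than \<open>\<epsilon>\<^sup>2\<close>; the added 1 makes this strict and covers
    empty \<open>TT\<close>.\<close>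
  define \<delta> where "\<delta> = \<epsilon>\<^sup>2 / (3 * (real (card TT) + 1))"
  have "\<delta> > 0" using assms(6) by (simp add: \<delta>_def)
  then obtain n where n: "measure (\<nu> \<Otimes>\<^sub>M \<nu>) (collision Fs n) < \<delta>"
    using collision_small[OF assms(1-3)] by blast
  define V where "V \<omega> = (\<Sum>T\<in>TT. (frequency n T \<omega> - ?m T)\<^sup>2)" for \<omega>
  have int: "integrable weights (\<lambda>\<omega>. (frequency n T \<omega> - ?m T)\<^sup>2)" if "T \<in> TT" for T
    using frequency_variance(1)[OF Fs] that TT(2) by blast
  then have int_V: "integrable weights V" unfolding V_def by (rule Bochner_Integration.integrable_sum)
  have "(\<integral>\<omega>. V \<omega> \<partial>weights) = (\<Sum>T\<in>TT. \<integral>\<omega>. (frequency n T \<omega> - ?m T)\<^sup>2 \<partial>weights)"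
    unfolding V_def using int by (rule Bochner_Integration.integral_sum)
  also have "\<dots> \<le> (\<Sum>T\<in>TT. 3 * \<delta>)"
  proof (rule sum_mono)
    fix T assume "T \<in> TT"
    then have "(\<integral>\<omega>. (frequency n T \<omega> - ?m T)\<^sup>2 \<partial>weights) \<le> 3 * measure (\<nu> \<Otimes>\<^sub>M \<nu>) (collision Fs n)"
      using frequency_variance(2)[OF Fs] TT(2) by blast
    then show "(\<integral>\<omega>. (frequency n T \<omega> - ?m T)\<^sup>2 \<partial>weights) \<le> 3 * \<delta>" using n by linarith
  qed
  also have "\<dots> < \<epsilon>\<^sup>2"
    using assms(6) by (simp add: \<delta>_def field_simps)
  finally have less: "(\<integral>\<omega>. V \<omega> \<partial>weights) < \<epsilon>\<^sup>2" .
  have "\<exists>\<omega>\<in>space weights. V \<omega> < \<epsilon>\<^sup>2"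
  proof (rule ccontr)
    assume "\<not> ?thesis"
    then have "(\<integral>\<omega>. \<epsilon>\<^sup>2 \<partial>weights) \<le> (\<integral>\<omega>. V \<omega> \<partial>weights)"
      using int_V by (intro integral_mono) (auto simp: not_less)
    then show False using less by (simp add: W.prob_space)
  qed
  then obtain \<omega> where \<omega>: "\<omega> \<in> space weights" "V \<omega> < \<epsilon>\<^sup>2" by blast
  have "\<bar>frequency n T \<omega> - ?m T\<bar> < \<epsilon>" if "T \<in> TT" for T
  proof -
    have "(frequency n T \<omega> - ?m T)\<^sup>2 \<le> V \<omega>"
      unfolding V_def by (rule member_le_sum[OF that _ TT(1)]) simp
    then have "\<bar>frequency n T \<omega> - ?m T\<bar>\<^sup>2 < \<epsilon>\<^sup>2" using \<omega>(2) by simp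
    then show ?thesis by (rule power_less_imp_less_base) (use assms(6) in simp)
  qed
  then show ?thesis using \<omega>(1) by blast
qed

section \<open>Local-global equivalence\<close>

text \<open>The projection of the lift preserves the measure and the coloured balls, so the
  distributions agree exactly and this direction holds before closures are taken.\<close>

lemma ball_distribution_base:
  assumes "c \<in> measurable \<nu> (count_space {1..m})"
  shows "ball_distribution D \<nu> E r m c =
    ball_distribution D (lift_measure \<nu> E) (lift_edges \<nu> E) r m (\<lambda>p. c (fst p))"
  unfolding ball_distribution_def ball_in_def[symmetric] space_lift_measure
proof (rule restrict_ext)
  fix F
  have "c \<in> measurable \<nu> (count_space UNIV)"
    using assms by (rule measurable_count_space_UNIV)
  then have A: "{x\<in>space \<nu>. ball_in E r c F x} \<in> sets \<nu>" by (rule ball_in_base_measurable)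
  have "ball_in E r c F (fst p) \<longleftrightarrow> ball_in (lift_edges \<nu> E) r (\<lambda>p. c (fst p)) F p" if "p \<in> \<Omega>" for p
    using ball_in_lift[of "fst p" "snd p" r c "\<lambda>p. c (fst p)" F] that by simp
  then have "{p\<in>\<Omega>. ball_in (lift_edges \<nu> E) r (\<lambda>p. c (fst p)) F p} =
      {p\<in>\<Omega>. fst p \<in> {x\<in>space \<nu>. ball_in E r c F x}}"
    by (auto simp: lift_space_def)
  then show "measure \<nu> {x\<in>space \<nu>. ball_in E r c F x} =
      measure (lift_measure \<nu> E) {p\<in>\<Omega>. ball_in (lift_edges \<nu> E) r (\<lambda>p. c (fst p)) F p}"
    by (simp only: measure_def emeasure_lift_measure_fst[OF A])
qed

lemma ball_distributions_subset:
  "ball_distributions D \<nu> E r m \<subseteq> ball_distributions D (lift_measure \<nu> E) (lift_edges \<nu> E) r m"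
proof
  fix y assume "y \<in> ball_distributions D \<nu> E r m"
  then obtain c where c: "c \<in> measurable \<nu> (count_space {1..m})" "y = ball_distribution D \<nu> E r m c"
    unfolding ball_distributions_def by blast
  have "(\<lambda>p. c (fst p)) \<in> measurable (lift_sub choices) (count_space {1..m})"
    by (rule measurable_compose[OF fst_lift_sub c(1)])
  also have "measurable (lift_sub choices) (count_space {1..m}) =
      measurable (lift_measure \<nu> E) (count_space {1..m})"
    by (rule measurable_cong_sets) (simp_all add: lift_algebra_eq)
  finally show "y \<in> ball_distributions D (lift_measure \<nu> E) (lift_edges \<nu> E) r m"
    unfolding c(2) ball_distribution_base[OF c(1)] ball_distributions_def by (rule imageI)
qed

text \<open>The ball event changes only if some word leads from the root to a point where the
  colourings differ. In the union bound the word \<open>u\<close> costs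
  \<open>Suc d ^ length u\<close>, so the constant depends on \<open>d\<close> and \<open>r\<close>
  alone.\<close>

lemma ball_perturbation:
  assumes c: "c \<in> measurable (lift_sub choices) (count_space UNIV)"
    and c': "c' \<in> measurable (lift_sub choices) (count_space UNIV)"
  shows "\<bar>measure (lift_measure \<nu> E) {p\<in>\<Omega>. ball_in (lift_edges \<nu> E) r c F p} -
      measure (lift_measure \<nu> E) {p\<in>\<Omega>. ball_in (lift_edges \<nu> E) r c' F p}\<bar>
    \<le> (\<Sum>u\<in>words r. real (Suc d) ^ length u) * measure (lift_measure \<nu> E) {p\<in>\<Omega>. c p \<noteq> c' p}"
proof -
  interpret L: prob_space "lift_measure \<nu> E" by (rule prob_space_lift_measure)
  define B where "B = {p\<in>\<Omega>. c p \<noteq> c' p}"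
  define U where "U u = {p\<in>\<Omega>. (act u (fst p), snd p) \<in> B}" for u
  define S where "S c = {p\<in>\<Omega>. ball_in (lift_edges \<nu> E) r c F p}" for c
  have sets_L: "L.events = sets (lift_sub choices)" by (simp add: lift_algebra_eq)
  have "Measurable.pred (lift_sub choices) (\<lambda>p. c p \<noteq> c' p)"
    by (rule measurable_count_space_binary[where h="(\<noteq>)", OF c c'])
  then have B: "B \<in> L.events" unfolding sets_L B_def by (simp add: pred_def)
  have U: "U u \<in> L.events" for u
  proof -
    have "(\<lambda>p. (act u (fst p), snd p)) \<in> measurable (lift_sub choices) (lift_sub choices)"
      by (intro shift_measurable choices_act)
    from measurable_sets[OF this B[unfolded sets_L]] show ?thesis
      unfolding sets_L U_def by (simp add: vimage_def Int_def conj_commute)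
  qed
  have S: "S a \<in> L.events" if "a \<in> measurable (lift_sub choices) (count_space UNIV)" for a
    unfolding S_def sets_L by (rule ball_in_lift_measurable[OF that choices_act])
  have same: "p \<in> S c \<longleftrightarrow> p \<in> S c'" if "p \<in> \<Omega>" "\<And>u. u \<in> words r \<Longrightarrow> p \<notin> U u" for p
  proof -
    have "c (act u (fst p), snd p) = c' (act u (fst p), snd p)" if "u \<in> words r" for u
      using \<open>p \<in> \<Omega>\<close> that \<open>\<And>u. u \<in> words r \<Longrightarrow> p \<notin> U u\<close>[of u] lift_act[of "fst p" "snd p" u]
      by (auto simp: U_def B_def)
    then show ?thesis
      using ball_in_lift_cong[of "fst p" "snd p" r c c' F] \<open>p \<in> \<Omega>\<close> by (simp add: S_def)
  qed
  have UW: "(\<Union>u\<in>words r. U u) \<in> L.events" using U finite_words by (intro sets.finite_UN) auto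
  have half: "L.prob (S a) \<le> L.prob (S b) + L.prob (\<Union>u\<in>words r. U u)"
    if "S a \<subseteq> S b \<union> (\<Union>u\<in>words r. U u)" "S b \<in> L.events" for a b
  proof -
    have "L.prob (S a) \<le> L.prob (S b \<union> (\<Union>u\<in>words r. U u))"
      using that UW by (intro L.finite_measure_mono sets.Un)
    also have "\<dots> \<le> L.prob (S b) + L.prob (\<Union>u\<in>words r. U u)"
      by (rule measure_Un_le[OF that(2) UW])
    finally show ?thesis .
  qed
  have sub: "S c \<subseteq> S c' \<union> (\<Union>u\<in>words r. U u)" "S c' \<subseteq> S c \<union> (\<Union>u\<in>words r. U u)"
    using same by (auto simp: S_def)
  have "\<bar>L.prob (S c) - L.prob (S c')\<bar> \<le> L.prob (\<Union>u\<in>words r. U u)"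
    using half[OF sub(1) S[OF c']] half[OF sub(2) S[OF c]] by linarith
  also have "\<dots> \<le> (\<Sum>u\<in>words r. L.prob (U u))"
    using U finite_words by (intro L.finite_measure_subadditive_finite) auto
  also have "\<dots> \<le> (\<Sum>u\<in>words r. real (Suc d) ^ length u * L.prob B)"
  proof (rule sum_mono)
    fix u
    have "emeasure (lift_measure \<nu> E) (U u) \<le> of_nat (Suc d) ^ length u * emeasure (lift_measure \<nu> E) B"
      unfolding U_def using B by (intro act_emeasure_lift) simp
    also have "of_nat (Suc d) ^ length u = ennreal (real (Suc d) ^ length u)"
      by (simp only: ennreal_of_nat_eq_real_of_nat ennreal_power of_nat_0_le_iff)
    finally show "L.prob (U u) \<le> real (Suc d) ^ length u * L.prob B"
      by (simp add: L.emeasure_eq_measure ennreal_mult[symmetric] del: of_nat_Suc)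
  qed
  finally show ?thesis by (simp add: sum_distrib_right S_def B_def)
qed

theorem colouring_realisation:
  assumes "atom_free \<nu>" and c: "c \<in> measurable (lift_measure \<nu> E) (count_space {1..m})"
    and "m \<ge> 1" "finite FF" "\<epsilon> > 0"
  shows "\<exists>c'\<in>measurable \<nu> (count_space {1..m}). \<forall>F\<in>FF.
    \<bar>measure \<nu> {x\<in>space \<nu>. ball_in E r c' F x} -
      measure (lift_measure \<nu> E) {p\<in>\<Omega>. ball_in (lift_edges \<nu> E) r c F p}\<bar> < \<epsilon>"
proof -
  have cL: "c \<in> measurable (lift_algebra \<nu> E) (count_space {1..m})"
    using c measurable_cong_sets[OF sets_lift_measure refl, of "count_space {1..m}"] by simp
  define K where "K = (\<Sum>u\<in>words r. real (Suc d) ^ length u)"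
  have K: "K > 0"
    unfolding K_def using finite_words Nil_words by (intro sum_pos) auto
  \<comment> \<open>The loss in \<open>ball_perturbation\<close> is \<open>K\<close>; half of
    \<open>\<epsilon>\<close> is spent on the passage to finitely many weights and half on the
    choice of the cell weights.\<close>
  then have "\<epsilon> / (2 * K) > 0" using assms(5) by simp
  from colouring_approximation[OF cL assms(3) this] obtain Fs c1 where Fs: "finite Fs" "Fs \<subseteq> choices"
    and c1: "c1 \<in> measurable (lift_sub Fs) (count_space {1..m})"
    and c1_close: "measure (lift_measure \<nu> E) {p\<in>\<Omega>. c p \<noteq> c1 p} < \<epsilon> / (2 * K)" by blast
  define Gs where "Gs = (\<lambda>(u, f) x. f (act u x)) ` (words r \<times> Fs)"
  have Gs: "finite Gs" "Gs \<subseteq> choices"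
    using Fs finite_words choices_act by (auto simp: Gs_def)
  define T where "T F = {p\<in>\<Omega>. ball_in (lift_edges \<nu> E) r c1 F p}" for F
  have c1U: "c1 \<in> measurable (lift_sub Fs) (count_space UNIV)"
    using c1 by (rule measurable_count_space_UNIV)
  have T: "T F \<in> sets (lift_sub Gs)" for F
    unfolding T_def by (rule ball_in_lift_measurable[OF c1U]) (auto simp: Gs_def)
  have "c \<in> measurable (lift_sub choices) (count_space UNIV)"
    using measurable_count_space_UNIV[OF cL] by (simp only: lift_algebra_eq)
  moreover have "c1 \<in> measurable (lift_sub choices) (count_space UNIV)"
  proof -
    have "(\<lambda>p. p) \<in> measurable (lift_sub choices) (lift_sub Fs)"
      using Fs(2) by (intro measurable_into_lift_sub) (auto intro: fst_lift_sub weight_lift_sub)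
    from measurable_compose[OF this c1U] show ?thesis by simp
  qed
  ultimately have pert: "\<bar>measure (lift_measure \<nu> E) {p\<in>\<Omega>. ball_in (lift_edges \<nu> E) r c F p} -
      measure (lift_measure \<nu> E) (T F)\<bar> \<le> K * measure (lift_measure \<nu> E) {p\<in>\<Omega>. c p \<noteq> c1 p}" for F
    unfolding T_def K_def by (rule ball_perturbation)
  have "K * measure (lift_measure \<nu> E) {p\<in>\<Omega>. c p \<noteq> c1 p} < K * (\<epsilon> / (2 * K))"
    using c1_close K by (rule mult_strict_left_mono)
  also have "K * (\<epsilon> / (2 * K)) = \<epsilon> / 2" using K by simp
  finally have close1: "\<bar>measure (lift_measure \<nu> E) {p\<in>\<Omega>. ball_in (lift_edges \<nu> E) r c F p} -
      measure (lift_measure \<nu> E) (T F)\<bar> < \<epsilon> / 2" for F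
    using pert[of F] by linarith
  have "finite (T ` FF)" "T ` FF \<subseteq> sets (lift_sub Gs)" "\<epsilon> / 2 > 0" using assms(4,5) T by auto
  from weights_realising_frequencies[OF Gs assms(1) this] obtain n \<omega>
    where \<omega>: "\<omega> \<in> space weights"
      and close2: "\<And>F. F \<in> FF \<Longrightarrow> \<bar>frequency n (T F) \<omega> - measure (lift_measure \<nu> E) (T F)\<bar> < \<epsilon> / 2" by blast
  define c' where "c' x = c1 (drawn n x \<omega>)" for x
  have "(\<lambda>x. drawn n x \<omega>) \<in> measurable \<nu> (lift_sub Fs)"
    using measurable_compose[OF measurable_Pair2'[OF \<omega>] drawn_measurable[OF Fs(2), of n]] by simp
  then have "c' \<in> measurable \<nu> (count_space {1..m})"
    unfolding c'_def[abs_def] by (rule measurable_compose[OF _ c1])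
  moreover have "\<bar>measure \<nu> {x\<in>space \<nu>. ball_in E r c' F x} -
      measure (lift_measure \<nu> E) {p\<in>\<Omega>. ball_in (lift_edges \<nu> E) r c F p}\<bar> < \<epsilon>" if "F \<in> FF" for F
  proof -
    have "ball_in E r c' F x \<longleftrightarrow> drawn n x \<omega> \<in> T F" if x: "x \<in> space \<nu>" for x
    proof -
      define \<xi> where "\<xi> = (\<lambda>v\<in>component E x. \<omega> (cell n v))"
      have dr: "drawn n x \<omega> = (x, \<xi>)" by (simp add: labelled_def \<xi>_def)
      have in_lift: "(x, \<xi>) \<in> \<Omega>" using labelled_lift_space[OF x \<omega>, of "\<lambda>_. cell n"] dr by simp
      \<comment> \<open>Cell labels ignore the root and the component is unchanged, so all vertices
        of the ball read the same \<open>\<xi>\<close>; the ball in the base becomes the ball of the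
        lift at \<open>(x, \<xi>)\<close>.\<close>
      have "c' (act u x) = c1 (act u x, \<xi>)" for u
        by (simp add: c'_def labelled_def \<xi>_def component_act_eq[OF x])
      then show ?thesis
        using ball_in_lift[OF in_lift, of r c' c1 F] in_lift by (simp add: T_def dr)
    qed
    then have "{x\<in>space \<nu>. ball_in E r c' F x} = {x\<in>space \<nu>. drawn n x \<omega> \<in> T F}" by blast
    then have "measure \<nu> {x\<in>space \<nu>. ball_in E r c' F x} = frequency n (T F) \<omega>"
      by (simp add: frequency_def)
    then show ?thesis using close1[of F] close2[OF that] by linarith
  qed
  ultimately show ?thesis by blast
qed

lemma ball_distributions_closure:
  assumes "atom_free \<nu>" "m \<ge> 1"
  shows "ball_distributions D (lift_measure \<nu> E) (lift_edges \<nu> E) r m \<subseteq>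
    powertop_real (rc_classes D r m) closure_of ball_distributions D \<nu> E r m"
proof
  let ?I = "rc_classes D r m"
  fix y assume "y \<in> ball_distributions D (lift_measure \<nu> E) (lift_edges \<nu> E) r m"
  then obtain c where c: "c \<in> measurable (lift_measure \<nu> E) (count_space {1..m})"
    and y: "y = ball_distribution D (lift_measure \<nu> E) (lift_edges \<nu> E) r m c"
    unfolding ball_distributions_def by blast
  show "y \<in> powertop_real ?I closure_of ball_distributions D \<nu> E r m"
    unfolding in_closure_of
  proof (intro conjI allI impI)
    show "y \<in> topspace (powertop_real ?I)" by (simp add: y ball_distribution_def)
    fix V assume V: "y \<in> V \<and> openin (powertop_real ?I) V"
    then have "\<exists>U. finite {i \<in> ?I. U i \<noteq> topspace euclideanreal} \<and>
        (\<forall>i\<in>?I. openin euclideanreal (U i)) \<and> y \<in> Pi\<^sub>E ?I U \<and> Pi\<^sub>E ?I U \<subseteq> V"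
      unfolding openin_product_topology_alt by blast
    then obtain U where U: "finite {i \<in> ?I. U i \<noteq> UNIV}" "\<And>i. i \<in> ?I \<Longrightarrow> open (U i)"
        "y \<in> Pi\<^sub>E ?I U" "Pi\<^sub>E ?I U \<subseteq> V"
      unfolding topspace_euclidean open_openin[symmetric] by blast
    \<comment> \<open>A basic neighbourhood restricts finitely many coordinates, so only the classes
      in \<open>J\<close> have to be matched.\<close>
    define J where "J = {i \<in> ?I. U i \<noteq> UNIV}"
    have "\<exists>e>0. ball (y i) e \<subseteq> U i" if "i \<in> J" for i
      using U(2,3) that by (auto simp: J_def open_contains_ball PiE_iff)
    then obtain e where e: "\<And>i. i \<in> J \<Longrightarrow> e i > 0" "\<And>i. i \<in> J \<Longrightarrow> ball (y i) (e i) \<subseteq> U i" by metis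
    \<comment> \<open>Inserting 1 keeps the minimum meaningful when \<open>J\<close> is
      empty.\<close>
    define \<epsilon> where "\<epsilon> = Min (insert 1 (e ` J))"
    have J: "finite J" using U(1) by (simp add: J_def)
    have "\<epsilon> > 0" using J e(1) by (simp add: \<epsilon>_def)
    have \<epsilon>_le: "\<epsilon> \<le> e i" if "i \<in> J" for i using J that by (auto simp: \<epsilon>_def)
    from colouring_realisation[OF assms(1) c assms(2) J \<open>\<epsilon> > 0\<close>, of r] obtain c'
      where c': "c' \<in> measurable \<nu> (count_space {1..m})"
        and close: "\<And>F. F \<in> J \<Longrightarrow> \<bar>measure \<nu> {x\<in>space \<nu>. ball_in E r c' F x} -
          measure (lift_measure \<nu> E) {p\<in>\<Omega>. ball_in (lift_edges \<nu> E) r c F p}\<bar> < \<epsilon>" by blast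
    define z where "z = ball_distribution D \<nu> E r m c'"
    have "z \<in> Pi\<^sub>E ?I U"
    proof (rule PiE_I)
      fix i assume i: "i \<in> ?I"
      show "z i \<in> U i"
      proof (cases "i \<in> J")
        case True
        have "dist (y i) (z i) < \<epsilon>"
          using close[OF True] i
          by (simp add: y z_def ball_distribution_def ball_in_def dist_real_def abs_minus_commute)
        then show ?thesis using e(2)[OF True] \<epsilon>_le[OF True] by auto
      qed (use i in \<open>auto simp: J_def\<close>)
    qed (simp add: z_def ball_distribution_def)
    moreover have "z \<in> ball_distributions D \<nu> E r m"
      using c' by (simp add: z_def ball_distributions_def)
    ultimately show "\<exists>z. z \<in> ball_distributions D \<nu> E r m \<and> z \<in> V" using U(4) by blast
  qed
qed

theorem lift_local_global_equivalent:
  assumes "atom_free \<nu>"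
  shows "local_global_equivalent D \<nu> E (lift_measure \<nu> E) (lift_edges \<nu> E)"
  unfolding local_global_equivalent_def
proof (intro allI impI equalityI)
  fix r m :: nat assume "1 \<le> m"
  let ?cl = "\<lambda>A. powertop_real (rc_classes D r m) closure_of A"
  show "?cl (ball_distributions D \<nu> E r m) \<subseteq>
      ?cl (ball_distributions D (lift_measure \<nu> E) (lift_edges \<nu> E) r m)"
    by (rule closure_of_mono[OF ball_distributions_subset])
  show "?cl (ball_distributions D (lift_measure \<nu> E) (lift_edges \<nu> E) r m) \<subseteq>
      ?cl (ball_distributions D \<nu> E r m)"
    by (rule closure_of_minimal[OF ball_distributions_closure[OF assms \<open>1 \<le> m\<close>] closedin_closure_of])
qed

end

section \<open>Mass transport and the passage from graphings to enumerated graphs\<close>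

text \<open>Mass transport: every point that \<open>g\<close> moves into \<open>A\<close> from
  outside sends at least one edge into \<open>A\<close>. By invariance these edges may be counted
  from \<open>A\<close>, where each point has at most \<open>d\<close>.\<close>

lemma graphing_emeasure_vimage_le:
  assumes "graphing d X \<nu> E" and A: "A \<in> sets \<nu>" and g: "g \<in> measurable \<nu> \<nu>"
    and step: "\<And>x. x \<in> space \<nu> \<Longrightarrow> g x \<in> insert x (E `` {x})"
  shows "emeasure \<nu> (g -` A \<inter> space \<nu>) \<le> of_nat (Suc d) * emeasure \<nu> A"
proof -
  have deg: "finite (E `` {x}) \<and> card (E `` {x}) \<le> d" if "x \<in> space \<nu>" for x
    using assms(1) that by (auto simp: graphing_def degrees_le_def)
  have transport: "(\<integral>\<^sup>+x\<in>space \<nu>. of_nat (edges_to E x A) \<partial>\<nu>) =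
      (\<integral>\<^sup>+x\<in>A. of_nat (edges_to E x (space \<nu>)) \<partial>\<nu>)"
    using assms(1) A sets.top[of \<nu>] unfolding graphing_def by blast
  \<comment> \<open>Points of \<open>A\<close> may be fixed by \<open>g\<close> and then yield no
    edge. They are bounded by the measure of \<open>A\<close> itself, which accounts for the
    additional 1 in the factor.\<close>
  define S where "S = (g -` A \<inter> space \<nu>) - A"
  have gA: "g -` A \<inter> space \<nu> \<in> sets \<nu>" by (rule measurable_sets[OF g A])
  have S: "S \<in> sets \<nu>" unfolding S_def by (rule sets.Diff[OF gA A])
  have "emeasure \<nu> S = (\<integral>\<^sup>+x. indicator S x \<partial>\<nu>)" using S by simp
  also have "\<dots> \<le> (\<integral>\<^sup>+x\<in>space \<nu>. of_nat (edges_to E x A) \<partial>\<nu>)"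
  proof (rule nn_integral_mono)
    fix x assume x: "x \<in> space \<nu>"
    show "indicator S x \<le> of_nat (edges_to E x A) * (indicator (space \<nu>) x :: ennreal)"
    proof (cases "x \<in> S")
      case True
      then have "g x \<in> E `` {x} \<inter> A" using step[OF x] by (auto simp: S_def)
      moreover have "finite (E `` {x} \<inter> A)" using deg[OF x] by simp
      ultimately have "1 \<le> edges_to E x A"
        unfolding edges_to_def by (metis One_nat_def Suc_leI card_gt_0_iff empty_iff)
      then have "of_nat 1 \<le> (of_nat (edges_to E x A) :: ennreal)" by (rule of_nat_mono)
      then show ?thesis using True x by simp
    qed simp
  qed
  also have "\<dots> \<le> (\<integral>\<^sup>+x. of_nat d * indicator A x \<partial>\<nu>)"
    unfolding transport
  proof (rule nn_integral_mono)
    fix x assume x: "x \<in> space \<nu>"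
    have "edges_to E x (space \<nu>) \<le> d"
      unfolding edges_to_def using deg[OF x] by (meson Int_lower1 card_mono le_trans)
    then show "of_nat (edges_to E x (space \<nu>)) * indicator A x \<le> (of_nat d * indicator A x :: ennreal)"
      by (intro mult_right_mono) simp_all
  qed
  also have "\<dots> = of_nat d * emeasure \<nu> A" using A by (simp add: nn_integral_cmult_indicator)
  finally have *: "emeasure \<nu> S \<le> of_nat d * emeasure \<nu> A" .
  have "emeasure \<nu> (g -` A \<inter> space \<nu>) \<le> emeasure \<nu> (A \<union> S)"
  proof (rule emeasure_mono)
    show "g -` A \<inter> space \<nu> \<subseteq> A \<union> S" by (auto simp: S_def)
    show "A \<union> S \<in> sets \<nu>" by (rule sets.Un[OF A S])
  qed
  also have "\<dots> \<le> emeasure \<nu> A + emeasure \<nu> S" by (rule emeasure_subadditive[OF A S])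
  also have "\<dots> \<le> emeasure \<nu> A + of_nat d * emeasure \<nu> A" by (rule add_left_mono[OF *])
  also have "\<dots> = of_nat (Suc d) * emeasure \<nu> A" by (simp add: distrib_right)
  finally show ?thesis .
qed

theorem theorem7p6:
  fixes d :: nat and X :: "'a topology" and \<nu> :: "'a measure" and E :: "('a \<times> 'a) set"
  assumes "d \<ge> 1"
    and "graphing d X \<nu> E"
    and "atom_free \<nu>"
  shows "local_global_equivalent d \<nu> E (lift_measure \<nu> E) (lift_edges \<nu> E)"
proof -
  interpret prob_space \<nu> using assms(2) by (simp add: graphing_def)
  have "\<exists>h k. h \<in> measurable \<nu> (seqs :: (nat \<Rightarrow> nat) measure) \<and> k \<in> measurable seqs \<nu> \<and>
      (\<forall>x\<in>space \<nu>. k (h x) = x)"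
    using assms(2) not_empty by (intro polish_retract_of_seqs[of X]) (auto simp: graphing_def)
  then obtain h :: "'a \<Rightarrow> nat \<Rightarrow> nat" and k where "h \<in> measurable \<nu> seqs"
    "k \<in> measurable seqs \<nu>" "\<And>x. x \<in> space \<nu> \<Longrightarrow> k (h x) = x" by blast
  then interpret seqs_retract \<nu> h k by (rule seqs_retract.intro)
  have E: "E \<in> sets (\<nu> \<Otimes>\<^sub>M \<nu>)" using assms(2) by (simp add: graphing_def)
  have deg: "finite (E `` {x}) \<and> card (E `` {x}) \<le> d" if "x \<in> space \<nu>" for x
    using assms(2) that by (auto simp: graphing_def degrees_le_def)
  have "\<exists>g. (\<forall>i. g i \<in> measurable \<nu> \<nu>) \<and>
      (\<forall>x\<in>space \<nu>. insert x (E `` {x}) = insert x ((\<lambda>i. g i x) ` {..<d}))"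
    by (rule measurable_enumeration[OF E deg])
  then obtain g where g: "\<And>i. g i \<in> measurable \<nu> \<nu>"
      "\<And>x. x \<in> space \<nu> \<Longrightarrow> insert x (E `` {x}) = insert x ((\<lambda>i. g i x) ` {..<d})"
    by (elim exE conjE) (rule that, simp_all)
  \<comment> \<open>Nothing is known about the enumeration at indices from \<open>d\<close> on; the
    identity is put there to meet \<open>g_id\<close>.\<close>
  define g' where "g' i = (if i < d then g i else (\<lambda>x. x))" for i
  have g': "g' i \<in> measurable \<nu> \<nu>" for i using g(1) by (simp add: g'_def)
  have im: "(\<lambda>i. g' i x) ` {..<d} = (\<lambda>i. g i x) ` {..<d}" for x
    by (rule image_cong) (simp_all add: g'_def)
  have step: "g' i x \<in> insert x (E `` {x})" if "x \<in> space \<nu>" for i x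
    using g(2)[OF that] by (auto simp: g'_def)
  interpret enumerated_graph \<nu> h k E g' d
  proof
    show "E \<in> sets (\<nu> \<Otimes>\<^sub>M \<nu>)" by (rule E)
    show "sym E" using assms(2) by (simp add: graphing_def simple_graph_def)
    show "g' i \<in> measurable \<nu> \<nu>" for i by (rule g')
    show "insert x (E `` {x}) = insert x ((\<lambda>i. g' i x) ` {..<d})" if "x \<in> space \<nu>" for x
      unfolding im by (rule g(2)[OF that])
    show "g' i x = x" if "d \<le> i" for i x using that by (simp add: g'_def)
    show "emeasure \<nu> (g' i -` A \<inter> space \<nu>) \<le> of_nat (Suc d) * emeasure \<nu> A" if "A \<in> sets \<nu>" for A i
      by (rule graphing_emeasure_vimage_le[OF assms(2) that g' step])
  qed
  show ?thesis by (rule lift_local_global_equivalent[OF assms(3)])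
qed

end
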